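(* Let $V,W$ be $n$-graded vector spaces and $E$ the $(n+1)$-graded vector space with $E^{(0,* )}=V$, $E^{(1,* )}=W$, $E^{(k,* )}=0$ otherwise. Let $P\in A^{(1,0,\dots,0)}(E)$, and put $\mu(X_1,X_2)=P(X_1,X_2)\in V$ and $\pi(X)Y=P(X,Y)\in W$ for $X,X_1,X_2\in V$, $Y\in W$. (1) $[P,P]^{\wedge}=0$ if and only if (a) $[\mu,\mu]^{\wedge}=0$, so that $\mathfrak g=(V,\mu)$ is a multigraded Lie algebra, and (b) $\pi(\mu(X_1,X_2))Y=[\pi(X_1),\pi(X_2)]Y$ for all $X_1,X_2\in V$, $Y\in W$, where $[\ ,\ ]$ is the multigraded commutator in $\operatorname{End}(W)$. (That is, by definition, $\mathcal M=(W,\pi)$ is a multigraded Lie-$\mathfrak g$-module.) (2) If $[P,P]^{\wedge}=0$, then $\partial_P=[P,\cdot]^{\wedge}:A(E)\to A(E)$ is a differential (its square is $0$), and it restricts to $\Lambda(\mathfrak g,\mathcal M)=\bigoplus_{k}\Lambda^{(k,* )}(\mathfrak g,\mathcal M)$, where for $C\in\Lambda^{(k,c)}(\mathfrak g,\mathcal M)$ and $X_i\in V^{x_i}$ $$(\partial_PC)(X_0,\dots,X_k)=-\Bigl[\sum_{i=0}^k(-1)^{\alpha_i(\mathbf x)+\langle x_i,c\rangle}\pi(X_i)C(X_0,\dots,\widehat{X_i},\dots,X_k)+\sum_{i<j}(-1)^{\alpha_{ij}(\mathbf x)}C(\mu(X_i,X_j),X_0,\dots,\widehat{X_i},\dots,\widehat{X_j},\dots,X_k)\Bigr],$$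 with $\alpha_i(\mathbf x)=\langle x_i,x_0+\dots+x_{i-1}\rangle+i$ and $\alpha_{ij}(\mathbf x)=\alpha_i(\mathbf x)+\alpha_j(\mathbf x)+\langle x_i,x_j\rangle$. (3) Suppose $[P,P]^{\wedge}=0$, let $\nu:W\times W\to W$ be multigraded symmetric (so $\nu\in A^{(1,-1,* )}(E)$), and suppose $[P,\nu]^{\wedge}=0$. Put $C_1\bullet C_2=[C_1,[C_2,\nu]^{\wedge}]^{\wedge}$ for $C_i\in\Lambda^{(k_i,c_i)}(\mathfrak g,\mathcal M)$. Then $(\Lambda(\mathfrak g,\mathcal M),\bullet)$ is multigraded commutative, i.e. $C_1\bullet C_2=(-1)^{(k_1-1)(k_2-1)+1+\langle c_1,c_2\rangle}C_2\bullet C_1$, and $\partial_P$ acts on it as a derivation of multidegree $(1,0,\dots,0)$, i.e. $\partial_P(C_1\bullet C_2)=\partial_PC_1\bullet C_2+(-1)^{k_1-1}C_1\bullet\partial_PC_2$. In this situation $\bullet$ induces a well-defined multigraded symmetric product (same sign rule) on the cohomology $H(\mathfrak g,\mathcal M)=\ker\partial_P/\operatorname{im}\partial_P$ of $(\Lambda(\mathfrak g,\mathcal M),\partial_P)$.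
   Context: All vector spaces are over a field $\mathbb K$ of characteristic $0$. For $x,y\in\mathbb Z^m$ put $\langle x,y\rangle=\sum_i x^iy^i$. An $m$-graded vector space is $U=\bigoplus_{x\in\mathbb Z^m}U^x$; the degree of a homogeneous $X_i$ is denoted $x_i$. An $m$-graded Lie algebra is an $m$-graded space with bilinear bracket adding degrees such that $[X,Y]=-(-1)^{\langle x,y\rangle}[Y,X]$ and $[X,[Y,Z]]=[[X,Y],Z]+(-1)^{\langle x,y\rangle}[Y,[X,Z]]$. $\operatorname{End}(W)=\bigoplus_\delta\operatorname{End}^\delta(W)$, with $\operatorname{End}^\delta(W)$ the linear maps $D$ with $D(W^x)\subseteq W^{x+\delta}$; the multigraded commutator is $[D_1,D_2]=D_1D_2-(-1)^{\langle\delta_1,\delta_2\rangle}D_2D_1$ for $D_i\in\operatorname{End}^{\delta_i}(W)$. For an $m$-graded space $U$: $M^{(k,\kappa)}(U)$ is the space of $(k+1)$-linear maps $K:U\times\dots\times U\to U$ with $K(U^{x_0}\times\dots\times U^{x_k})\subseteq U^{x_0+\dots+x_k+\kappa}$ ($M^{(-1,\kappa)}(U)=U^\kappa$; zero for $k<-1$). For $K_i\in M^{(k_i,\kappa_i)}(U)$, $$(j(K_1)K_2)(X_0,\dots,X_{k_1+k_2})=\sum_{i=0}^{k_2}(-1)^{k_1i+\langle\kappa_1,\kappa_2+x_0+\dots+x_{i-1}\rangle}K_2(X_0,\dots,K_1(X_i,\dots,X_{i+k_1}),\dots,X_{k_1+k_2})$$ (zero if $k_2=-1$). For $\mathbf x=(x_0,\dots,x_k)$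 and a permutation $\sigma$ of $\{0,\dots,k\}$, $\operatorname{sign}(\sigma,\mathbf x)=\prod_{i<j,\ \sigma i>\sigma j}\bigl(-(-1)^{\langle x_{\sigma i},x_{\sigma j}\rangle}\bigr)$; $(\alpha K)(X_0,\dots,X_k)=\frac1{(k+1)!}\sum_{\sigma\in\mathcal S_{k+1}}\operatorname{sign}(\sigma,\mathbf x)K(X_{\sigma0},\dots,X_{\sigma k})$; $A^{(k,\kappa)}(U)=\alpha(M^{(k,\kappa)}(U))$, $A(U)=\bigoplus_{(k,\kappa)}A^{(k,\kappa)}(U)$; and for $K_i\in A^{(k_i,\kappa_i)}(U)$, $$i(K_1)K_2=\frac{(k_1+k_2+1)!}{(k_1+1)!(k_2+1)!}\,\alpha(j(K_1)K_2),\qquad [K_1,K_2]^{\wedge}=i(K_1)K_2-(-1)^{k_1k_2+\langle\kappa_1,\kappa_2\rangle}i(K_2)K_1$$ (with $i(K_1)K_2=0$ if $k_2=-1$). $A(U)$ is an $(m+1)$-graded Lie algebra. For $E$ as in the claim, elements of $A(E)$ have multidegree $(k,q,\kappa)$ with $k$ the form degree and $(q,\kappa)\in\mathbb Z\times\mathbb Z^n$ the weight; $*$ in place of $\kappa$ means the direct sum over all $\kappa\in\mathbb Z^n$. $\Lambda^{(k,c)}(\mathfrak g,\mathcal M)=A^{(k-1,1,c)}(E)$, the space of multigraded alternating $k$-linear maps $V\times\dots\times V\to W$ of weight $c$ (for $k=0$: $W^c$). Multidegrees in the sign rules for $\bullet$ are those in $A(E)$, i.e. $(k-1,1,c)$.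 "Multigraded symmetric" for $\nu$ means $\nu(Y_1,Y_2)=(-1)^{\langle y_1,y_2\rangle}\nu(Y_2,Y_1)$ for $Y_i\in W^{y_i}$; $\nu$ is extended by zero to $E\times E$. $\widehat{\ }$ denotes omission. *)

theory Defs
  imports Complex_Main "HOL-Library.Function_Algebras" "HOL-Library.Product_Plus"
    "HOL-Combinatorics.Permutations"
begin

section \<open>Multigraded vector spaces\<close>

text \<open>
  An element of \<open>\<int>\<^sup>m\<close> is an integer sequence that vanishes from position \<open>m\<close> on, so that
  \<open>m = 0\<close> is allowed and degrees are added pointwise.
\<close>

type_synonym mdeg = "nat \<Rightarrow> int"

definition degs :: "nat \<Rightarrow> mdeg set" where
  "degs m = {x. \<forall>i\<ge>m. x i = 0}"

definition pairing :: "nat \<Rightarrow> mdeg \<Rightarrow> mdeg \<Rightarrow> int" where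
  "pairing m x y = (\<Sum>i<m. x i * y i)"

text \<open>\<open>dcons q \<kappa>\<close> is the degree \<open>(q, \<kappa>) \<in> \<int> \<times> \<int>\<^sup>n = \<int>\<^bsup>n+1\<^esup>\<close>.\<close>

definition dcons :: "int \<Rightarrow> mdeg \<Rightarrow> mdeg" where
  "dcons q x = case_nat q x"

text \<open>
  \<open>decomposes G v f\<close>: \<open>v\<close> is the sum of the finitely many nonzero \<open>f d \<in> G d\<close>. If the sum of the
  subspaces \<open>G d\<close> is direct, \<open>hcomp G v d\<close> is the component of \<open>v \<in> dsum G\<close> in \<open>G d\<close>.
\<close>

definition decomposes :: "('i \<Rightarrow> 'a::comm_monoid_add set) \<Rightarrow> 'a \<Rightarrow> ('i \<Rightarrow> 'a) \<Rightarrow> bool" where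
  "decomposes G v f \<longleftrightarrow>
     finite {d. f d \<noteq> 0} \<and> (\<forall>d. f d \<in> G d) \<and> v = (\<Sum>d | f d \<noteq> 0. f d)"

definition dsum :: "('i \<Rightarrow> 'a::comm_monoid_add set) \<Rightarrow> 'a set" where
  "dsum G = {v. \<exists>f. decomposes G v f}"

definition hcomp :: "('i \<Rightarrow> 'a::comm_monoid_add set) \<Rightarrow> 'a \<Rightarrow> 'i \<Rightarrow> 'a" where
  "hcomp G v = (THE f. decomposes G v f)"

definition hsupp :: "('i \<Rightarrow> 'a::comm_monoid_add set) \<Rightarrow> 'a \<Rightarrow> 'i set" where
  "hsupp G v = {d. hcomp G v d \<noteq> 0}"

record ('k, 'u) gspace =
  gdim :: nat
  gscale :: "'k \<Rightarrow> 'u \<Rightarrow> 'u"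
  gpart :: "mdeg \<Rightarrow> 'u set"

definition graded_space :: "('k::field_char_0, 'u::ab_group_add) gspace \<Rightarrow> bool" where
  "graded_space U \<longleftrightarrow>
     vector_space (gscale U) \<and>
     (\<forall>x. module.subspace (gscale U) (gpart U x)) \<and>
     (\<forall>x. x \<notin> degs (gdim U) \<longrightarrow> gpart U x = {0}) \<and>
     (\<forall>v. \<exists>!f. decomposes (gpart U) v f)"

text \<open>The \<open>(n+1)\<close>-graded space \<open>E\<close> with \<open>E\<^bsup>(0,*)\<^esup> = V\<close>, \<open>E\<^bsup>(1,*)\<^esup> = W\<close>, and zero otherwise.\<close>

definition Egr :: "('k, 'v::zero) gspace \<Rightarrow> ('k, 'w::zero) gspace \<Rightarrow> ('k, 'v \<times> 'w) gspace" where
  "Egr V W =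
     \<lparr>gdim = Suc (gdim V),
      gscale = (\<lambda>a e. (gscale V a (fst e), gscale W a (snd e))),
      gpart = (\<lambda>d. if d 0 = 0 then gpart V (\<lambda>i. d (Suc i)) \<times> {0}
                   else if d 0 = 1 then {0} \<times> gpart W (\<lambda>i. d (Suc i))
                   else {(0, 0)})\<rparr>"

section \<open>Endomorphisms and modules\<close>

definition End_part :: "('k::field_char_0, 'u::ab_group_add) gspace \<Rightarrow> mdeg \<Rightarrow> ('u \<Rightarrow> 'u) set" where
  "End_part W \<delta> = {D. Vector_Spaces.linear (gscale W) (gscale W) D \<and>
                     (\<forall>x. D ` gpart W x \<subseteq> gpart W (x + \<delta>))}"

text \<open>The multigraded commutator, extended bilinearly to \<open>End(W) = dsum (End_part W)\<close>.\<close>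

definition gcomm :: "('k::field_char_0, 'u::ab_group_add) gspace \<Rightarrow> ('u \<Rightarrow> 'u) \<Rightarrow> ('u \<Rightarrow> 'u) \<Rightarrow> 'u \<Rightarrow> 'u" where
  "gcomm W D1 D2 =
     (\<Sum>\<delta>1\<in>hsupp (End_part W) D1. \<Sum>\<delta>2\<in>hsupp (End_part W) D2.
        (\<lambda>Y. hcomp (End_part W) D1 \<delta>1 (hcomp (End_part W) D2 \<delta>2 Y)
           - gscale W ((-1) powi pairing (gdim W) \<delta>1 \<delta>2)
               (hcomp (End_part W) D2 \<delta>2 (hcomp (End_part W) D1 \<delta>1 Y))))"

definition graded_lie_algebra ::
    "('k::field_char_0, 'u::ab_group_add) gspace \<Rightarrow> ('u \<Rightarrow> 'u \<Rightarrow> 'u) \<Rightarrow> bool" where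
  "graded_lie_algebra V br \<longleftrightarrow>
     graded_space V \<and>
     (\<forall>X. Vector_Spaces.linear (gscale V) (gscale V) (\<lambda>Y. br X Y)) \<and>
     (\<forall>Y. Vector_Spaces.linear (gscale V) (gscale V) (\<lambda>X. br X Y)) \<and>
     (\<forall>x y X Y. X \<in> gpart V x \<longrightarrow> Y \<in> gpart V y \<longrightarrow>
        br X Y \<in> gpart V (x + y) \<and>
        br X Y = - gscale V ((-1) powi pairing (gdim V) x y) (br Y X)) \<and>
     (\<forall>x y z X Y Z. X \<in> gpart V x \<longrightarrow> Y \<in> gpart V y \<longrightarrow> Z \<in> gpart V z \<longrightarrow>
        br X (br Y Z) =
          br (br X Y) Z + gscale V ((-1) powi pairing (gdim V) x y) (br Y (br X Z)))"

definition graded_lie_module ::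
    "('k::field_char_0, 'v::ab_group_add) gspace \<Rightarrow> ('v \<Rightarrow> 'v \<Rightarrow> 'v) \<Rightarrow>
     ('k, 'w::ab_group_add) gspace \<Rightarrow> ('v \<Rightarrow> 'w \<Rightarrow> 'w) \<Rightarrow> bool" where
  "graded_lie_module V br W act \<longleftrightarrow>
     graded_lie_algebra V br \<and> graded_space W \<and> gdim W = gdim V \<and>
     (\<forall>Y. Vector_Spaces.linear (gscale V) (gscale W) (\<lambda>X. act X Y)) \<and>
     (\<forall>x. \<forall>X\<in>gpart V x. act X \<in> End_part W x) \<and>
     (\<forall>X1 X2 Y. act (br X1 X2) Y = gcomm W (act X1) (act X2) Y)"

section \<open>The multigraded Nijenhuis-Richardson algebra\<close>

text \<open>
  A \<open>p\<close>-linear map is encoded as a function on lists which vanishes on lists of length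
  different from \<open>p\<close>; maps of different arity are thus linearly independent, and direct sums
  over the form degree are formed inside one function space.
\<close>

definition multilinear :: "('k::field, 'u::ab_group_add) gspace \<Rightarrow> nat \<Rightarrow> ('u list \<Rightarrow> 'u) \<Rightarrow> bool" where
  "multilinear U p K \<longleftrightarrow>
     (\<forall>xs. length xs \<noteq> p \<longrightarrow> K xs = 0) \<and>
     (\<forall>xs i. length xs = p \<longrightarrow> i < p \<longrightarrow>
        Vector_Spaces.linear (gscale U) (gscale U) (\<lambda>v. K (xs[i := v])))"

text \<open>\<open>M\<^bsup>(k,\<kappa>)\<^esup>(U)\<close>; the form degree \<open>k\<close> is one less than the arity.\<close>

definition multi_maps :: "('k::field, 'u::ab_group_add) gspace \<Rightarrow> int \<times> mdeg \<Rightarrow> ('u list \<Rightarrow> 'u) set" where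
  "multi_maps U = (\<lambda>(k, \<kappa>).
     if k < -1 then {0}
     else {K. multilinear U (nat (k + 1)) K \<and>
              (\<forall>xs ds. length xs = nat (k + 1) \<longrightarrow> list_all2 (\<lambda>X x. X \<in> gpart U x) xs ds \<longrightarrow>
                 K xs \<in> gpart U (sum_list ds + \<kappa>))})"

text \<open>
  Multilinear extension of an expression \<open>f ds xs\<close> given only for lists \<open>xs\<close> of homogeneous elements
  of degrees \<open>ds\<close>.
\<close>

definition hom_ext ::
    "('k, 'u::ab_group_add) gspace \<Rightarrow> (mdeg list \<Rightarrow> 'u list \<Rightarrow> 'u) \<Rightarrow> 'u list \<Rightarrow> 'u" where
  "hom_ext U f xs =
     (\<Sum>ds\<in>listset (map (hsupp (gpart U)) xs). f ds (map2 (hcomp (gpart U)) xs ds))"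

text \<open>
  \<open>insertion U d1 K1 d2 K2\<close> is \<open>j(K\<^sub>1)K\<^sub>2\<close>, where \<open>d1\<close>, \<open>d2\<close> are the multidegrees of \<open>K1\<close>, \<open>K2\<close>.
\<close>

definition insertion ::
    "('k::field_char_0, 'u::ab_group_add) gspace \<Rightarrow> int \<times> mdeg \<Rightarrow> ('u list \<Rightarrow> 'u) \<Rightarrow>
     int \<times> mdeg \<Rightarrow> ('u list \<Rightarrow> 'u) \<Rightarrow> 'u list \<Rightarrow> 'u" where
  "insertion U = (\<lambda>(k1, \<kappa>1) K1 (k2, \<kappa>2) K2 Xs.
     if k2 = -1 \<or> int (length Xs) \<noteq> k1 + k2 + 1 then 0
     else hom_ext U (\<lambda>xs Ys. \<Sum>i\<le>nat k2.
            gscale U ((-1) powi (k1 * int i + pairing (gdim U) \<kappa>1 (\<kappa>2 + sum_list (take i xs))))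
              (K2 (take i Ys @ [K1 (take (nat (k1 + 1)) (drop i Ys))]
                   @ drop (i + nat (k1 + 1)) Ys))) Xs)"

definition koszul_sign :: "nat \<Rightarrow> (nat \<Rightarrow> nat) \<Rightarrow> mdeg list \<Rightarrow> 'k::field_char_0" where
  "koszul_sign m \<sigma> xs =
     (\<Prod>(i, j)\<in>{(i, j). i < j \<and> j < length xs \<and> \<sigma> i > \<sigma> j}.
        - ((-1) powi pairing m (xs ! \<sigma> i) (xs ! \<sigma> j)))"

text \<open>The alternator \<open>\<alpha>\<close>; the list passed to \<open>K\<close> is \<open>X\<^bsub>\<sigma> 0\<^esub>, \<dots>, X\<^bsub>\<sigma> k\<^esub>\<close>.\<close>

definition alternator ::
    "('k::field_char_0, 'u::ab_group_add) gspace \<Rightarrow> ('u list \<Rightarrow> 'u) \<Rightarrow> 'u list \<Rightarrow> 'u" where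
  "alternator U K =
     hom_ext U (\<lambda>xs Ys. gscale U (1 / fact (length Ys))
       (\<Sum>\<sigma> | \<sigma> permutes {..<length Ys}.
          gscale U (koszul_sign (gdim U) \<sigma> xs) (K (permute_list \<sigma> Ys))))"

definition alt_maps ::
    "('k::field_char_0, 'u::ab_group_add) gspace \<Rightarrow> int \<times> mdeg \<Rightarrow> ('u list \<Rightarrow> 'u) set" where
  "alt_maps U d = alternator U ` multi_maps U d"

abbreviation alt_algebra :: "('k::field_char_0, 'u::ab_group_add) gspace \<Rightarrow> ('u list \<Rightarrow> 'u) set" where
  "alt_algebra U \<equiv> dsum (alt_maps U)"

definition map_scale :: "('k, 'u) gspace \<Rightarrow> 'k \<Rightarrow> ('u list \<Rightarrow> 'u) \<Rightarrow> 'u list \<Rightarrow> 'u" where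
  "map_scale U a K = (\<lambda>Xs. gscale U a (K Xs))"

definition alt_insertion ::
    "('k::field_char_0, 'u::ab_group_add) gspace \<Rightarrow> int \<times> mdeg \<Rightarrow> ('u list \<Rightarrow> 'u) \<Rightarrow>
     int \<times> mdeg \<Rightarrow> ('u list \<Rightarrow> 'u) \<Rightarrow> 'u list \<Rightarrow> 'u" where
  "alt_insertion U d1 K1 d2 K2 =
     (if fst d2 = -1 then 0
      else map_scale U
             (fact (nat (fst d1 + fst d2 + 1)) / (fact (nat (fst d1 + 1)) * fact (nat (fst d2 + 1))))
             (alternator U (insertion U d1 K1 d2 K2)))"

definition nr_bracket_hom ::
    "('k::field_char_0, 'u::ab_group_add) gspace \<Rightarrow> int \<times> mdeg \<Rightarrow> ('u list \<Rightarrow> 'u) \<Rightarrow>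
     int \<times> mdeg \<Rightarrow> ('u list \<Rightarrow> 'u) \<Rightarrow> 'u list \<Rightarrow> 'u" where
  "nr_bracket_hom U d1 K1 d2 K2 =
     alt_insertion U d1 K1 d2 K2
     - map_scale U ((-1) powi (fst d1 * fst d2 + pairing (gdim U) (snd d1) (snd d2)))
         (alt_insertion U d2 K2 d1 K1)"

text \<open>The bracket \<open>[ , ]\<^sup>\<and>\<close>, extended bilinearly to \<open>A(U)\<close>.\<close>

definition nr_bracket ::
    "('k::field_char_0, 'u::ab_group_add) gspace \<Rightarrow> ('u list \<Rightarrow> 'u) \<Rightarrow> ('u list \<Rightarrow> 'u) \<Rightarrow> 'u list \<Rightarrow> 'u" where
  "nr_bracket U K L =
     (\<Sum>d\<in>hsupp (alt_maps U) K. \<Sum>e\<in>hsupp (alt_maps U) L.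
        nr_bracket_hom U d (hcomp (alt_maps U) K d) e (hcomp (alt_maps U) L e))"

section \<open>The structure map, cochains and cohomology\<close>

definition inV :: "'v \<Rightarrow> 'v \<times> 'w::zero" where "inV X = (X, 0)"
definition inW :: "'w \<Rightarrow> 'v::zero \<times> 'w" where "inW Y = (0, Y)"

definition mult_of :: "(('v \<times> 'w::zero) list \<Rightarrow> 'v \<times> 'w) \<Rightarrow> 'v list \<Rightarrow> 'v" where
  "mult_of P Xs = fst (P (map inV Xs))"

definition act_of :: "(('v::zero \<times> 'w::zero) list \<Rightarrow> 'v \<times> 'w) \<Rightarrow> 'v \<Rightarrow> 'w \<Rightarrow> 'w" where
  "act_of P X Y = snd (P [inV X, inW Y])"

text \<open>The value in \<open>W\<close> of an element of \<open>\<Lambda>\<close> on arguments from \<open>V\<close>.\<close>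

definition cochain_eval :: "(('v \<times> 'w::zero) list \<Rightarrow> 'v \<times> 'w) \<Rightarrow> 'v list \<Rightarrow> 'w" where
  "cochain_eval C Xs = snd (C (map inV Xs))"

definition Lam ::
    "('k::field_char_0, 'v::ab_group_add) gspace \<Rightarrow> ('k, 'w::ab_group_add) gspace \<Rightarrow>
     nat \<times> mdeg \<Rightarrow> (('v \<times> 'w) list \<Rightarrow> 'v \<times> 'w) set" where
  "Lam V W = (\<lambda>(k, c). alt_maps (Egr V W) (int k - 1, dcons 1 c))"

abbreviation Lambda ::
    "('k::field_char_0, 'v::ab_group_add) gspace \<Rightarrow> ('k, 'w::ab_group_add) gspace \<Rightarrow>
     (('v \<times> 'w) list \<Rightarrow> 'v \<times> 'w) set" where
  "Lambda V W \<equiv> dsum (Lam V W)"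

definition bd ::
    "('k::field_char_0, 'v::ab_group_add) gspace \<Rightarrow> ('k, 'w::ab_group_add) gspace \<Rightarrow>
     (('v \<times> 'w) list \<Rightarrow> 'v \<times> 'w) \<Rightarrow> (('v \<times> 'w) list \<Rightarrow> 'v \<times> 'w) \<Rightarrow> ('v \<times> 'w) list \<Rightarrow> 'v \<times> 'w" where
  "bd V W P = nr_bracket (Egr V W) P"

definition alpha1 :: "nat \<Rightarrow> mdeg list \<Rightarrow> nat \<Rightarrow> int" where
  "alpha1 n xs i = pairing n (xs ! i) (sum_list (take i xs)) + int i"

definition alpha2 :: "nat \<Rightarrow> mdeg list \<Rightarrow> nat \<Rightarrow> nat \<Rightarrow> int" where
  "alpha2 n xs i j = alpha1 n xs i + alpha1 n xs j + pairing n (xs ! i) (xs ! j)"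

text \<open>A linear endomorphism of the space of maps \<open>A\<close> with square zero.\<close>

definition differential_on ::
    "('k \<Rightarrow> 'a \<Rightarrow> 'a) \<Rightarrow> 'a::ab_group_add set \<Rightarrow> ('a \<Rightarrow> 'a) \<Rightarrow> bool" where
  "differential_on sc A D \<longleftrightarrow>
     D ` A \<subseteq> A \<and>
     (\<forall>F\<in>A. \<forall>G\<in>A. D (F + G) = D F + D G) \<and>
     (\<forall>a. \<forall>F\<in>A. D (sc a F) = sc a (D F)) \<and>
     (\<forall>F\<in>A. D (D F) = 0)"

definition bilinear_product ::
    "'a set \<Rightarrow> ('a \<Rightarrow> 'a \<Rightarrow> 'a) \<Rightarrow> ('k \<Rightarrow> 'a \<Rightarrow> 'a) \<Rightarrow> ('a \<Rightarrow> 'a \<Rightarrow> 'a) \<Rightarrow> bool" where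
  "bilinear_product A add sc pr \<longleftrightarrow>
     (\<forall>a\<in>A. \<forall>b\<in>A. pr a b \<in> A) \<and>
     (\<forall>a\<in>A. \<forall>b\<in>A. \<forall>c\<in>A.
        pr (add a b) c = add (pr a c) (pr b c) \<and> pr c (add a b) = add (pr c a) (pr c b)) \<and>
     (\<forall>r. \<forall>a\<in>A. \<forall>b\<in>A. pr (sc r a) b = sc r (pr a b) \<and> pr a (sc r b) = sc r (pr a b))"

text \<open>Extension by zero to \<open>E\<close> of a multilinear map on \<open>W\<close>.\<close>

definition extW :: "('w list \<Rightarrow> 'w) \<Rightarrow> ('v::zero \<times> 'w) list \<Rightarrow> 'v \<times> 'w" where
  "extW \<nu> es = inW (\<nu> (map snd es))"

definition graded_symmetric ::
    "('k::field_char_0, 'w::ab_group_add) gspace \<Rightarrow> ('w list \<Rightarrow> 'w) \<Rightarrow> bool" where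
  "graded_symmetric W \<nu> \<longleftrightarrow>
     (\<forall>y1 y2 Y1 Y2. Y1 \<in> gpart W y1 \<longrightarrow> Y2 \<in> gpart W y2 \<longrightarrow>
        \<nu> [Y1, Y2] = gscale W ((-1) powi pairing (gdim W) y1 y2) (\<nu> [Y2, Y1]))"

definition bullet ::
    "('k::field_char_0, 'v::ab_group_add) gspace \<Rightarrow> ('k, 'w::ab_group_add) gspace \<Rightarrow> ('w list \<Rightarrow> 'w) \<Rightarrow>
     (('v \<times> 'w) list \<Rightarrow> 'v \<times> 'w) \<Rightarrow> (('v \<times> 'w) list \<Rightarrow> 'v \<times> 'w) \<Rightarrow> ('v \<times> 'w) list \<Rightarrow> 'v \<times> 'w" where
  "bullet V W \<nu> C1 C2 = nr_bracket (Egr V W) C1 (nr_bracket (Egr V W) C2 (extW \<nu>))"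

definition cocycles ::
    "('k::field_char_0, 'v::ab_group_add) gspace \<Rightarrow> ('k, 'w::ab_group_add) gspace \<Rightarrow>
     (('v \<times> 'w) list \<Rightarrow> 'v \<times> 'w) \<Rightarrow> (('v \<times> 'w) list \<Rightarrow> 'v \<times> 'w) set" where
  "cocycles V W P = {C \<in> Lambda V W. bd V W P C = 0}"

definition coboundaries ::
    "('k::field_char_0, 'v::ab_group_add) gspace \<Rightarrow> ('k, 'w::ab_group_add) gspace \<Rightarrow>
     (('v \<times> 'w) list \<Rightarrow> 'v \<times> 'w) \<Rightarrow> (('v \<times> 'w) list \<Rightarrow> 'v \<times> 'w) set" where
  "coboundaries V W P = bd V W P ` Lambda V W"

definition coh_rel ::
    "('k::field_char_0, 'v::ab_group_add) gspace \<Rightarrow> ('k, 'w::ab_group_add) gspace \<Rightarrow>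
     (('v \<times> 'w) list \<Rightarrow> 'v \<times> 'w) \<Rightarrow>
     ((('v \<times> 'w) list \<Rightarrow> 'v \<times> 'w) \<times> (('v \<times> 'w) list \<Rightarrow> 'v \<times> 'w)) set" where
  "coh_rel V W P =
     {(C, C'). C \<in> cocycles V W P \<and> C' \<in> cocycles V W P \<and> C - C' \<in> coboundaries V W P}"

definition cohomology ::
    "('k::field_char_0, 'v::ab_group_add) gspace \<Rightarrow> ('k, 'w::ab_group_add) gspace \<Rightarrow>
     (('v \<times> 'w) list \<Rightarrow> 'v \<times> 'w) \<Rightarrow> (('v \<times> 'w) list \<Rightarrow> 'v \<times> 'w) set set" where
  "cohomology V W P = cocycles V W P // coh_rel V W P"

definition coh_part ::
    "('k::field_char_0, 'v::ab_group_add) gspace \<Rightarrow> ('k, 'w::ab_group_add) gspace \<Rightarrow>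
     (('v \<times> 'w) list \<Rightarrow> 'v \<times> 'w) \<Rightarrow> nat \<times> mdeg \<Rightarrow> (('v \<times> 'w) list \<Rightarrow> 'v \<times> 'w) set set" where
  "coh_part V W P d = (cocycles V W P \<inter> Lam V W d) // coh_rel V W P"

definition coh_add ::
    "('k::field_char_0, 'v::ab_group_add) gspace \<Rightarrow> ('k, 'w::ab_group_add) gspace \<Rightarrow>
     (('v \<times> 'w) list \<Rightarrow> 'v \<times> 'w) \<Rightarrow> (('v \<times> 'w) list \<Rightarrow> 'v \<times> 'w) set \<Rightarrow>
     (('v \<times> 'w) list \<Rightarrow> 'v \<times> 'w) set \<Rightarrow> (('v \<times> 'w) list \<Rightarrow> 'v \<times> 'w) set" where
  "coh_add V W P h1 h2 = (\<Union>C1\<in>h1. \<Union>C2\<in>h2. coh_rel V W P `` {C1 + C2})"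

definition coh_scale ::
    "('k::field_char_0, 'v::ab_group_add) gspace \<Rightarrow> ('k, 'w::ab_group_add) gspace \<Rightarrow>
     (('v \<times> 'w) list \<Rightarrow> 'v \<times> 'w) \<Rightarrow> 'k \<Rightarrow> (('v \<times> 'w) list \<Rightarrow> 'v \<times> 'w) set \<Rightarrow>
     (('v \<times> 'w) list \<Rightarrow> 'v \<times> 'w) set" where
  "coh_scale V W P a h = (\<Union>C\<in>h. coh_rel V W P `` {map_scale (Egr V W) a C})"

definition coh_prod ::
    "('k::field_char_0, 'v::ab_group_add) gspace \<Rightarrow> ('k, 'w::ab_group_add) gspace \<Rightarrow>
     (('v \<times> 'w) list \<Rightarrow> 'v \<times> 'w) \<Rightarrow> ('w list \<Rightarrow> 'w) \<Rightarrow> (('v \<times> 'w) list \<Rightarrow> 'v \<times> 'w) set \<Rightarrow>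
     (('v \<times> 'w) list \<Rightarrow> 'v \<times> 'w) set \<Rightarrow> (('v \<times> 'w) list \<Rightarrow> 'v \<times> 'w) set" where
  "coh_prod V W P \<nu> h1 h2 = (\<Union>C1\<in>h1. \<Union>C2\<in>h2. coh_rel V W P `` {bullet V W \<nu> C1 C2})"

end

theory Submission
  imports Defs "HOL-Combinatorics.Multiset_Permutations"
begin

text \<open>
  The statement is an exercise in the graded Lie algebra \<open>A(E)\<close>, once that algebra is under control;
  most of what follows is the proof that \<open>[ , ]\<^sup>\<and>\<close> satisfies the graded Jacobi identity on \<open>A(U)\<close> for
  every graded space \<open>U\<close>.

  \<^bold>\<open>The Jacobi identity.\<close> For homogeneous arguments \<open>X\<^sub>i\<close>, \<open>i \<in> T\<close>, write \<open>K(X\<^sub>S)\<close> for the value of \<open>K\<close> on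
  the arguments with index in \<open>S\<close>, in increasing order, and \<open>\<epsilon>(A, B)\<close> for the Koszul sign of moving the
  arguments in \<open>A\<close> in front of those in \<open>B\<close>. Alternating the insertion of \<open>K\<^sub>1\<close> into \<open>K\<^sub>2\<close> produces each
  choice of arguments of \<open>K\<^sub>1\<close> equally often and with the same sign, which gives the shuffle formula
  (\<open>alt_insertion_family\<close>)
  \<open>(i(K\<^sub>1)K\<^sub>2)(X\<^sub>T) = \<plusminus> \<Sum> S \<subseteq> T. \<epsilon>(S, T - S) K\<^sub>2(K\<^sub>1(X\<^sub>S), X\<^bsub>T - S\<^esub>)\<close>
  with the constant sign \<open>(-1)\<close> to the power \<open>\<langle>\<kappa>\<^sub>1, \<kappa>\<^sub>2\<rangle>\<close>. The exponent of \<open>\<epsilon>\<close> is biadditive in disjoint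
  sets, so iterating the formula is bookkeeping: in \<open>i(K\<^sub>1)(i(K\<^sub>2)K\<^sub>3)\<close> the value of \<open>K\<^sub>1\<close> goes either into
  \<open>K\<^sub>2\<close>, which reproduces \<open>i(i(K\<^sub>1)K\<^sub>2)K\<^sub>3\<close>, or next to the value of \<open>K\<^sub>2\<close> into \<open>K\<^sub>3\<close>. The second kind of
  terms is graded symmetric in \<open>K\<^sub>1\<close> and \<open>K\<^sub>2\<close>. Hence \<open>i\<close> is a graded pre-Lie product (\<open>pre_Lie\<close>), and the
  graded commutator of a pre-Lie product satisfies the Jacobi identity (\<open>Jacobi_homogeneous\<close>).

  \<^bold>\<open>Part (1).\<close> The element \<open>P\<close> is odd, so \<open>[P, P]\<^sup>\<and> = 2 i(P)P\<close>. This is a trilinear map on \<open>E\<close> preserving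
  degrees. On three arguments from \<open>V\<close> it is \<open>i(\<mu>)\<mu>\<close>, that is, the Jacobi identity of \<open>\<mu>\<close>; on two
  arguments from \<open>V\<close> and one from \<open>W\<close> it is the module identity; with more arguments from \<open>W\<close> it vanishes,
  because \<open>E\<close> has nothing in degree \<open>2\<close> or higher (\<open>self_bracket_zero_iff\<close>).

  \<^bold>\<open>Part (2).\<close> By the Jacobi identity \<open>2 [P, [P, K]] = [[P, P], K]\<close>. In the formula for the differential
  of a cochain the sum over pairs is the shuffle formula for \<open>i(P)C\<close>, where only two-element subsets
  count, and the other sum is the one for \<open>i(C)P\<close>, where only complements of points count
  (\<open>bd_formula\<close>).

  \<^bold>\<open>Part (3).\<close> The bracket of two cochains has weight \<open>2\<close> and so is zero. The Jacobi identity for \<open>C\<^sub>1\<close>,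
  \<open>C\<^sub>2\<close>, \<open>\<nu>\<close> then says that \<open>C\<^sub>1 \<bullet> C\<^sub>2\<close> and \<open>C\<^sub>2 \<bullet> C\<^sub>1\<close> agree up to the sign (\<open>pd_commute\<close>), and \<open>[P, \<cdot>]\<close> is a
  derivation of the bracket that kills \<open>\<nu>\<close> (\<open>D_pd\<close>). For the cohomology of possibly inhomogeneous
  cocycles one uses that the homogeneous components of a cocycle are cocycles (\<open>hcomp_cocycle\<close>).
\<close>

section \<open>Signs\<close>

text \<open>
  Every sign is a power of \<open>-1\<close>. Letting the integer exponents act on arbitrary abelian groups keeps the
  scalar field out of the sign computations, and the same lemmas apply to elements and to maps.
\<close>

definition signed :: "int \<Rightarrow> 'a::ab_group_add \<Rightarrow> 'a" where
  "signed a v = (if even a then v else - v)"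

lemma signed_0 [simp]: "signed 0 v = v"
  by (simp add: signed_def)

lemma signed_zero [simp]: "signed a 0 = 0"
  by (simp add: signed_def)

lemma signed_eq_0_iff [simp]: "signed a v = 0 \<longleftrightarrow> v = 0"
  by (simp add: signed_def)

lemma signed_signed [simp]: "signed a (signed b v) = signed (a + b) v"
  by (auto simp: signed_def)

lemma signed_add: "signed a (v + w) = signed a v + signed a w"
  by (simp add: signed_def)

lemma signed_diff: "signed a (v - w) = signed a v - signed a w"
  by (simp add: signed_def)

lemma signed_Suc: "signed (1 + a) v = - signed a v"
  by (auto simp: signed_def)

lemma signed_sum: "signed a (\<Sum>i\<in>I. f i) = (\<Sum>i\<in>I. signed a (f i))"
  by (simp add: signed_def sum_negf)

lemma signed_cong: "even (a - b) \<Longrightarrow> signed a v = signed b v"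
  by (auto simp: signed_def)

lemma signed_fun: "signed a f x = signed a (f x)"
  by (simp add: signed_def)

lemma signed_additive:
  assumes "\<And>v. f (- v) = - f v"
  shows "f (signed a v) = signed a (f v)"
  using assms by (simp add: signed_def)

lemma fst_signed [simp]: "fst (signed a v) = signed a (fst v)"
  by (simp add: signed_def)

lemma pairing_add_left: "pairing m (x + y) z = pairing m x z + pairing m y z"
  by (simp add: pairing_def algebra_simps sum.distrib)

lemma pairing_add_right: "pairing m z (x + y) = pairing m z x + pairing m z y"
  by (simp add: pairing_def algebra_simps sum.distrib)

lemma pairing_commute: "pairing m x y = pairing m y x"
  by (simp add: pairing_def mult.commute)

lemma pairing_zero [simp]: "pairing m 0 x = 0" "pairing m x 0 = 0"
  by (simp_all add: pairing_def)

lemma sum_fun_apply: "(\<Sum>i\<in>I. f i) x = (\<Sum>i\<in>I. f i x)"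
  by (induction I rule: infinite_finite_induct) simp_all

lemma pairing_sum_right: "pairing m z (\<Sum>i\<in>I. f i) = (\<Sum>i\<in>I. pairing m z (f i))"
  by (simp add: pairing_def sum_fun_apply sum_distrib_left sum.swap[of _ I])

lemma pairing_sum_left: "pairing m (\<Sum>i\<in>I. f i) z = (\<Sum>i\<in>I. pairing m (f i) z)"
  by (simp add: pairing_def sum_fun_apply sum_distrib_right sum.swap[of _ I])

lemmas pairing_simps = pairing_add_left pairing_add_right

section \<open>Direct sums\<close>

text \<open>
  The sum of the subgroups \<open>G d\<close> is direct: zero has only the trivial decomposition. The homogeneous
  parts of a graded space, of \<open>End(W)\<close>, of \<open>A(U)\<close> and of the cochains are all instances.
\<close>

definition direct :: "('i \<Rightarrow> 'a::ab_group_add set) \<Rightarrow> bool" where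
  "direct G \<longleftrightarrow> (\<forall>d. 0 \<in> G d \<and> (\<forall>a\<in>G d. \<forall>b\<in>G d. a - b \<in> G d)) \<and>
     (\<forall>f. decomposes G 0 f \<longrightarrow> (\<forall>d. f d = 0))"

lemma decomposesI:
  assumes "finite T" "\<And>d. f d \<in> G d" "\<And>d. d \<notin> T \<Longrightarrow> f d = 0" "v = (\<Sum>d\<in>T. f d)"
  shows "decomposes G v f"
proof -
  have s: "{d. f d \<noteq> 0} \<subseteq> T" using assms(3) by auto
  have "(\<Sum>d | f d \<noteq> 0. f d) = (\<Sum>d\<in>T. f d)"
    by (rule sum.mono_neutral_left) (use assms s in auto)
  then show ?thesis using assms s unfolding decomposes_def by (auto intro: finite_subset)
qed

lemma decomposes_sum:
  assumes "decomposes G v f" "finite T" "{d. f d \<noteq> 0} \<subseteq> T"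
  shows "v = (\<Sum>d\<in>T. f d)"
proof -
  have "(\<Sum>d | f d \<noteq> 0. f d) = (\<Sum>d\<in>T. f d)"
    by (rule sum.mono_neutral_left) (use assms in auto)
  then show ?thesis using assms(1) unfolding decomposes_def by simp
qed

lemma direct_unique: "direct G \<Longrightarrow> decomposes G 0 f \<Longrightarrow> f d = 0"
  unfolding direct_def by simp

lemma direct_zero: "direct G \<Longrightarrow> 0 \<in> G d"
  unfolding direct_def by blast

lemma direct_diff: "direct G \<Longrightarrow> a \<in> G d \<Longrightarrow> b \<in> G d \<Longrightarrow> a - b \<in> G d"
  unfolding direct_def by blast

lemma direct_minus: "direct G \<Longrightarrow> a \<in> G d \<Longrightarrow> - a \<in> G d"
  using direct_diff[of G 0 d a] direct_zero[of G d] by simp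

lemma direct_add: "direct G \<Longrightarrow> a \<in> G d \<Longrightarrow> b \<in> G d \<Longrightarrow> a + b \<in> G d"
  using direct_diff[of G a d "- b"] direct_minus[of G b d] by simp

lemma decomposes_diff:
  assumes "direct G" "decomposes G v f" "decomposes G w g"
  shows "decomposes G (v - w) (\<lambda>d. f d - g d)"
proof -
  let ?T = "{d. f d \<noteq> 0} \<union> {d. g d \<noteq> 0}"
  have fin: "finite ?T" using assms unfolding decomposes_def by auto
  have "v = (\<Sum>d\<in>?T. f d)" "w = (\<Sum>d\<in>?T. g d)"
    by (rule decomposes_sum[OF _ fin]; use assms in auto)+
  then have "v - w = (\<Sum>d\<in>?T. f d - g d)" by (simp add: sum_subtractf)
  then show ?thesis
    using assms fin
    by (intro decomposesI[OF fin]) (auto intro: direct_diff simp: decomposes_def)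
qed

lemma decomposes_unique:
  assumes "direct G" "decomposes G v f" "decomposes G v g"
  shows "f = g"
proof -
  have "decomposes G 0 (\<lambda>d. f d - g d)" using decomposes_diff[OF assms] by simp
  from direct_unique[OF assms(1) this] show ?thesis by (intro ext) simp
qed

lemma hcomp_eq:
  assumes "direct G" "decomposes G v f"
  shows "hcomp G v = f"
  unfolding hcomp_def by (rule the_equality) (auto intro: assms decomposes_unique[OF assms(1) _ assms(2)])

lemma hcomp_decomposes:
  assumes "direct G" "v \<in> dsum G"
  shows "decomposes G v (hcomp G v)"
proof -
  obtain f where "decomposes G v f" using assms(2) unfolding dsum_def by auto
  then show ?thesis using hcomp_eq[OF assms(1)] by simp
qed

lemma hcomp_in: "direct G \<Longrightarrow> v \<in> dsum G \<Longrightarrow> hcomp G v d \<in> G d"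
  using hcomp_decomposes[of G v] by (simp add: decomposes_def)

lemma finite_hsupp: "direct G \<Longrightarrow> v \<in> dsum G \<Longrightarrow> finite (hsupp G v)"
  using hcomp_decomposes[of G v] by (simp add: decomposes_def hsupp_def)

lemma sum_hcomp: 
  "direct G \<Longrightarrow> v \<in> dsum G \<Longrightarrow> finite T \<Longrightarrow> hsupp G v \<subseteq> T \<Longrightarrow> (\<Sum>d\<in>T. hcomp G v d) = v"
  using decomposes_sum[OF hcomp_decomposes, of G v T] unfolding hsupp_def by simp

lemma hcomp_diff:
  assumes "direct G" "v \<in> dsum G" "w \<in> dsum G"
  shows "hcomp G (v - w) d = hcomp G v d - hcomp G w d"
  using hcomp_eq[OF assms(1) decomposes_diff[OF assms(1) hcomp_decomposes hcomp_decomposes]] assms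
  by simp

lemma dsum_diff: "direct G \<Longrightarrow> v \<in> dsum G \<Longrightarrow> w \<in> dsum G \<Longrightarrow> v - w \<in> dsum G"
  using decomposes_diff[OF _ hcomp_decomposes hcomp_decomposes, of G v w] by (auto simp: dsum_def)

lemma decomposes_homogeneous:
  "direct G \<Longrightarrow> v \<in> G d \<Longrightarrow> decomposes G v (\<lambda>e. if e = d then v else 0)"
  by (rule decomposesI[of "{d}"]) (auto simp: direct_zero)

lemma hcomp_homogeneous: "direct G \<Longrightarrow> v \<in> G d \<Longrightarrow> hcomp G v e = (if e = d then v else 0)"
  using hcomp_eq[OF _ decomposes_homogeneous, of G v d] by simp

lemma hsupp_homogeneous: "direct G \<Longrightarrow> v \<in> G d \<Longrightarrow> hsupp G v = (if v = 0 then {} else {d})"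
  by (auto simp: hsupp_def hcomp_homogeneous)

lemma in_dsum: "direct G \<Longrightarrow> v \<in> G d \<Longrightarrow> v \<in> dsum G"
  using decomposes_homogeneous[of G v d] by (auto simp: dsum_def)

lemma dsum_zero: "direct G \<Longrightarrow> 0 \<in> dsum G"
  by (rule in_dsum[OF _ direct_zero])

lemma hcomp_zero: "direct G \<Longrightarrow> hcomp G 0 d = 0"
  using hcomp_homogeneous[of G 0 d d] by (simp add: direct_zero)

lemma dsum_minus: "direct G \<Longrightarrow> v \<in> dsum G \<Longrightarrow> - v \<in> dsum G"
  using dsum_diff[of G 0 v] dsum_zero by auto

lemma dsum_add: "direct G \<Longrightarrow> v \<in> dsum G \<Longrightarrow> w \<in> dsum G \<Longrightarrow> v + w \<in> dsum G"
  using dsum_diff[of G v "- w"] dsum_minus[of G w] by auto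

lemma hcomp_minus: "direct G \<Longrightarrow> v \<in> dsum G \<Longrightarrow> hcomp G (- v) d = - hcomp G v d"
  using hcomp_diff[of G 0 v d] by (simp add: dsum_zero hcomp_zero)

lemma hcomp_add:
  "direct G \<Longrightarrow> v \<in> dsum G \<Longrightarrow> w \<in> dsum G \<Longrightarrow> hcomp G (v + w) d = hcomp G v d + hcomp G w d"
  using hcomp_diff[of G v "- w" d] by (simp add: dsum_minus hcomp_minus)

lemma dsum_sum: "direct G \<Longrightarrow> (\<And>i. i \<in> I \<Longrightarrow> f i \<in> dsum G) \<Longrightarrow> (\<Sum>i\<in>I. f i) \<in> dsum G"
  by (induction I rule: infinite_finite_induct) (auto intro: dsum_zero dsum_add)

lemma direct_sum: "direct G \<Longrightarrow> (\<And>i. i \<in> I \<Longrightarrow> f i \<in> G d) \<Longrightarrow> (\<Sum>i\<in>I. f i) \<in> G d"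
  by (induction I rule: infinite_finite_induct) (auto intro: direct_zero direct_add)

lemma direct_signed: "direct G \<Longrightarrow> v \<in> G d \<Longrightarrow> signed a v \<in> G d"
  by (simp add: signed_def direct_minus)

lemma dsum_signed: "direct G \<Longrightarrow> v \<in> dsum G \<Longrightarrow> signed a v \<in> dsum G"
  by (simp add: signed_def dsum_minus)

lemma dsum_induct [consumes 2, case_names homogeneous add]:
  assumes "direct G" "v \<in> dsum G"
    and "\<And>d v. v \<in> G d \<Longrightarrow> Q v"
    and "\<And>v w. v \<in> dsum G \<Longrightarrow> w \<in> dsum G \<Longrightarrow> Q v \<Longrightarrow> Q w \<Longrightarrow> Q (v + w)"
  shows "Q v"
proof -
  have *: "Q (\<Sum>d\<in>T. hcomp G v d)" if "finite T" for T
    using that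
  proof (induction T)
    case empty
    show ?case using assms(3)[OF direct_zero[OF assms(1)]] by (simp only: sum.empty)
  next
    case (insert d T)
    have "Q (hcomp G v d + (\<Sum>d\<in>T. hcomp G v d))"
    proof (rule assms(4))
      show "Q (hcomp G v d)" by (rule assms(3)[OF hcomp_in[OF assms(1,2)]])
    qed (use insert assms(1,2) in \<open>auto intro!: dsum_sum intro: in_dsum hcomp_in\<close>)
    with insert show ?case by simp
  qed
  show ?thesis
    using *[of "hsupp G v"] sum_hcomp[OF assms(1,2)] assms(1,2) by (simp add: finite_hsupp)
qed

lemma dsum_induct2 [consumes 4, case_names homogeneous add_left add_right]:
  assumes G: "direct G" and H: "direct H" and v: "v \<in> dsum G" and w: "w \<in> dsum H"
    and hom: "\<And>d e v w. v \<in> G d \<Longrightarrow> w \<in> H e \<Longrightarrow> Q v w"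
    and left: "\<And>v v' w. v \<in> dsum G \<Longrightarrow> v' \<in> dsum G \<Longrightarrow> w \<in> dsum H \<Longrightarrow> Q v w \<Longrightarrow> Q v' w \<Longrightarrow> Q (v + v') w"
    and right: "\<And>v w w'. v \<in> dsum G \<Longrightarrow> w \<in> dsum H \<Longrightarrow> w' \<in> dsum H \<Longrightarrow> Q v w \<Longrightarrow> Q v w' \<Longrightarrow> Q v (w + w')"
  shows "Q v w"
  using G v
proof (induction rule: dsum_induct)
  case (homogeneous d v)
  from H w show ?case
    by (induction rule: dsum_induct) (auto intro: hom[OF homogeneous] right[OF in_dsum[OF G, OF homogeneous]])
qed (use w in \<open>auto intro: left\<close>)

lemma dsum_subset:
  assumes "direct G" "direct H" "\<And>d. G d \<subseteq> dsum H"
  shows "dsum G \<subseteq> dsum H"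
proof
  fix v assume "v \<in> dsum G"
  with assms(1) show "v \<in> dsum H"
    by (induction rule: dsum_induct) (use assms in \<open>auto intro: dsum_add\<close>)
qed

text \<open>The degrees of cochains and of symmetric products are parametrized subsets of the degrees of \<open>A(E)\<close>.\<close>

lemma direct_reindex:
  assumes "direct G" "inj h"
  shows "direct (\<lambda>d. G (h d))"
  unfolding direct_def
proof (intro conjI allI impI ballI)
  fix f d assume f: "decomposes (\<lambda>d. G (h d)) 0 f"
  define g where "g e = (if e \<in> range h then f (inv h e) else 0)" for e
  let ?T = "h ` {d. f d \<noteq> 0}"
  have fin: "finite {d. f d \<noteq> 0}" using f unfolding decomposes_def by auto
  have gh: "g (h d) = f d" for d using assms(2) by (simp add: g_def)
  have "(\<Sum>e\<in>?T. g e) = (\<Sum>d | f d \<noteq> 0. f d)"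
    by (subst sum.reindex) (use assms(2) gh in \<open>auto intro: inj_on_subset\<close>)
  then have "decomposes G 0 g"
    using f fin gh assms
    by (intro decomposesI[of ?T]) (auto simp: decomposes_def g_def intro: direct_zero)
  from direct_unique[OF assms(1) this] show "f d = 0" by (metis gh)
qed (use assms in \<open>auto simp: direct_def\<close>)

text \<open>
  The biadditive extension of an operation that is given on homogeneous elements and depends on their
  degrees. Both the commutator of \<open>End(W)\<close> and the bracket of \<open>A(U)\<close> have this shape.
\<close>

definition bilinear_ext ::
    "('i \<Rightarrow> 'a::ab_group_add set) \<Rightarrow> ('j \<Rightarrow> 'b::ab_group_add set) \<Rightarrow>
     ('i \<Rightarrow> 'a \<Rightarrow> 'j \<Rightarrow> 'b \<Rightarrow> 'c::ab_group_add) \<Rightarrow> 'a \<Rightarrow> 'b \<Rightarrow> 'c" where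
  "bilinear_ext G H B v w = (\<Sum>d\<in>hsupp G v. \<Sum>e\<in>hsupp H w. B d (hcomp G v d) e (hcomp H w e))"

definition biadditive where
  "biadditive G H B \<longleftrightarrow>
     (\<forall>d e v v' w. v \<in> G d \<longrightarrow> v' \<in> G d \<longrightarrow> w \<in> H e \<longrightarrow> B d (v + v') e w = B d v e w + B d v' e w) \<and>
     (\<forall>d e v w w'. v \<in> G d \<longrightarrow> w \<in> H e \<longrightarrow> w' \<in> H e \<longrightarrow> B d v e (w + w') = B d v e w + B d v e w')"

lemma biadditive_zero:
  fixes B :: "'i \<Rightarrow> 'a::ab_group_add \<Rightarrow> 'j \<Rightarrow> 'b::ab_group_add \<Rightarrow> 'c::ab_group_add"
  assumes "direct G" "direct H" "biadditive G H B"
  shows "w \<in> H e \<Longrightarrow> B d 0 e w = 0" "v \<in> G d \<Longrightarrow> B d v e 0 = 0"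
proof -
  assume "w \<in> H e"
  then have "B d (0 + 0) e w = B d 0 e w + B d 0 e w"
    using assms direct_zero[of G d] unfolding biadditive_def by blast
  then show "B d 0 e w = 0" by simp
next
  assume "v \<in> G d"
  then have "B d v e (0 + 0) = B d v e 0 + B d v e 0"
    using assms direct_zero[of H e] unfolding biadditive_def by blast
  then show "B d v e 0 = 0" by simp
qed

lemma bilinear_ext_superset:
  assumes "direct G" "direct H" "biadditive G H B" "v \<in> dsum G" "w \<in> dsum H"
    and "finite S" "hsupp G v \<subseteq> S" "finite T" "hsupp H w \<subseteq> T"
  shows "bilinear_ext G H B v w = (\<Sum>d\<in>S. \<Sum>e\<in>T. B d (hcomp G v d) e (hcomp H w e))"
proof -
  have "bilinear_ext G H B v w = (\<Sum>d\<in>hsupp G v. \<Sum>e\<in>T. B d (hcomp G v d) e (hcomp H w e))"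
    unfolding bilinear_ext_def
    by (intro sum.cong refl sum.mono_neutral_left)
       (use assms biadditive_zero[OF assms(1-3)] in \<open>auto simp: hsupp_def hcomp_in\<close>)
  also have "\<dots> = (\<Sum>d\<in>S. \<Sum>e\<in>T. B d (hcomp G v d) e (hcomp H w e))"
    by (intro sum.mono_neutral_left)
       (use assms biadditive_zero[OF assms(1-3)] in \<open>auto simp: hsupp_def hcomp_in\<close>)
  finally show ?thesis .
qed

lemma bilinear_ext_add:
  assumes "direct G" "direct H" "biadditive G H B" "v \<in> dsum G" "v' \<in> dsum G" 
    "w \<in> dsum H" "w' \<in> dsum H"
  shows "bilinear_ext G H B (v + v') w = bilinear_ext G H B v w + bilinear_ext G H B v' w"
    and "bilinear_ext G H B v (w + w') = bilinear_ext G H B v w + bilinear_ext G H B v w'"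
proof -
  let ?S = "hsupp G v \<union> hsupp G v' \<union> hsupp G (v + v')"
  let ?T = "hsupp H w \<union> hsupp H w' \<union> hsupp H (w + w')"
  note sup = bilinear_ext_superset[OF assms(1-3), of _ _ ?S ?T]
  have fin: "finite ?S" "finite ?T" using assms by (auto intro: finite_hsupp dsum_add)
  have eqs: "bilinear_ext G H B u z = (\<Sum>d\<in>?S. \<Sum>e\<in>?T. B d (hcomp G u d) e (hcomp H z e))"
    if "u \<in> {v, v', v + v'}" "z \<in> {w, w', w + w'}" for u z
    by (rule sup) (use that assms fin in \<open>auto intro: dsum_add\<close>)
  show "bilinear_ext G H B (v + v') w = bilinear_ext G H B v w + bilinear_ext G H B v' w"
    using assms by (simp add: eqs hcomp_add sum.distrib[symmetric] hcomp_in biadditive_def)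
  show "bilinear_ext G H B v (w + w') = bilinear_ext G H B v w + bilinear_ext G H B v w'"
    using assms by (simp add: eqs hcomp_add sum.distrib[symmetric] hcomp_in biadditive_def)
qed

lemma bilinear_ext_homogeneous:
  assumes "direct G" "direct H" "biadditive G H B" "v \<in> G d" "w \<in> H e"
  shows "bilinear_ext G H B v w = B d v e w"
  using assms biadditive_zero[OF assms(1-3)]
  by (auto simp: bilinear_ext_def hsupp_homogeneous hcomp_homogeneous)

section \<open>Multilinear maps on a graded space\<close>

lemma listset_iff: "ds \<in> listset As \<longleftrightarrow> list_all2 (\<lambda>d A. d \<in> A) ds As"
  by (induction As arbitrary: ds) (auto simp: set_Cons_def list_all2_Cons2)

lemma finite_listset: "(\<And>A. A \<in> set As \<Longrightarrow> finite A) \<Longrightarrow> finite (listset As)"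
proof (induction As)
  case (Cons A As)
  have "listset (A # As) = (\<lambda>(d, ds). d # ds) ` (A \<times> listset As)"
    by (auto simp: set_Cons_def)
  then show ?case using Cons by simp
qed simp

lemma length_eq_append_Cons_conv:
  assumes "length ds = length A + Suc (length B)"
  obtains dA d dB where "ds = dA @ d # dB" "length dA = length A" "length dB = length B"
proof
  show "ds = take (length A) ds @ ds ! length A # drop (Suc (length A)) ds"
    using assms by (simp add: id_take_nth_drop[symmetric])
qed (use assms in auto)

text \<open>
  Degrees are carried along explicitly, because the zero vector is homogeneous of every degree.
\<close>

abbreviation homs :: "('k, 'u) gspace \<Rightarrow> 'u list \<Rightarrow> mdeg list \<Rightarrow> bool" where
  "homs U \<equiv> list_all2 (\<lambda>X x. X \<in> gpart U x)"

definition has_degree :: "('k, 'u) gspace \<Rightarrow> mdeg \<Rightarrow> ('u list \<Rightarrow> 'u) \<Rightarrow> bool" where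
  "has_degree U \<kappa> K \<longleftrightarrow> (\<forall>Xs xs. homs U Xs xs \<longrightarrow> K Xs \<in> gpart U (sum_list xs + \<kappa>))"

lemma powi_minus_one: "(-1 :: 'a::field) powi a = (if even a then 1 else -1)"
  by (simp add: power_int_minus_left)

locale graded_vs =
  fixes U :: "('k::field_char_0, 'u::ab_group_add) gspace"
  assumes graded: "graded_space U"
begin

sublocale vs: vector_space "gscale U"
  using graded by (simp add: graded_space_def)

abbreviation pr :: "mdeg \<Rightarrow> mdeg \<Rightarrow> int" where "pr \<equiv> pairing (gdim U)"

lemma scale_sign: "gscale U ((-1) powi a) v = signed a v"
  by (simp add: powi_minus_one signed_def)

lemma scale_signed: "gscale U a (signed b v) = signed b (gscale U a v)"
  by (rule signed_additive) simp

lemma subspace_part: "vs.subspace (gpart U x)"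
  using graded by (simp add: graded_space_def)

lemma direct_part: "direct (gpart U)"
  unfolding direct_def
proof (intro conjI allI impI ballI)
  fix f d assume f: "decomposes (gpart U) 0 f"
  have "decomposes (gpart U) 0 (\<lambda>_. 0)"
    by (rule decomposesI[of "{}"]) (use subspace_part vs.subspace_0 in auto)
  moreover have "\<exists>!f. decomposes (gpart U) 0 f" using graded by (simp add: graded_space_def)
  ultimately have "f = (\<lambda>_. 0)" using f by auto
  then show "f d = 0" by simp
qed (use subspace_part vs.subspace_0 vs.subspace_diff in auto)

lemma part_dsum [simp]: "v \<in> dsum (gpart U)"
  using graded unfolding graded_space_def dsum_def by auto

lemma part_scale: "v \<in> gpart U x \<Longrightarrow> gscale U a v \<in> gpart U x"
  using subspace_part vs.subspace_scale by blast

lemmas part_zero = direct_zero[OF direct_part]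
  and part_add = direct_add[OF direct_part]
  and part_diff = direct_diff[OF direct_part]
  and part_sum = direct_sum[OF direct_part]
  and part_signed = direct_signed[OF direct_part]
  and cmp_in = hcomp_in[OF direct_part part_dsum]
  and cmp_add = hcomp_add[OF direct_part part_dsum part_dsum]
  and cmp_finite = finite_hsupp[OF direct_part part_dsum]
  and cmp_hom = hcomp_homogeneous[OF direct_part]
  and supp_hom = hsupp_homogeneous[OF direct_part]
  and cmp_sum = sum_hcomp[OF direct_part part_dsum]

lemma cmp_scale: "hcomp (gpart U) (gscale U a v) d = gscale U a (hcomp (gpart U) v d)"
proof -
  let ?f = "\<lambda>d. gscale U a (hcomp (gpart U) v d)"
  have "gscale U a v = gscale U a (\<Sum>d\<in>hsupp (gpart U) v. hcomp (gpart U) v d)"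
    by (subst cmp_sum) (auto simp: cmp_finite)
  then have "decomposes (gpart U) (gscale U a v) ?f"
    by (intro decomposesI[of "hsupp (gpart U) v"])
       (auto simp: cmp_finite cmp_in part_scale vs.scale_sum_right, simp add: hsupp_def)
  from hcomp_eq[OF direct_part this] show ?thesis by simp
qed

subsection \<open>Multilinearity\<close>

lemma linear_iff_UU: "Vector_Spaces.linear (gscale U) (gscale U) f \<longleftrightarrow>
    (\<forall>v w. f (v + w) = f v + f w) \<and> (\<forall>a v. f (gscale U a v) = gscale U a (f v))"
  by (simp add: Vector_Spaces.linear_iff vs.vector_space_axioms)

lemma multilinear_iff:
  "multilinear U p K \<longleftrightarrow> (\<forall>Xs. length Xs \<noteq> p \<longrightarrow> K Xs = 0) \<and>
     (\<forall>A B. Suc (length A + length B) = p \<longrightarrow>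
        (\<forall>v w. K (A @ (v + w) # B) = K (A @ v # B) + K (A @ w # B)) \<and>
        (\<forall>a v. K (A @ gscale U a v # B) = gscale U a (K (A @ v # B))))"
  (is "_ \<longleftrightarrow> _ \<and> ?R")
proof -
  have "(\<forall>Xs i. length Xs = p \<longrightarrow> i < p \<longrightarrow>
          Vector_Spaces.linear (gscale U) (gscale U) (\<lambda>v. K (Xs[i := v]))) \<longleftrightarrow> ?R"
  proof (intro iffI allI impI)
    fix A B :: "'u list"
    assume L: "\<forall>Xs i. length Xs = p \<longrightarrow> i < p \<longrightarrow>
          Vector_Spaces.linear (gscale U) (gscale U) (\<lambda>v. K (Xs[i := v]))"
      and len: "Suc (length A + length B) = p"
    show "(\<forall>v w. K (A @ (v + w) # B) = K (A @ v # B) + K (A @ w # B)) \<and>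
        (\<forall>a v. K (A @ gscale U a v # B) = gscale U a (K (A @ v # B)))"
      using L[rule_format, of "A @ 0 # B" "length A"] len by (simp add: linear_iff_UU)
  next
    fix Xs :: "'u list" and i
    assume R: ?R and Xs: "length Xs = p" "i < p"
    have "Suc (length (take i Xs) + length (drop (Suc i) Xs)) = p" using Xs by simp
    from R[rule_format, OF this]
    show "Vector_Spaces.linear (gscale U) (gscale U) (\<lambda>v. K (Xs[i := v]))"
      using Xs by (simp add: linear_iff_UU upd_conv_take_nth_drop)
  qed
  then show ?thesis unfolding multilinear_def by simp
qed

lemma multilinearI:
  assumes "\<And>Xs. length Xs \<noteq> p \<Longrightarrow> K Xs = 0"
    and "\<And>A B v w. Suc (length A + length B) = p \<Longrightarrow>
           K (A @ (v + w) # B) = K (A @ v # B) + K (A @ w # B)"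
    and "\<And>A B a v. Suc (length A + length B) = p \<Longrightarrow>
           K (A @ gscale U a v # B) = gscale U a (K (A @ v # B))"
  shows "multilinear U p K"
  using assms by (simp add: multilinear_iff)

lemma ml_length: "multilinear U p K \<Longrightarrow> length Xs \<noteq> p \<Longrightarrow> K Xs = 0"
  by (simp add: multilinear_iff)

lemma ml_add: "multilinear U p K \<Longrightarrow> K (A @ (v + w) # B) = K (A @ v # B) + K (A @ w # B)"
  by (cases "Suc (length A + length B) = p") (auto simp: multilinear_iff)

lemma ml_scale: "multilinear U p K \<Longrightarrow> K (A @ gscale U a v # B) = gscale U a (K (A @ v # B))"
  by (cases "Suc (length A + length B) = p") (auto simp: multilinear_iff)

lemma ml_zero: "multilinear U p K \<Longrightarrow> K (A @ 0 # B) = 0"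
  using ml_scale[of p K A 0 0 B] by simp

lemma ml_zero_set: "multilinear U p K \<Longrightarrow> 0 \<in> set Xs \<Longrightarrow> K Xs = 0"
  by (auto simp: in_set_conv_decomp ml_zero)

lemma ml_minus: "multilinear U p K \<Longrightarrow> K (A @ (- v) # B) = - K (A @ v # B)"
  using ml_scale[of p K A "-1" v B] by simp

lemma ml_signed: "multilinear U p K \<Longrightarrow> K (A @ signed a v # B) = signed a (K (A @ v # B))"
  by (simp add: signed_def ml_minus)

lemma ml_sum: "multilinear U p K \<Longrightarrow> K (A @ (\<Sum>i\<in>I. f i) # B) = (\<Sum>i\<in>I. K (A @ f i # B))"
  by (induction I rule: infinite_finite_induct) (auto simp: ml_zero ml_add)

lemma multilinear_Cons: "multilinear U (Suc p) K \<Longrightarrow> multilinear U p (\<lambda>Xs. K (X # Xs))"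
proof (rule multilinearI)
  fix A B :: "'u list" and v w a
  assume K: "multilinear U (Suc p) K"
  show "K (X # A @ (v + w) # B) = K (X # A @ v # B) + K (X # A @ w # B)"
    using ml_add[OF K, of "X # A"] by simp
  show "K (X # A @ gscale U a v # B) = gscale U a (K (X # A @ v # B))"
    using ml_scale[OF K, of "X # A"] by simp
qed (auto simp: ml_length)

lemma multilinear_zero: "multilinear U p (\<lambda>_. 0)"
  by (rule multilinearI) auto

lemma multilinear_add: "multilinear U p K \<Longrightarrow> multilinear U p L \<Longrightarrow> multilinear U p (\<lambda>Xs. K Xs + L Xs)"
  by (rule multilinearI) (auto simp: ml_length ml_add ml_scale vs.scale_right_distrib)

lemma multilinear_scale: "multilinear U p K \<Longrightarrow> multilinear U p (\<lambda>Xs. gscale U a (K Xs))"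
  by (rule multilinearI) (auto simp: ml_length ml_add ml_scale vs.scale_right_distrib mult.commute)

lemma multilinear_signed: "multilinear U p K \<Longrightarrow> multilinear U p (\<lambda>Xs. signed a (K Xs))"
  using multilinear_scale[of p K "(-1) powi a"] by (simp add: scale_sign)

lemma multilinear_sum:
  "(\<And>i. i \<in> I \<Longrightarrow> multilinear U p (K i)) \<Longrightarrow> multilinear U p (\<lambda>Xs. \<Sum>i\<in>I. K i Xs)"
  by (induction I rule: infinite_finite_induct) (auto intro: multilinear_zero multilinear_add)

subsection \<open>Extension from homogeneous arguments\<close>

text \<open>
  Enlarging the range of degrees only adds terms with a zero argument. With a range that is common to
  \<open>v\<close>, \<open>w\<close> and \<open>v + w\<close> the extension is seen to be additive in each slot.
\<close>

lemma hom_ext_superset: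
  assumes "\<And>ds. multilinear U p (f ds)" "finite T" "\<And>X. X \<in> set Xs \<Longrightarrow> hsupp (gpart U) X \<subseteq> T"
  shows "hom_ext U f Xs = (\<Sum>ds\<in>listset (map (\<lambda>_. T) Xs). f ds (map2 (hcomp (gpart U)) Xs ds))"
  unfolding hom_ext_def
proof (rule sum.mono_neutral_left)
  show "finite (listset (map (\<lambda>_. T) Xs))" using assms(2) by (auto intro: finite_listset)
  show "listset (map (hsupp (gpart U)) Xs) \<subseteq> listset (map (\<lambda>_. T) Xs)"
    using assms(3) by (force simp: listset_iff list_all2_conv_all_nth)
  show "\<forall>ds\<in>listset (map (\<lambda>_. T) Xs) - listset (map (hsupp (gpart U)) Xs).
          f ds (map2 (hcomp (gpart U)) Xs ds) = 0"
  proof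
    fix ds assume "ds \<in> listset (map (\<lambda>_. T) Xs) - listset (map (hsupp (gpart U)) Xs)"
    then obtain i where i: "i < length Xs" "length ds = length Xs" "ds ! i \<notin> hsupp (gpart U) (Xs ! i)"
      by (auto simp: listset_iff list_all2_conv_all_nth)
    then have "map2 (hcomp (gpart U)) Xs ds ! i = 0" by (simp add: hsupp_def)
    moreover have "map2 (hcomp (gpart U)) Xs ds ! i \<in> set (map2 (hcomp (gpart U)) Xs ds)"
      using i by (intro nth_mem) simp
    ultimately have "0 \<in> set (map2 (hcomp (gpart U)) Xs ds)" by (simp only:)
    then show "f ds (map2 (hcomp (gpart U)) Xs ds) = 0" by (rule ml_zero_set[OF assms(1)])
  qed
qed

lemma multilinear_hom_ext:
  assumes f: "\<And>ds. multilinear U p (f ds)"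
  shows "multilinear U p (hom_ext U f)"
proof (rule multilinearI)
  fix Xs :: "'u list" assume "length Xs \<noteq> p"
  then have "f ds (map2 (hcomp (gpart U)) Xs ds) = 0" if "ds \<in> listset (map (hsupp (gpart U)) Xs)" for ds
    using that by (intro ml_length[OF f]) (auto simp: listset_iff dest: list_all2_lengthD)
  then show "hom_ext U f Xs = 0" by (simp add: hom_ext_def)
next
  fix A B :: "'u list" and v w
  assume "Suc (length A + length B) = p"
  define T where "T = (\<Union>X\<in>set A \<union> set B \<union> {v, w, v + w}. hsupp (gpart U) X)"
  have T: "finite T" by (auto simp: T_def cmp_finite)
  define L where "L = listset (map (\<lambda>_. T) A @ T # map (\<lambda>_. T) B)"
  have e: "hom_ext U f (A @ u # B) = (\<Sum>ds\<in>L. f ds (map2 (hcomp (gpart U)) (A @ u # B) ds))"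
    if "hsupp (gpart U) u \<subseteq> T" for u
  proof -
    have "hsupp (gpart U) X \<subseteq> T" if "X \<in> set (A @ u # B)" for X
      using that \<open>hsupp (gpart U) u \<subseteq> T\<close> unfolding T_def by auto
    with hom_ext_superset[of p f T "A @ u # B", OF f T]
    show ?thesis by (simp add: L_def)
  qed
  have "f ds (map2 (hcomp (gpart U)) (A @ (v + w) # B) ds) =
      f ds (map2 (hcomp (gpart U)) (A @ v # B) ds) + f ds (map2 (hcomp (gpart U)) (A @ w # B) ds)"
    if "ds \<in> L" for ds
  proof -
    have "length ds = length A + Suc (length B)"
      using that by (auto simp: L_def listset_iff dest: list_all2_lengthD)
    then obtain dA d dB where "ds = dA @ d # dB" "length dA = length A" "length dB = length B"
      by (rule length_eq_append_Cons_conv)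
    then show ?thesis by (simp add: cmp_add ml_add[OF f])
  qed
  then show "hom_ext U f (A @ (v + w) # B) = hom_ext U f (A @ v # B) + hom_ext U f (A @ w # B)"
    by (subst (1 2 3) e) (auto simp: T_def sum.distrib[symmetric])
next
  fix A B :: "'u list" and v a
  assume "Suc (length A + length B) = p"
  define T where "T = (\<Union>X\<in>set A \<union> set B \<union> {v, gscale U a v}. hsupp (gpart U) X)"
  have T: "finite T" by (auto simp: T_def cmp_finite)
  define L where "L = listset (map (\<lambda>_. T) A @ T # map (\<lambda>_. T) B)"
  have e: "hom_ext U f (A @ u # B) = (\<Sum>ds\<in>L. f ds (map2 (hcomp (gpart U)) (A @ u # B) ds))"
    if "hsupp (gpart U) u \<subseteq> T" for u
  proof -
    have "hsupp (gpart U) X \<subseteq> T" if "X \<in> set (A @ u # B)" for X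
      using that \<open>hsupp (gpart U) u \<subseteq> T\<close> unfolding T_def by auto
    with hom_ext_superset[of p f T "A @ u # B", OF f T]
    show ?thesis by (simp add: L_def)
  qed
  have "f ds (map2 (hcomp (gpart U)) (A @ gscale U a v # B) ds) =
      gscale U a (f ds (map2 (hcomp (gpart U)) (A @ v # B) ds))"
    if "ds \<in> L" for ds
  proof -
    have "length ds = length A + Suc (length B)"
      using that by (auto simp: L_def listset_iff dest: list_all2_lengthD)
    then obtain dA d dB where "ds = dA @ d # dB" "length dA = length A" "length dB = length B"
      by (rule length_eq_append_Cons_conv)
    then show ?thesis by (simp add: cmp_scale ml_scale[OF f])
  qed
  then show "hom_ext U f (A @ gscale U a v # B) = gscale U a (hom_ext U f (A @ v # B))"
    by (subst (1 2) e) (auto simp: T_def vs.scale_sum_right)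
qed

text \<open>
  If an argument is zero, its own degree is not determined by it; then the sum defining the extension
  is empty, and the right-hand side vanishes by multilinearity.
\<close>

lemma hom_ext_homogeneous:
  assumes f: "multilinear U p (f xs)" and Xs: "homs U Xs xs"
  shows "hom_ext U f Xs = f xs Xs"
proof (cases "0 \<in> set Xs")
  case True
  then obtain i where "i < length Xs" "Xs ! i = 0" by (auto simp: in_set_conv_nth)
  moreover have "hsupp (gpart U) 0 = {}" using supp_hom[OF part_zero] by simp
  ultimately have no: "listset (map (hsupp (gpart U)) Xs) = {}"
    by (force simp: listset_iff list_all2_conv_all_nth)
  from True show ?thesis by (simp add: hom_ext_def no ml_zero_set[OF f])
next
  case False
  have "ds \<in> listset (map (hsupp (gpart U)) Xs) \<longleftrightarrow> ds = xs" for ds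
    using Xs False unfolding listset_iff
  proof (induction Xs xs arbitrary: ds rule: list_all2_induct)
    case (Cons X Xs x xs)
    then show ?case by (auto simp: list_all2_Cons2 supp_hom)
  qed simp
  then have one: "listset (map (hsupp (gpart U)) Xs) = {xs}" by blast
  from Xs have "map2 (hcomp (gpart U)) Xs xs = Xs"
    by (induction Xs xs rule: list_all2_induct) (auto simp: cmp_hom)
  then show ?thesis by (simp add: hom_ext_def one)
qed

lemma multilinear_expand:
  assumes "multilinear U p K"
  shows "hom_ext U (\<lambda>_. K) Xs = K Xs"
  using assms
proof (induction Xs arbitrary: p K)
  case Nil
  then show ?case by (simp add: hom_ext_def)
next
  case (Cons X Xs)
  show ?case
  proof (cases p)
    case 0
    with Cons.prems show ?thesis
      using ml_length[OF multilinear_hom_ext[OF Cons.prems], of "X # Xs"] ml_length[OF Cons.prems, of "X # Xs"]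
      by simp
  next
    case (Suc q)
    note K = Cons.prems[unfolded Suc]
    let ?S = "hsupp (gpart U) X" and ?L = "listset (map (hsupp (gpart U)) Xs)"
    have "listset (map (hsupp (gpart U)) (X # Xs)) = (\<lambda>(d, ds). d # ds) ` (?S \<times> ?L)"
      by (auto simp: set_Cons_def)
    then have "hom_ext U (\<lambda>_. K) (X # Xs) =
        (\<Sum>(d, ds)\<in>?S \<times> ?L. K (hcomp (gpart U) X d # map2 (hcomp (gpart U)) Xs ds))"
      unfolding hom_ext_def by (simp only:) (subst sum.reindex, auto intro!: inj_onI sum.cong)
    also have "\<dots> = (\<Sum>d\<in>?S. hom_ext U (\<lambda>_ Xs. K (hcomp (gpart U) X d # Xs)) Xs)"
      by (simp add: sum.cartesian_product[symmetric] hom_ext_def)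
    also have "\<dots> = (\<Sum>d\<in>?S. K ([] @ hcomp (gpart U) X d # Xs))"
      by (simp add: Cons.IH[OF multilinear_Cons[OF K]])
    also have "\<dots> = K (X # Xs)"
      by (subst ml_sum[OF K, symmetric]) (simp add: cmp_sum cmp_finite)
    finally show ?thesis .
  qed
qed

text \<open>Both maps are expanded into their values on the homogeneous components of the arguments.\<close>

lemma multilinear_eqI:
  assumes K: "multilinear U p K" and L: "multilinear U p L"
    and eq: "\<And>Xs xs. homs U Xs xs \<Longrightarrow> length Xs = p \<Longrightarrow> K Xs = L Xs"
  shows "K = L"
proof
  fix Xs
  have "K (map2 (hcomp (gpart U)) Xs ds) = L (map2 (hcomp (gpart U)) Xs ds)"
    if "ds \<in> listset (map (hsupp (gpart U)) Xs)" for ds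
  proof (cases "length Xs = p")
    case True
    have len: "length ds = length Xs" using that by (auto simp: listset_iff dest: list_all2_lengthD)
    show ?thesis
      by (rule eq[of _ ds]) (use len True in \<open>auto simp: list_all2_conv_all_nth cmp_in\<close>)
  next
    case False
    then show ?thesis
      using that ml_length[OF K, of "map2 (hcomp (gpart U)) Xs ds"]
        ml_length[OF L, of "map2 (hcomp (gpart U)) Xs ds"]
      by (auto simp: listset_iff dest: list_all2_lengthD)
  qed
  then have "hom_ext U (\<lambda>_. K) Xs = hom_ext U (\<lambda>_. L) Xs"
    unfolding hom_ext_def by (rule sum.cong[OF refl])
  then show "K Xs = L Xs" using multilinear_expand[OF K] multilinear_expand[OF L] by simp
qed

end

section \<open>Koszul signs and the alternator\<close>

text \<open>
  The exponent of the Koszul sign, as a sum over all pairs of positions, so that the exponents of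
  different permutations can be compared pair by pair.
\<close>

definition kexp :: "nat \<Rightarrow> (nat \<Rightarrow> nat) \<Rightarrow> mdeg list \<Rightarrow> int" where
  "kexp m \<sigma> xs = (\<Sum>(i, j) | i < j \<and> j < length xs.
     if \<sigma> j < \<sigma> i then 1 + pairing m (xs ! \<sigma> i) (xs ! \<sigma> j) else 0)"

lemma finite_pairs: "finite {(i, j). i < j \<and> j < (n::nat)}"
  by (rule finite_subset[of _ "{..<n} \<times> {..<n}"]) auto

lemma koszul_sign_eq: "koszul_sign m \<sigma> xs = (-1) powi kexp m \<sigma> xs"
proof -
  have *: "(\<Prod>p\<in>A. - ((-1 :: 'a::field_char_0) powi f p)) = (-1) powi (\<Sum>p\<in>A. 1 + f p)"
    if "finite A" for A :: "(nat \<times> nat) set" and f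
    using that by induction (simp_all add: power_int_add)
  let ?A = "{(i, j). i < j \<and> j < length xs \<and> \<sigma> i > \<sigma> j}"
  have fin: "finite ?A" by (rule finite_subset[OF _ finite_pairs[of "length xs"]]) auto
  have "kexp m \<sigma> xs = (\<Sum>(i, j)\<in>?A. 1 + pairing m (xs ! \<sigma> i) (xs ! \<sigma> j))"
    unfolding kexp_def by (rule sum.mono_neutral_cong_right[OF finite_pairs]) (auto split: if_splits)
  then show ?thesis
    unfolding koszul_sign_def using *[OF fin, of "\<lambda>(i, j). pairing m (xs ! \<sigma> i) (xs ! \<sigma> j)"]
    by (simp add: case_prod_beta)
qed

text \<open>
  A permutation acts on the unordered pairs of positions.
\<close>

lemma sum_pairs_permute:
  fixes g :: "nat \<Rightarrow> nat \<Rightarrow> int"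
  assumes \<sigma>: "\<sigma> permutes {..<n}" and g: "\<And>i j. g i j = g j i"
  shows "(\<Sum>(i, j) | i < j \<and> j < n. g (\<sigma> i) (\<sigma> j)) = (\<Sum>(i, j) | i < j \<and> j < n. g i j)"
proof -
  let ?J = "\<lambda>\<sigma>::nat \<Rightarrow> nat. \<lambda>(i, j). (min (\<sigma> i) (\<sigma> j), max (\<sigma> i) (\<sigma> j))"
  have J: "?J \<tau> p \<in> {(i, j). i < j \<and> j < n}"
    if p_in: "p \<in> {(i, j). i < j \<and> j < n}" and \<tau>: "\<tau> permutes {..<n}" for \<tau> p
  proof -
    obtain i j where p: "p = (i, j)" "i < j" "j < n" using p_in by auto
    then have "\<tau> i < n" "\<tau> j < n" using permutes_in_image[OF \<tau>] by auto
    moreover have "\<tau> i \<noteq> \<tau> j" using p permutes_inj[OF \<tau>] by (auto dest: injD)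
    ultimately show ?thesis using p by auto
  qed
  show ?thesis
  proof (rule sum.reindex_bij_witness[where i = "?J (inv \<sigma>)" and j = "?J \<sigma>"])
    fix p assume p: "p \<in> {(i, j). i < j \<and> j < n}"
    show "?J \<sigma> p \<in> {(i, j). i < j \<and> j < n}" by (rule J[OF p \<sigma>])
    show "?J (inv \<sigma>) p \<in> {(i, j). i < j \<and> j < n}" by (rule J[OF p permutes_inv[OF \<sigma>]])
    show "?J (inv \<sigma>) (?J \<sigma> p) = p" "?J \<sigma> (?J (inv \<sigma>) p) = p"
      using p by (auto simp: min_def max_def permutes_inverses[OF \<sigma>])
    show "(case ?J \<sigma> p of (i, j) \<Rightarrow> g i j) = (case p of (i, j) \<Rightarrow> g (\<sigma> i) (\<sigma> j))"
      using g by (auto simp: min_def max_def split: prod.splits)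
  qed
qed

text \<open>
  The Koszul sign is a cocycle. Every unordered pair of positions contributes, up to an even
  number, the exponent of that pair as often as the order of the pair is reversed, and a reversal by
  \<open>\<tau> \<circ> \<sigma>\<close> comes from exactly one of the two permutations.
\<close>

lemma kexp_compose:
  assumes \<sigma>: "\<sigma> permutes {..<length xs}" and \<tau>: "\<tau> permutes {..<length xs}"
  shows "even (kexp m (\<tau> \<circ> \<sigma>) xs - (kexp m \<tau> xs + kexp m \<sigma> (permute_list \<tau> xs)))"
proof -
  let ?h = "\<lambda>i j. 1 + pairing m (xs ! i) (xs ! j)"
  let ?D = "{(i, j). i < j \<and> j < length xs}"
  define g where "g i j = (if (i < j) \<noteq> (\<tau> i < \<tau> j) \<and> i \<noteq> j then ?h (\<tau> i) (\<tau> j) else 0)" for i j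
  have inj: "\<tau> i = \<tau> j \<longleftrightarrow> i = j" "\<sigma> i = \<sigma> j \<longleftrightarrow> i = j" for i j
    using permutes_inj[OF \<sigma>] permutes_inj[OF \<tau>] by (auto dest: injD)
  have g: "g i j = g j i" for i j
    using inj(1)[of i j] by (auto simp: g_def pairing_commute)
  have "kexp m \<tau> xs = (\<Sum>(i, j)\<in>?D. g i j)"
    unfolding kexp_def by (intro sum.cong) (use inj in \<open>fastforce simp: g_def\<close>)+
  also have "\<dots> = (\<Sum>(i, j)\<in>?D. g (\<sigma> i) (\<sigma> j))"
    by (rule sum_pairs_permute[OF \<sigma> g, symmetric])
  finally have 1: "kexp m \<tau> xs = \<dots>" .
  have nth: "permute_list \<tau> xs ! \<sigma> i = xs ! \<tau> (\<sigma> i)" if "i < length xs" for i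
    by (rule permute_list_nth[OF \<tau>]) (use that permutes_in_image[OF \<sigma>] in auto)
  have 2: "kexp m \<sigma> (permute_list \<tau> xs) =
      (\<Sum>(i, j)\<in>?D. if \<sigma> j < \<sigma> i then ?h (\<tau> (\<sigma> i)) (\<tau> (\<sigma> j)) else 0)"
    unfolding kexp_def by (intro sum.cong) (auto simp: nth)
  have 3: "kexp m (\<tau> \<circ> \<sigma>) xs =
      (\<Sum>(i, j)\<in>?D. if \<tau> (\<sigma> j) < \<tau> (\<sigma> i) then ?h (\<tau> (\<sigma> i)) (\<tau> (\<sigma> j)) else 0)"
    unfolding kexp_def by (intro sum.cong) auto
  show ?thesis
    unfolding 1 2 3 sum.distrib[symmetric] sum_subtractf[symmetric]
  proof (rule dvd_sum)
    fix p assume "p \<in> ?D"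
    then obtain i j where p: "p = (i, j)" "i < j" by auto
    then have "\<sigma> i \<noteq> \<sigma> j" "\<tau> (\<sigma> i) \<noteq> \<tau> (\<sigma> j)" using inj by auto
    then show "even ((case p of (i, j) \<Rightarrow> if \<tau> (\<sigma> j) < \<tau> (\<sigma> i) then ?h (\<tau> (\<sigma> i)) (\<tau> (\<sigma> j)) else 0) -
      ((case p of (i, j) \<Rightarrow> g (\<sigma> i) (\<sigma> j)) +
       (case p of (i, j) \<Rightarrow> if \<sigma> j < \<sigma> i then ?h (\<tau> (\<sigma> i)) (\<tau> (\<sigma> j)) else 0)))"
      by (auto simp: p g_def)
  qed
qed

text \<open>
  Alternating in the graded sense. These are exactly the fixed points of the alternator, which gives a
  description of the elements of \<open>A(U)\<close> that does not mention preimages under the alternator.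
\<close>

definition alternating :: "('k, 'u::ab_group_add) gspace \<Rightarrow> ('u list \<Rightarrow> 'u) \<Rightarrow> bool" where
  "alternating U K \<longleftrightarrow> (\<forall>Xs xs \<sigma>. homs U Xs xs \<longrightarrow> \<sigma> permutes {..<length Xs} \<longrightarrow>
     K (permute_list \<sigma> Xs) = signed (kexp (gdim U) \<sigma> xs) (K Xs))"

lemma homs_permute: 
  assumes "homs U Xs xs" "\<sigma> permutes {..<length Xs}"
  shows "homs U (permute_list \<sigma> Xs) (permute_list \<sigma> xs)"
proof -
  have "length Xs = length xs" using assms(1) by (rule list_all2_lengthD)
  then show ?thesis
    using assms permutes_in_image[OF assms(2)]
    by (auto simp: list_all2_conv_all_nth permute_list_nth)
qed

lemma sum_list_permute:
  fixes xs :: "mdeg list"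
  assumes "\<sigma> permutes {..<length xs}"
  shows "sum_list (permute_list \<sigma> xs) = sum_list xs"
  using mset_permute_list[OF assms] by (metis sum_mset_sum_list)

context graded_vs
begin

lemma multilinear_cong:
  assumes "multilinear U p K" "\<And>Xs. length Xs = p \<Longrightarrow> L Xs = K Xs" "\<And>Xs. length Xs \<noteq> p \<Longrightarrow> L Xs = 0"
  shows "multilinear U p L"
proof -
  have "L = K"
    using assms(2,3) ml_length[OF assms(1)] by (metis ext)
  with assms(1) show ?thesis by simp
qed

lemma multilinear_permute:
  assumes K: "multilinear U p K" and \<sigma>: "\<sigma> permutes {..<p}"
  shows "multilinear U p (\<lambda>Xs. K (permute_list \<sigma> Xs))"
  unfolding multilinear_def
proof (intro conjI allI impI)
  fix Xs :: "'u list" and i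
  assume Xs: "length Xs = p" "i < p"
  have "permute_list \<sigma> (Xs[i := v]) = (permute_list \<sigma> Xs)[inv \<sigma> i := v]" for v
  proof (rule nth_equalityI)
    fix j assume "j < length (permute_list \<sigma> (Xs[i := v]))"
    then show "permute_list \<sigma> (Xs[i := v]) ! j = (permute_list \<sigma> Xs)[inv \<sigma> i := v] ! j"
      using Xs \<sigma> permutes_in_image[OF \<sigma>, of j] permutes_inv_eq[OF \<sigma>, of i j]
      by (auto simp: permute_list_nth nth_list_update)
  qed simp
  moreover have "inv \<sigma> i < p" using permutes_in_image[OF permutes_inv[OF \<sigma>], of i] Xs by simp
  moreover have "length (permute_list \<sigma> Xs) = p" using Xs by simp
  ultimately show "Vector_Spaces.linear (gscale U) (gscale U) (\<lambda>v. K (permute_list \<sigma> (Xs[i := v])))"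
    using K unfolding multilinear_def by simp
qed (simp add: ml_length[OF K])

lemma alternator_summand_multilinear:
  assumes K: "multilinear U p K"
  shows "multilinear U p (\<lambda>Ys. gscale U (1 / fact (length Ys))
       (\<Sum>\<sigma> | \<sigma> permutes {..<length Ys}. gscale U (koszul_sign (gdim U) \<sigma> xs) (K (permute_list \<sigma> Ys))))"
proof (rule multilinear_cong)
  show "multilinear U p (\<lambda>Ys. gscale U (1 / fact p)
       (\<Sum>\<sigma> | \<sigma> permutes {..<p}. gscale U (koszul_sign (gdim U) \<sigma> xs) (K (permute_list \<sigma> Ys))))"
    by (intro multilinear_scale multilinear_sum multilinear_permute K) simp
qed (simp_all add: ml_length[OF K])

lemma multilinear_alternator: "multilinear U p K \<Longrightarrow> multilinear U p (alternator U K)"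
  unfolding alternator_def by (rule multilinear_hom_ext) (rule alternator_summand_multilinear)

lemma alternator_homogeneous:
  assumes K: "multilinear U p K" and Xs: "homs U Xs xs"
  shows "alternator U K Xs = gscale U (1 / fact (length Xs))
     (\<Sum>\<sigma> | \<sigma> permutes {..<length Xs}. signed (kexp (gdim U) \<sigma> xs) (K (permute_list \<sigma> Xs)))"
  unfolding alternator_def
  by (subst hom_ext_homogeneous[OF alternator_summand_multilinear[OF K] Xs])
     (simp add: koszul_sign_eq scale_sign)

lemma alternator_degree:
  assumes K: "multilinear U p K" and deg: "has_degree U \<kappa> K"
  shows "has_degree U \<kappa> (alternator U K)"
  unfolding has_degree_def
proof (intro allI impI)
  fix Xs xs assume Xs: "homs U Xs xs"
  have len: "length Xs = length xs" using Xs by (rule list_all2_lengthD)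
  show "alternator U K Xs \<in> gpart U (sum_list xs + \<kappa>)"
    unfolding alternator_homogeneous[OF K Xs]
  proof (intro part_scale part_sum part_signed)
    fix \<sigma> assume "\<sigma> \<in> {\<sigma>. \<sigma> permutes {..<length Xs}}"
    then have \<sigma>: "\<sigma> permutes {..<length Xs}" by simp
    show "K (permute_list \<sigma> Xs) \<in> gpart U (sum_list xs + \<kappa>)"
      using deg homs_permute[OF Xs \<sigma>] sum_list_permute[of \<sigma> xs] \<sigma> len
      unfolding has_degree_def by metis
  qed
qed

text \<open>
  Permuting the arguments permutes the summands of the alternator, and the cocycle property turns the
  change of the signs into one common factor.
\<close>

lemma alternating_alternator:
  assumes K: "multilinear U p K"
  shows "alternating U (alternator U K)"
  unfolding alternating_def
proof (intro allI impI)
  fix Xs xs \<tau> assume Xs: "homs U Xs xs" and \<tau>: "\<tau> permutes {..<length Xs}"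
  have len: "length Xs = length xs" using Xs by (rule list_all2_lengthD)
  let ?N = "length Xs" and ?k = "kexp (gdim U)"
  have "(\<Sum>\<sigma> | \<sigma> permutes {..<?N}. signed (?k \<sigma> (permute_list \<tau> xs)) (K (permute_list \<sigma> (permute_list \<tau> Xs))))
      = (\<Sum>\<sigma> | \<sigma> permutes {..<?N}. signed (?k \<tau> xs) (signed (?k (\<tau> \<circ> \<sigma>) xs) (K (permute_list (\<tau> \<circ> \<sigma>) Xs))))"
  proof (rule sum.cong[OF refl])
    fix \<sigma> assume "\<sigma> \<in> {\<sigma>. \<sigma> permutes {..<?N}}"
    then have \<sigma>: "\<sigma> permutes {..<?N}" by simp
    have ev: "even (?k \<sigma> (permute_list \<tau> xs) - (?k \<tau> xs + ?k (\<tau> \<circ> \<sigma>) xs))"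
      using kexp_compose[of \<sigma> xs \<tau> "gdim U"] \<sigma> \<tau> len by auto
    show "signed (?k \<sigma> (permute_list \<tau> xs)) (K (permute_list \<sigma> (permute_list \<tau> Xs))) =
        signed (?k \<tau> xs) (signed (?k (\<tau> \<circ> \<sigma>) xs) (K (permute_list (\<tau> \<circ> \<sigma>) Xs)))"
      unfolding signed_signed permute_list_compose[OF \<sigma>] by (rule signed_cong[OF ev])
  qed
  also have "\<dots> = signed (?k \<tau> xs) (\<Sum>\<sigma> | \<sigma> permutes {..<?N}. signed (?k \<sigma> xs) (K (permute_list \<sigma> Xs)))"
    unfolding signed_sum
  proof (rule sum.reindex_bij_betw[where h = "(\<circ>) \<tau>"
        and g = "\<lambda>\<sigma>. signed (?k \<tau> xs) (signed (?k \<sigma> xs) (K (permute_list \<sigma> Xs)))"])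
    show "bij_betw ((\<circ>) \<tau>) {\<sigma>. \<sigma> permutes {..<?N}} {\<sigma>. \<sigma> permutes {..<?N}}"
      by (rule bij_betw_byWitness[where f' = "(\<circ>) (inv \<tau>)"])
         (use \<tau> in \<open>auto simp: o_assoc[symmetric] permutes_inv_o permutes_compose permutes_inv, 
            auto simp: o_assoc permutes_inv_o\<close>)
  qed
  finally show "alternator U K (permute_list \<tau> Xs) = signed (?k \<tau> xs) (alternator U K Xs)"
    by (simp add: alternator_homogeneous[OF K Xs] alternator_homogeneous[OF K homs_permute[OF Xs \<tau>]] scale_signed)
qed

text \<open>
  All summands are equal, and their number is invertible in characteristic \<open>0\<close>.
\<close>

lemma alternator_id:
  assumes K: "multilinear U p K" and alt: "alternating U K"
  shows "alternator U K = K"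
proof (rule multilinear_eqI[OF multilinear_alternator[OF K] K])
  fix Xs xs assume Xs: "homs U Xs xs"
  have "(\<Sum>\<sigma> | \<sigma> permutes {..<length Xs}. signed (kexp (gdim U) \<sigma> xs) (K (permute_list \<sigma> Xs)))
      = (\<Sum>\<sigma> | \<sigma> permutes {..<length Xs}. K Xs)"
    by (rule sum.cong[OF refl]) (use alt Xs in \<open>auto simp: alternating_def signed_def\<close>)
  also have "\<dots> = gscale U (fact (length Xs)) (K Xs)"
    by (simp add: vs.sum_constant_scale card_permutations)
  finally show "alternator U K Xs = K Xs"
    unfolding alternator_homogeneous[OF K Xs] by simp
qed

subsection \<open>The parts of \<open>A(U)\<close>\<close>

lemma multi_maps_iff:
  "-1 \<le> k \<Longrightarrow> K \<in> multi_maps U (k, \<kappa>) \<longleftrightarrow> multilinear U (nat (k + 1)) K \<and> has_degree U \<kappa> K"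
proof -
  assume k: "-1 \<le> k"
  have "has_degree U \<kappa> K \<longleftrightarrow> (\<forall>xs ds. length xs = nat (k + 1) \<longrightarrow> homs U xs ds \<longrightarrow>
        K xs \<in> gpart U (sum_list ds + \<kappa>))" if "multilinear U (nat (k + 1)) K"
    unfolding has_degree_def using ml_length[OF that] part_zero by metis
  with k show ?thesis by (auto simp: multi_maps_def)
qed

lemma alternator_zero: "alternator U (\<lambda>_. 0) = (\<lambda>_. 0)"
  by (rule ext) (simp add: alternator_def hom_ext_def)

lemma alt_maps_below: "k < -1 \<Longrightarrow> alt_maps U (k, \<kappa>) = {0}"
  using alternator_zero by (simp add: alt_maps_def multi_maps_def zero_fun_def)

lemma alt_maps_iff:
  assumes "-1 \<le> k"
  shows "K \<in> alt_maps U (k, \<kappa>) \<longleftrightarrow> multilinear U (nat (k + 1)) K \<and> has_degree U \<kappa> K \<and> alternating U K"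
proof
  assume "K \<in> alt_maps U (k, \<kappa>)"
  then obtain L where L: "K = alternator U L" "multilinear U (nat (k + 1)) L" "has_degree U \<kappa> L"
    using assms by (auto simp: alt_maps_def multi_maps_iff)
  then show "multilinear U (nat (k + 1)) K \<and> has_degree U \<kappa> K \<and> alternating U K"
    using multilinear_alternator[OF L(2)] alternator_degree[OF L(2,3)] alternating_alternator[OF L(2)] by simp
next
  assume K: "multilinear U (nat (k + 1)) K \<and> has_degree U \<kappa> K \<and> alternating U K"
  then have "alternator U K = K" using alternator_id by blast
  moreover have "K \<in> multi_maps U (k, \<kappa>)" using K assms by (simp add: multi_maps_iff)
  ultimately show "K \<in> alt_maps U (k, \<kappa>)" unfolding alt_maps_def by (metis image_eqI)
qed

lemma alternating_zero: "alternating U (\<lambda>_. 0)"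
  by (simp add: alternating_def)

lemma has_degree_zero: "has_degree U \<kappa> (\<lambda>_. 0)"
  by (simp add: has_degree_def part_zero)

lemma alt_multilinear: "K \<in> alt_maps U (k, \<kappa>) \<Longrightarrow> multilinear U (nat (k + 1)) K"
  by (cases "k < -1") (auto simp: alt_maps_below alt_maps_iff zero_fun_def multilinear_zero)

lemma alt_degree: "K \<in> alt_maps U (k, \<kappa>) \<Longrightarrow> has_degree U \<kappa> K"
  by (cases "k < -1") (auto simp: alt_maps_below alt_maps_iff zero_fun_def has_degree_zero)

lemma alt_alternating: "K \<in> alt_maps U (k, \<kappa>) \<Longrightarrow> alternating U K"
  by (cases "k < -1") (auto simp: alt_maps_below alt_maps_iff zero_fun_def alternating_zero)

lemma alt_length: "K \<in> alt_maps U (k, \<kappa>) \<Longrightarrow> int (length Xs) \<noteq> k + 1 \<Longrightarrow> K Xs = 0"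
  by (cases "k < -1") (auto simp: alt_maps_below intro!: ml_length[OF alt_multilinear])

lemma alternating_diff: "alternating U K \<Longrightarrow> alternating U L \<Longrightarrow> alternating U (K - L)"
  by (simp add: alternating_def signed_diff)

lemma alternating_scale: "alternating U K \<Longrightarrow> alternating U (map_scale U a K)"
  by (simp add: alternating_def map_scale_def scale_signed)

lemma alt_diff: "K \<in> alt_maps U d \<Longrightarrow> L \<in> alt_maps U d \<Longrightarrow> K - L \<in> alt_maps U d"
proof (cases d)
  case (Pair k \<kappa>)
  assume "K \<in> alt_maps U d" "L \<in> alt_maps U d"
  then show ?thesis
    using multilinear_add[of "nat (k + 1)" K "\<lambda>Xs. - L Xs"] multilinear_signed[of "nat (k + 1)" L 1]
      alternating_diff[of K L]
    by (cases "k < -1")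
       (auto simp: Pair alt_maps_below alt_maps_iff signed_def fun_diff_def has_degree_def intro: part_diff)
qed

lemma alt_scale: "K \<in> alt_maps U d \<Longrightarrow> map_scale U a K \<in> alt_maps U d"
proof (cases d)
  case (Pair k \<kappa>)
  assume "K \<in> alt_maps U d"
  then show ?thesis
    using multilinear_scale[of "nat (k + 1)" K a] alternating_scale[of K a]
    by (cases "k < -1")
       (auto simp: Pair alt_maps_below alt_maps_iff map_scale_def has_degree_def zero_fun_def intro: part_scale)
qed

lemma alt_zero: "0 \<in> alt_maps U d"
  by (cases d; cases "fst d < -1")
     (auto simp: alt_maps_below alt_maps_iff zero_fun_def multilinear_zero has_degree_zero alternating_zero)

text \<open>
  The arity separates form degrees, and on homogeneous arguments the weights separate because the sum
  of the parts of \<open>U\<close> is direct.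
\<close>

lemma direct_alt_maps: "direct (alt_maps U)"
  unfolding direct_def
proof (intro conjI allI impI ballI)
  fix f and d :: "int \<times> mdeg" assume f: "decomposes (alt_maps U) 0 f"
  obtain k \<kappa> where d: "d = (k, \<kappa>)" by (cases d)
  have fin: "finite {d. f d \<noteq> 0}" and fa: "\<And>d. f d \<in> alt_maps U d" and s: "0 = (\<Sum>d | f d \<noteq> 0. f d)"
    using f unfolding decomposes_def by auto
  have "f d = (\<lambda>_. 0)"
  proof (rule multilinear_eqI[OF _ multilinear_zero])
    show "multilinear U (nat (k + 1)) (f d)" using fa[of d] d alt_multilinear by simp
    fix Xs xs assume Xs: "homs U Xs xs" and len: "length Xs = nat (k + 1)"
    show "f d Xs = 0"
    proof (cases "k < -1")
      case False
      let ?D = "{d. f d \<noteq> 0}"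
      let ?K = "insert \<kappa> (snd ` ?D)"
      have z: "f (k', \<kappa>') Xs = 0" if "k' \<noteq> k" for k' \<kappa>'
        using alt_length[OF fa[of "(k', \<kappa>')"], of Xs] that len False by auto
      \<comment> \<open>the summand of weight \<open>\<kappa>\<close> takes its value on \<open>Xs\<close> in the degree \<open>sum_list xs + \<kappa>\<close>\<close>
      have "decomposes (gpart U) 0 (\<lambda>x. f (k, x - sum_list xs) Xs)"
      proof (rule decomposesI[of "(\<lambda>\<kappa>. sum_list xs + \<kappa>) ` ?K"])
        show "finite ((\<lambda>\<kappa>. sum_list xs + \<kappa>) ` ?K)" using fin by auto
        show "f (k, x - sum_list xs) Xs \<in> gpart U x" for x
        proof -
          have "f (k, x - sum_list xs) Xs \<in> gpart U (sum_list xs + (x - sum_list xs))"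
            using alt_degree[OF fa[of "(k, x - sum_list xs)"]] Xs unfolding has_degree_def by blast
          then show ?thesis by simp
        qed
        show "f (k, x - sum_list xs) Xs = 0" if "x \<notin> (\<lambda>\<kappa>. sum_list xs + \<kappa>) ` ?K" for x
        proof (rule ccontr)
          assume "f (k, x - sum_list xs) Xs \<noteq> 0"
          then have "(k, x - sum_list xs) \<in> ?D" by auto
          from imageI[OF this, of snd] have "x - sum_list xs \<in> ?K" by simp
          then have "sum_list xs + (x - sum_list xs) \<in> (\<lambda>\<kappa>. sum_list xs + \<kappa>) ` ?K" by (rule imageI)
          with that show False by simp
        qed
        have "0 = (\<Sum>d\<in>?D. f d Xs)" using fun_cong[OF s, of Xs] by (simp add: sum_fun_apply)
        also have "\<dots> = (\<Sum>d\<in>Pair k ` ?K. f d Xs)"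
          by (rule sum.mono_neutral_cong) (use fin z in \<open>force simp: image_iff\<close>)+
        also have "\<dots> = (\<Sum>\<kappa>\<in>?K. f (k, \<kappa>) Xs)" by (subst sum.reindex) (auto intro: inj_onI)
        also have "\<dots> = (\<Sum>x\<in>(\<lambda>\<kappa>. sum_list xs + \<kappa>) ` ?K. f (k, x - sum_list xs) Xs)"
          by (subst sum.reindex) (auto intro: inj_onI)
        finally show "0 = \<dots>" .
      qed
      from direct_unique[OF direct_part this, of "sum_list xs + \<kappa>"] show ?thesis by (simp add: d)
    qed (use fa[of d] d in \<open>simp add: alt_maps_below\<close>)
  qed
  then show "f d = 0" by (simp add: zero_fun_def)
qed (simp_all add: alt_zero alt_diff)

end

section \<open>Signs of families of arguments\<close>

text \<open>
  Families of arguments are indexed by a linearly ordered set, so that arguments can be selected by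
  subsets instead of positions. The first function is the exponent of the sign \<open>\<epsilon>(A, B)\<close> of moving the
  arguments in \<open>A\<close> in front of those in \<open>B\<close>; the second is the exponent of the sign of sorting a list.
\<close>

definition kinv :: "nat \<Rightarrow> ('i::linorder \<Rightarrow> mdeg) \<Rightarrow> 'i set \<Rightarrow> 'i set \<Rightarrow> int" where
  "kinv m x A B = (\<Sum>a\<in>A. \<Sum>b\<in>B. if b < a then 1 + pairing m (x a) (x b) else 0)"

fun lexp :: "nat \<Rightarrow> ('i::linorder \<Rightarrow> mdeg) \<Rightarrow> 'i list \<Rightarrow> int" where
  "lexp m x [] = 0"
| "lexp m x (a # l) = kinv m x {a} (set l) + lexp m x l"

abbreviation args :: "('i::linorder \<Rightarrow> 'u) \<Rightarrow> 'i set \<Rightarrow> 'u list" where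
  "args X S \<equiv> map X (sorted_list_of_set S)"

lemma kinv_Un_left:
  "finite A \<Longrightarrow> finite A' \<Longrightarrow> A \<inter> A' = {} \<Longrightarrow> kinv m x (A \<union> A') B = kinv m x A B + kinv m x A' B"
  by (simp add: kinv_def sum.union_disjoint)

lemma kinv_Un_right:
  "finite B \<Longrightarrow> finite B' \<Longrightarrow> B \<inter> B' = {} \<Longrightarrow> kinv m x A (B \<union> B') = kinv m x A B + kinv m x A B'"
  by (simp add: kinv_def sum.union_disjoint sum.distrib)

lemma kinv_empty [simp]: "kinv m x {} B = 0" "kinv m x A {} = 0"
  by (simp_all add: kinv_def)

lemma kinv_insert_left:
  "finite A \<Longrightarrow> a \<notin> A \<Longrightarrow> kinv m x (insert a A) B = kinv m x {a} B + kinv m x A B"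
  by (simp add: kinv_def)

lemma kinv_insert_right:
  "finite B \<Longrightarrow> b \<notin> B \<Longrightarrow> kinv m x A (insert b B) = kinv m x A {b} + kinv m x A B"
  by (simp add: kinv_def sum.distrib)

lemma kinv_cong:
  "(\<And>i. i \<in> A \<union> B \<Longrightarrow> x i = y i) \<Longrightarrow> kinv m x A B = kinv m y A B"
  unfolding kinv_def by (intro sum.cong refl) auto

lemma kinv_below:
  assumes "\<And>b. b \<in> B \<Longrightarrow> z < b"
  shows "kinv m x {z} B = 0"
proof -
  have "\<not> b < z" if "b \<in> B" for b using assms[OF that] by simp
  then show ?thesis by (simp add: kinv_def)
qed

lemma kinv_above:
  "(\<And>a. a \<in> A \<Longrightarrow> z < a) \<Longrightarrow> kinv m x A {z} = int (card A) + pairing m (\<Sum>a\<in>A. x a) (x z)"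
  by (simp add: kinv_def sum.distrib) (simp only: pairing_sum_left)

text \<open>
  Both orders together reverse every pair from \<open>A \<times> B\<close> once, so the two exponents add up to the exponent
  of exchanging objects of degrees \<open>(|A|, x\<^sub>A)\<close> and \<open>(|B|, x\<^sub>B)\<close>, where \<open>x\<^sub>A\<close> is the total degree.
\<close>

lemma kinv_swap:
  assumes "A \<inter> B = {}"
  shows "kinv m x A B + kinv m x B A =
    int (card A) * int (card B) + pairing m (\<Sum>a\<in>A. x a) (\<Sum>b\<in>B. x b)"
proof -
  have 1: "kinv m x B A = (\<Sum>a\<in>A. \<Sum>b\<in>B. if a < b then 1 + pairing m (x b) (x a) else 0)"
    unfolding kinv_def by (rule sum.swap)
  have "(if b < a then 1 + pairing m (x a) (x b) else 0) + (if a < b then 1 + pairing m (x b) (x a) else 0)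
      = 1 + pairing m (x a) (x b)" if "a \<in> A" "b \<in> B" for a b
    using that assms pairing_commute[of m "x a" "x b"] by (cases a b rule: linorder_cases) auto
  then have "kinv m x A B + kinv m x B A = (\<Sum>a\<in>A. \<Sum>b\<in>B. 1 + pairing m (x a) (x b))"
    unfolding 1 unfolding kinv_def by (simp add: sum.distrib[symmetric])
  also have "\<dots> = int (card A) * int (card B) + pairing m (\<Sum>a\<in>A. x a) (\<Sum>b\<in>B. x b)"
    by (subst pairing_sum_left, subst pairing_sum_right) (simp add: sum.distrib)
  finally show ?thesis .
qed

lemma lexp_append:
  "distinct (l @ l') \<Longrightarrow> lexp m x (l @ l') = lexp m x l + kinv m x (set l) (set l') + lexp m x l'"
proof (induction l)
  case (Cons a l)
  then show ?case
    using kinv_insert_left[of "set l" a m x "set l'"] kinv_Un_right[of "set l" "set l'" m x "{a}"] by auto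
qed simp

lemma lexp_cong: "(\<And>i. i \<in> set l \<Longrightarrow> x i = y i) \<Longrightarrow> lexp m x l = lexp m y l"
  by (induction l) (auto intro!: kinv_cong arg_cong2[where f = "(+)"])

lemma sum_pairs_nested:
  fixes F :: "nat \<Rightarrow> nat \<Rightarrow> int"
  shows "(\<Sum>(i, j) | i < j \<and> j < n. F i j) = (\<Sum>j<n. \<Sum>i<j. F i j)"
proof -
  have "(\<Sum>j<n. \<Sum>i<j. F i j) = (\<Sum>(j, i)\<in>Sigma {..<n} (\<lambda>j. {..<j}). F i j)"
    by (rule sum.Sigma) auto
  also have "\<dots> = (\<Sum>(i, j) | i < j \<and> j < n. F i j)"
    by (rule sum.reindex_bij_witness[where i = "\<lambda>(i, j). (j, i)" and j = "\<lambda>(j, i). (i, j)"]) auto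
  finally show ?thesis by simp
qed

lemma lexp_nth:
  "distinct l \<Longrightarrow> lexp m x l =
     (\<Sum>j<length l. \<Sum>i<j. if l ! j < l ! i then 1 + pairing m (x (l ! i)) (x (l ! j)) else 0)"
proof (induction l)
  case (Cons a l)
  have "kinv m x {a} (set l) = (\<Sum>b\<in>set l. if b < a then 1 + pairing m (x a) (x b) else 0)"
    by (simp add: kinv_def)
  also have "\<dots> = (\<Sum>j<length l. if l ! j < a then 1 + pairing m (x a) (x (l ! j)) else 0)"
    using Cons.prems
    by (intro sum.reindex_bij_betw[symmetric, where h = "(!) l"]) (auto intro: bij_betw_nth)
  finally show ?case
    using Cons by (simp add: sum.lessThan_Suc_shift sum.distrib del: sum.lessThan_Suc cong del: if_weak_cong)
qed simp

lemma kexp_eq_lexp: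
  assumes \<sigma>: "\<sigma> permutes {..<length L}" and L: "sorted_wrt (<) L"
  shows "kexp m \<sigma> (map x L) = lexp m x (permute_list \<sigma> L)"
proof -
  have d: "distinct L" using L by (simp add: strict_sorted_iff)
  have lt: "L ! i < L ! j \<longleftrightarrow> i < j" if "i < length L" "j < length L" for i j
    using that L by (metis linorder_neqE_nat order_less_asym order_less_irrefl sorted_wrt_nth_less)
  have s: "\<sigma> i < length L" if "i < length L" for i using permutes_in_image[OF \<sigma>, of i] that by simp
  have "distinct (permute_list \<sigma> L)" using d \<sigma> by simp
  then show ?thesis
    unfolding kexp_def sum_pairs_nested lexp_nth
    using \<sigma> by (simp only: lexp_nth length_map length_permute_list)
       (intro sum.cong refl, auto simp: permute_list_nth lt s)
qed

lemma sum_permutes_eq: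
  fixes g :: "'i::linorder list \<Rightarrow> 'b::comm_monoid_add"
  assumes "finite T"
  shows "(\<Sum>\<sigma> | \<sigma> permutes {..<card T}. g (permute_list \<sigma> (sorted_list_of_set T)))
    = (\<Sum>l\<in>permutations_of_set T. g l)"
proof -
  let ?L = "sorted_list_of_set T"
  have len: "length ?L = card T" by simp
  show ?thesis
  proof (rule sum.reindex_bij_betw)
    show "bij_betw (\<lambda>\<sigma>. permute_list \<sigma> ?L) {\<sigma>. \<sigma> permutes {..<card T}} (permutations_of_set T)"
    proof (rule bij_betw_imageI)
      show "inj_on (\<lambda>\<sigma>. permute_list \<sigma> ?L) {\<sigma>. \<sigma> permutes {..<card T}}"
      proof (rule inj_onI)
        fix \<sigma> \<tau> assume "\<sigma> \<in> {\<sigma>. \<sigma> permutes {..<card T}}" "\<tau> \<in> {\<sigma>. \<sigma> permutes {..<card T}}"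
          and e: "permute_list \<sigma> ?L = permute_list \<tau> ?L"
        then have st: "\<sigma> permutes {..<card T}" "\<tau> permutes {..<card T}" by auto
        show "\<sigma> = \<tau>"
        proof
          fix i show "\<sigma> i = \<tau> i"
          proof (cases "i < card T")
            case True
            then have "?L ! \<sigma> i = ?L ! \<tau> i"
              using e st len by (metis permute_list_nth)
            moreover have "\<sigma> i < length ?L" "\<tau> i < length ?L"
              using True permutes_in_image[OF st(1), of i] permutes_in_image[OF st(2), of i] by auto
            ultimately show ?thesis using nth_eq_iff_index_eq[of ?L] by auto
          next
            case False
            then show ?thesis
              using permutes_not_in[OF st(1), of i] permutes_not_in[OF st(2), of i] by simp
          qed
        qed
      qed
      show "(\<lambda>\<sigma>. permute_list \<sigma> ?L) ` {\<sigma>. \<sigma> permutes {..<card T}} = permutations_of_set T"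
      proof (intro equalityI subsetI)
        fix l assume "l \<in> (\<lambda>\<sigma>. permute_list \<sigma> ?L) ` {\<sigma>. \<sigma> permutes {..<card T}}"
        then show "l \<in> permutations_of_set T"
          using assms by (auto simp: permutations_of_set_def)
      next
        fix l assume "l \<in> permutations_of_set T"
        then have "mset l = mset ?L"
          using assms by (metis distinct_sorted_list_of_set permutations_of_setD set_eq_iff_mset_eq_distinct set_sorted_list_of_set)
        then obtain \<sigma> where "\<sigma> permutes {..<length ?L}" "permute_list \<sigma> ?L = l"
          by (rule mset_eq_permutation)
        then show "l \<in> (\<lambda>\<sigma>. permute_list \<sigma> ?L) ` {\<sigma>. \<sigma> permutes {..<card T}}" by auto
      qed
    qed
  qed
qed

text \<open>
  A listing of \<open>T\<close> consists of a choice of the set of its first \<open>p\<close> entries, a listing of this set and a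
  listing of the rest.
\<close>

lemma sum_permutations_take:
  fixes F :: "'i set \<Rightarrow> 'b::comm_monoid_add"
  assumes T: "finite T" "card T = p + q"
  shows "(\<Sum>l\<in>permutations_of_set T. F (set (take p l)))
    = (\<Sum>S | S \<subseteq> T \<and> card S = p. \<Sum>_\<in>permutations_of_set S \<times> permutations_of_set (T - S). F S)"
proof -
  let ?D = "Sigma {S. S \<subseteq> T \<and> card S = p} (\<lambda>S. permutations_of_set S \<times> permutations_of_set (T - S))"
  have "(\<Sum>S | S \<subseteq> T \<and> card S = p. \<Sum>_\<in>permutations_of_set S \<times> permutations_of_set (T - S). F S)
    = (\<Sum>(S, _)\<in>?D. F S)"
    by (rule sum.Sigma) (use T in auto)
  also have "\<dots> = (\<Sum>l\<in>permutations_of_set T. F (set (take p l)))"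
  proof (rule sum.reindex_bij_witness[where i = "\<lambda>l. (set (take p l), take p l, drop p l)"
        and j = "\<lambda>(S, l1, l2). l1 @ l2"])
    fix a assume "a \<in> ?D"
    then obtain S l1 l2 where a: "a = (S, l1, l2)" "S \<subseteq> T" "card S = p"
      "set l1 = S" "distinct l1" "set l2 = T - S" "distinct l2"
      by (auto simp: permutations_of_set_def)
    have "length l1 = p" using a distinct_card by metis
    then show "(\<lambda>l. (set (take p l), take p l, drop p l)) (case a of (S, l1, l2) \<Rightarrow> l1 @ l2) = a"
      "F (set (take p (case a of (S, l1, l2) \<Rightarrow> l1 @ l2))) = (case a of (S, _) \<Rightarrow> F S)"
      using a by auto
    show "(case a of (S, l1, l2) \<Rightarrow> l1 @ l2) \<in> permutations_of_set T"
      using a by (auto simp: permutations_of_set_def)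
  next
    fix l assume "l \<in> permutations_of_set T"
    then have l: "set l = T" "distinct l" by (auto simp: permutations_of_set_def)
    then have "length l = p + q" using T distinct_card by metis
    then have "card (set (take p l)) = p" using l by (simp add: distinct_card)
    moreover have "set (drop p l) = T - set (take p l)"
      using l by (metis append_take_drop_id set_append distinct_append Un_Diff Diff_cancel Diff_triv Int_commute sup_bot_left)
    ultimately show "(set (take p l), take p l, drop p l) \<in> ?D"
      using l by (auto simp: permutations_of_set_def dest: in_set_takeD)
  qed auto
  finally show ?thesis by simp
qed

lemma args_insert_below:
  assumes "finite R" "\<And>r. r \<in> R \<Longrightarrow> z < r"
  shows "args X (insert z R) = X z # args X R"
proof -
  have "sorted_list_of_set (insert z R) = z # sorted_list_of_set R"
  proof -
    have "z \<notin> R" using assms(2)[of z] by auto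
    moreover have "insort z (sorted_list_of_set R) = z # sorted_list_of_set R"
      using assms by (intro insort_is_Cons) (simp add: less_imp_le)
    ultimately show ?thesis using assms(1) by simp
  qed
  then show ?thesis by simp
qed

context graded_vs
begin

lemma homs_map: "(\<And>i. i \<in> set l \<Longrightarrow> X i \<in> gpart U (x i)) \<Longrightarrow> homs U (map X l) (map x l)"
  by (auto simp: list_all2_conv_all_nth)

lemma degree_args:
  assumes "has_degree U \<kappa> K" "finite S" "\<And>i. i \<in> S \<Longrightarrow> X i \<in> gpart U (x i)"
  shows "K (args X S) \<in> gpart U ((\<Sum>i\<in>S. x i) + \<kappa>)"
proof -
  have "homs U (args X S) (args x S)" using assms by (intro homs_map) auto
  then have "K (args X S) \<in> gpart U (sum_list (args x S) + \<kappa>)"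
    using assms(1) unfolding has_degree_def by blast
  then show ?thesis using assms(2) by (simp add: sum_list_distinct_conv_sum_set)
qed

lemma alternating_family:
  assumes "alternating U K" "distinct l" "\<And>i. i \<in> set l \<Longrightarrow> X i \<in> gpart U (x i)"
  shows "K (map X l) = signed (lexp (gdim U) x l) (K (args X (set l)))"
proof -
  let ?L = "sorted_list_of_set (set l)"
  have "mset l = mset ?L"
    using assms(2) by (metis List.finite_set distinct_sorted_list_of_set set_eq_iff_mset_eq_distinct set_sorted_list_of_set)
  then obtain \<sigma> where \<sigma>: "\<sigma> permutes {..<length ?L}" "permute_list \<sigma> ?L = l"
    by (rule mset_eq_permutation)
  have "homs U (map X ?L) (map x ?L)" using assms(3) by (intro homs_map) auto
  then have "K (permute_list \<sigma> (map X ?L)) = signed (kexp (gdim U) \<sigma> (map x ?L)) (K (map X ?L))"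
    using assms(1) \<sigma>(1) unfolding alternating_def by auto
  then show ?thesis
    using \<sigma> by (simp add: permute_list_map kexp_eq_lexp)
qed

lemma alternator_family:
  assumes K: "multilinear U p K" and T: "finite T" and X: "\<And>i. i \<in> T \<Longrightarrow> X i \<in> gpart U (x i)"
  shows "alternator U K (args X T) = gscale U (1 / fact (card T))
    (\<Sum>l\<in>permutations_of_set T. signed (lexp (gdim U) x l) (K (map X l)))"
proof -
  have h: "homs U (args X T) (args x T)" using assms by (intro homs_map) auto
  have "(\<Sum>\<sigma> | \<sigma> permutes {..<card T}. signed (kexp (gdim U) \<sigma> (args x T)) (K (permute_list \<sigma> (args X T))))
    = (\<Sum>\<sigma> | \<sigma> permutes {..<card T}. signed (lexp (gdim U) x (permute_list \<sigma> (sorted_list_of_set T)))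
        (K (map X (permute_list \<sigma> (sorted_list_of_set T)))))"
    by (intro sum.cong refl) (auto simp: permute_list_map kexp_eq_lexp)
  also have "\<dots> = (\<Sum>l\<in>permutations_of_set T. signed (lexp (gdim U) x l) (K (map X l)))"
    by (rule sum_permutes_eq[OF T, where g = "\<lambda>l. signed (lexp (gdim U) x l) (K (map X l))"])
  finally show ?thesis unfolding alternator_homogeneous[OF K h] by simp
qed

end

section \<open>Insertion\<close>

context graded_vs
begin

text \<open>
  The slot that varies lies before, inside or after the block of arguments given to the inner map.
\<close>

lemma multilinear_insertion_summand:
  assumes K1: "multilinear U p K1" and K2: "multilinear U (Suc q) K2" and i: "i \<le> q"
  shows "multilinear U (p + q) (\<lambda>Ys. K2 (take i Ys @ [K1 (take p (drop i Ys))] @ drop (i + p) Ys))"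
proof -
  have "K2 (take i Ys @ [K1 (take p (drop i Ys))] @ drop (i + p) Ys) = 0" if "length Ys \<noteq> p + q" for Ys
  proof (cases "length (take p (drop i Ys)) = p")
    case True
    then have "length (take i Ys @ [K1 (take p (drop i Ys))] @ drop (i + p) Ys) \<noteq> Suc q"
      using that by (auto simp: min_def split: if_splits)
    then show ?thesis by (rule ml_length[OF K2])
  next
    case False
    then have "K1 (take p (drop i Ys)) = 0" by (rule ml_length[OF K1])
    then show ?thesis using ml_zero[OF K2] by simp
  qed
  moreover have "(\<forall>v w. K2 (take i (A @ (v + w) # B) @ [K1 (take p (drop i (A @ (v + w) # B)))] @ drop (i + p) (A @ (v + w) # B))
      = K2 (take i (A @ v # B) @ [K1 (take p (drop i (A @ v # B)))] @ drop (i + p) (A @ v # B))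
      + K2 (take i (A @ w # B) @ [K1 (take p (drop i (A @ w # B)))] @ drop (i + p) (A @ w # B))) \<and>
    (\<forall>a v. K2 (take i (A @ gscale U a v # B) @ [K1 (take p (drop i (A @ gscale U a v # B)))] @ drop (i + p) (A @ gscale U a v # B))
      = gscale U a (K2 (take i (A @ v # B) @ [K1 (take p (drop i (A @ v # B)))] @ drop (i + p) (A @ v # B))))"
    for A B
  proof -
    consider (1) "length A < i" | (2) "i \<le> length A" "length A < i + p" | (3) "i + p \<le> length A" by linarith
    then show ?thesis
    proof cases
      case 1
      then obtain r where "i = Suc (length A + r)" using less_iff_Suc_add by auto
      then show ?thesis
        using ml_add[OF K2, of A] ml_scale[OF K2, of A] by simp
    next
      case 2
      then obtain r where r: "length A = i + r" using le_Suc_ex by auto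
      with 2 obtain s where s: "p = Suc (r + s)" using less_iff_Suc_add[of r p] by auto
      have "take i (A @ v # B) = take i A" "take p (drop i (A @ v # B)) = drop i A @ v # take s B"
        "drop (i + p) (A @ v # B) = drop s B" for v
        using r s by auto
      then show ?thesis
        using ml_add[OF K2, of "take i A"] ml_scale[OF K2, of "take i A"]
        by (simp add: ml_add[OF K1] ml_scale[OF K1])
    next
      case 3
      then obtain r where r: "length A = i + p + r" using le_Suc_ex by auto
      have "take i (A @ v # B) = take i A" "take p (drop i (A @ v # B)) = take p (drop i A)"
        "drop (i + p) (A @ v # B) = drop (i + p) A @ v # B" for v
        using r by auto
      then show ?thesis
        using ml_add[OF K2, of "take i A @ K1 (take p (drop i A)) # drop (i + p) A"]
          ml_scale[OF K2, of "take i A @ K1 (take p (drop i A)) # drop (i + p) A"]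
        by simp
    qed
  qed
  ultimately show ?thesis by (intro multilinearI) auto
qed

lemma multilinear_insertion_aux:
  assumes K1: "multilinear U p K1" and K2: "multilinear U (Suc q) K2"
  shows "multilinear U (p + q) (\<lambda>Ys. \<Sum>i\<le>q.
    gscale U (c i) (K2 (take i Ys @ [K1 (take p (drop i Ys))] @ drop (i + p) Ys)))"
  by (intro multilinear_sum multilinear_scale multilinear_insertion_summand assms) simp

lemma insertion_eq:
  "insertion U (int p - 1, \<kappa>1) K1 (int q, \<kappa>2) K2 = (\<lambda>Xs. if length Xs \<noteq> p + q then 0
     else hom_ext U (\<lambda>xs Ys. \<Sum>i\<le>q.
            gscale U ((-1) powi ((int p - 1) * int i + pr \<kappa>1 (\<kappa>2 + sum_list (take i xs))))
              (K2 (take i Ys @ [K1 (take p (drop i Ys))] @ drop (i + p) Ys))) Xs)"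
  by (auto simp: insertion_def fun_eq_iff)

lemma multilinear_insertion:
  assumes K1: "multilinear U p K1" and K2: "multilinear U (Suc q) K2"
  shows "multilinear U (p + q) (insertion U (int p - 1, \<kappa>1) K1 (int q, \<kappa>2) K2)"
  unfolding insertion_eq
  by (rule multilinear_cong[OF multilinear_hom_ext[OF multilinear_insertion_aux[OF K1 K2]]]) auto

lemma insertion_homogeneous:
  assumes K1: "multilinear U p K1" and K2: "multilinear U (Suc q) K2"
    and Xs: "homs U Xs xs" "length Xs = p + q"
  shows "insertion U (int p - 1, \<kappa>1) K1 (int q, \<kappa>2) K2 Xs = (\<Sum>i\<le>q.
    signed ((int p - 1) * int i + pr \<kappa>1 (\<kappa>2 + sum_list (take i xs)))
      (K2 (take i Xs @ [K1 (take p (drop i Xs))] @ drop (i + p) Xs)))"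
proof -
  have "hom_ext U (\<lambda>xs Ys. \<Sum>i\<le>q.
            gscale U ((-1) powi ((int p - 1) * int i + pr \<kappa>1 (\<kappa>2 + sum_list (take i xs))))
              (K2 (take i Ys @ [K1 (take p (drop i Ys))] @ drop (i + p) Ys))) Xs
    = (\<Sum>i\<le>q.
            gscale U ((-1) powi ((int p - 1) * int i + pr \<kappa>1 (\<kappa>2 + sum_list (take i xs))))
              (K2 (take i Xs @ [K1 (take p (drop i Xs))] @ drop (i + p) Xs)))"
    by (rule hom_ext_homogeneous[OF _ Xs(1)]) (rule multilinear_insertion_aux[OF K1 K2])
  then show ?thesis using Xs(2) unfolding insertion_eq scale_sign by simp
qed

lemma insertion_degree:
  assumes K1: "multilinear U p K1" "has_degree U \<kappa>1 K1"
    and K2: "multilinear U (Suc q) K2" "has_degree U \<kappa>2 K2"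
  shows "has_degree U (\<kappa>1 + \<kappa>2) (insertion U (int p - 1, \<kappa>1) K1 (int q, \<kappa>2) K2)"
  unfolding has_degree_def
proof (intro allI impI)
  fix Xs xs assume Xs: "homs U Xs xs"
  show "insertion U (int p - 1, \<kappa>1) K1 (int q, \<kappa>2) K2 Xs \<in> gpart U (sum_list xs + (\<kappa>1 + \<kappa>2))"
  proof (cases "length Xs = p + q")
    case True
    have "K2 (take i Xs @ [K1 (take p (drop i Xs))] @ drop (i + p) Xs)
        \<in> gpart U (sum_list xs + (\<kappa>1 + \<kappa>2))" for i
    proof -
      have "homs U (take p (drop i Xs)) (take p (drop i xs))"
        using Xs by (intro list_all2_takeI list_all2_dropI)
      then have "K1 (take p (drop i Xs)) \<in> gpart U (sum_list (take p (drop i xs)) + \<kappa>1)"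
        using K1(2) unfolding has_degree_def by blast
      then have "homs U (take i Xs @ [K1 (take p (drop i Xs))] @ drop (i + p) Xs)
          (take i xs @ [sum_list (take p (drop i xs)) + \<kappa>1] @ drop (i + p) xs)"
        using Xs by (intro list_all2_appendI list_all2_takeI list_all2_dropI) auto
      then have "K2 (take i Xs @ [K1 (take p (drop i Xs))] @ drop (i + p) Xs) \<in>
          gpart U (sum_list (take i xs @ [sum_list (take p (drop i xs)) + \<kappa>1] @ drop (i + p) xs) + \<kappa>2)"
        using K2(2) unfolding has_degree_def by blast
      moreover have "xs = take i xs @ take p (drop i xs) @ drop (i + p) xs"
        by (metis append_take_drop_id drop_drop add.commute)
      then have "sum_list xs = sum_list (take i xs) + (sum_list (take p (drop i xs)) + sum_list (drop (i + p) xs))"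
        by (metis sum_list_append)
      ultimately show ?thesis by (simp add: add.assoc add.left_commute)
    qed
    then show ?thesis
      unfolding insertion_homogeneous[OF K1(1) K2(1) Xs True] by (intro part_sum part_signed)
  next
    case False
    then show ?thesis using part_zero by (simp add: insertion_eq)
  qed
qed

lemma map_scale_zero [simp]: "map_scale U a 0 = 0"
  by (simp add: map_scale_def zero_fun_def)

lemma alt_cases:
  assumes "K \<in> alt_maps U (k, \<kappa>)"
  obtains "K = 0" | p where "k = int p - 1"
proof (cases "k < -1")
  case False
  then have "k = int (nat (k + 1)) - 1" by simp
  with that show ?thesis by blast
qed (use assms that in \<open>auto simp: alt_maps_below\<close>)

lemma insertion_zero_left:
  assumes K2: "multilinear U p K2"
  shows "insertion U d1 0 d2 K2 = 0"
proof -
  have "K2 (A @ 0 # B) = 0" for A B by (rule ml_zero[OF K2])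
  then show ?thesis by (auto simp: insertion_def fun_eq_iff hom_ext_def split: prod.splits)
qed

lemma insertion_zero_right: "insertion U d1 K1 d2 0 = 0"
  by (auto simp: insertion_def fun_eq_iff hom_ext_def split: prod.splits)

lemma alternator_zero': "alternator U 0 = 0"
  using alternator_zero by (simp add: zero_fun_def)

lemma alt_insertion_zero_left: "K2 \<in> alt_maps U d2 \<Longrightarrow> alt_insertion U d1 0 d2 K2 = 0"
  by (cases d2) (auto simp: alt_insertion_def insertion_zero_left[OF alt_multilinear] alternator_zero')

lemma alt_insertion_zero_right: "alt_insertion U d1 K1 d2 0 = 0"
  by (simp add: alt_insertion_def insertion_zero_right alternator_zero')

lemma alt_insertion_alt:
  assumes "K1 \<in> alt_maps U d1" "K2 \<in> alt_maps U d2"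
  shows "alt_insertion U d1 K1 d2 K2 \<in> alt_maps U (d1 + d2)"
proof -
  obtain k1 \<kappa>1 k2 \<kappa>2 where d: "d1 = (k1, \<kappa>1)" "d2 = (k2, \<kappa>2)" by (cases d1, cases d2)
  note K = assms[unfolded d]
  consider "K1 = 0" | "K2 = 0" | "k2 = -1" | p q where "k1 = int p - 1" "k2 = int q"
    using K(1)
  proof (cases rule: alt_cases)
    case (2 p)
    note p = this
    from K(2) show ?thesis
    proof (cases rule: alt_cases)
      case (2 r)
      then show ?thesis using that p by (cases r) auto
    qed (use that in auto)
  qed (use that in auto)
  then show ?thesis
  proof cases
    case (4 p q)
    note K = K[unfolded 4]
    have ml: "multilinear U p K1" "multilinear U (Suc q) K2"
      using alt_multilinear[OF K(1)] alt_multilinear[OF K(2)] by (auto simp: nat_add_distrib)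
    let ?J = "insertion U (int p - 1, \<kappa>1) K1 (int q, \<kappa>2) K2"
    have n: "nat (int p - 1 + int q + 1) = p + q" by simp
    have k: "-1 \<le> int p - 1 + int q" by simp
    have "alternator U ?J \<in> alt_maps U (int p - 1 + int q, \<kappa>1 + \<kappa>2)"
      unfolding alt_maps_iff[OF k] n
      by (intro conjI multilinear_alternator multilinear_insertion ml
          alternating_alternator[OF multilinear_insertion[OF ml]]
          alternator_degree[OF multilinear_insertion[OF ml]]
          insertion_degree alt_degree[OF K(1)] alt_degree[OF K(2)])
    then show ?thesis by (simp add: d 4 alt_insertion_def alt_scale)
  qed (use assms in \<open>simp_all add: alt_insertion_zero_left alt_insertion_zero_right alt_zero\<close>,
       simp add: alt_insertion_def d alt_zero)
qed

end

section \<open>The shuffle formula\<close>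

lemma exists_below_int:
  assumes "finite (T :: int set)"
  obtains z where "\<And>t. t \<in> T \<Longrightarrow> z < t"
proof
  fix t assume "t \<in> T"
  then have "Min (insert 0 T) \<le> t" using assms by (intro Min_le) auto
  then show "Min (insert 0 T) - 1 < t" by linarith
qed

context graded_vs
begin

text \<open>
  The homogeneous element \<open>Z\<close> is moved to the front past the arguments in \<open>A\<close>, and the others are sorted.
  For the proof it gets an index below all others; this is why the families are indexed by integers
  and not by natural numbers.
\<close>

lemma alternating_move_front:
  fixes X :: "int \<Rightarrow> 'u"
  assumes K: "alternating U K" and d: "distinct (A @ C)"
    and X: "\<And>i. i \<in> set (A @ C) \<Longrightarrow> X i \<in> gpart U (x i)" and Z: "Z \<in> gpart U w"
  shows "K (map X A @ Z # map X C) =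
    signed (lexp (gdim U) x (A @ C) + (int (length A) + pr (\<Sum>a\<in>set A. x a) w))
      (K (Z # args X (set A \<union> set C)))"
proof -
  obtain z where z: "\<And>t. t \<in> set A \<union> set C \<Longrightarrow> z < t"
    using exists_below_int[of "set A \<union> set C"] by auto
  then have zn: "z \<notin> set A" "z \<notin> set C" by force+
  let ?X = "X(z := Z)" and ?x = "x(z := w)"
  have m: "map ?X l = map X l" if "z \<notin> set l" for l using that by simp
  have "K (map ?X (A @ z # C)) = signed (lexp (gdim U) ?x (A @ z # C)) (K (args ?X (set (A @ z # C))))"
    by (rule alternating_family[OF K]) (use d X Z zn in auto)
  moreover have "args ?X (set (A @ z # C)) = Z # args X (set A \<union> set C)"
    using args_insert_below[of "set A \<union> set C" z ?X] z zn m[of "sorted_list_of_set (set A \<union> set C)"] by simp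
  moreover have "lexp (gdim U) ?x (A @ z # C) =
      lexp (gdim U) x (A @ C) + (int (length A) + pr (\<Sum>a\<in>set A. x a) w)"
  proof -
    have "lexp (gdim U) ?x (A @ z # C) =
        lexp (gdim U) ?x A + (kinv (gdim U) ?x (set A) {z} + kinv (gdim U) ?x (set A) (set C))
        + (kinv (gdim U) ?x {z} (set C) + lexp (gdim U) ?x C)"
      using d zn kinv_insert_right[of "set C" z "gdim U" ?x "set A"] by (simp add: lexp_append)
    moreover have "kinv (gdim U) ?x {z} (set C) = 0" by (rule kinv_below) (use z in auto)
    moreover have "kinv (gdim U) ?x (set A) {z} = int (card (set A)) + pr (\<Sum>a\<in>set A. ?x a) (?x z)"
      by (rule kinv_above) (use z in auto)
    moreover have "(\<Sum>a\<in>set A. ?x a) = (\<Sum>a\<in>set A. x a)" by (rule sum.cong) (use zn in auto)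
    moreover have "lexp (gdim U) ?x A = lexp (gdim U) x A" "lexp (gdim U) ?x C = lexp (gdim U) x C"
      by (rule lexp_cong; use zn in auto)+
    moreover have "kinv (gdim U) ?x (set A) (set C) = kinv (gdim U) x (set A) (set C)"
      by (rule kinv_cong) (use zn in auto)
    ultimately show ?thesis using d by (simp add: lexp_append distinct_card)
  qed
  ultimately show ?thesis using zn by (simp add: m)
qed

text \<open>
  The reason for the signs in the definition of the insertion: the sign of inserting at position \<open>i\<close> is
  the sign of moving the inner map, as an object of degree \<open>(k\<^sub>1, \<kappa>\<^sub>1)\<close>, past the \<open>i\<close> arguments in front of
  it. Together with the sign of the permutation this leaves a sign that depends only on the set of the
  arguments of the inner map.
\<close>

lemma insertion_summand:
  fixes X :: "int \<Rightarrow> 'u"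
  assumes K1: "alternating U K1" "has_degree U \<kappa>1 K1"
    and K2: "alternating U K2" "multilinear U r K2"
    and l: "distinct (A @ B @ C)" "set (A @ B @ C) = T"
    and X: "\<And>i. i \<in> T \<Longrightarrow> X i \<in> gpart U (x i)"
  shows "signed (lexp (gdim U) x (A @ B @ C))
      (signed ((int (length B) - 1) * int (length A) + pr \<kappa>1 (\<kappa>2 + sum_list (map x A)))
        (K2 (map X A @ [K1 (map X B)] @ map X C)))
    = signed (pr \<kappa>1 \<kappa>2) (signed (kinv (gdim U) x (set B) (T - set B))
        (K2 (K1 (args X (set B)) # args X (T - set B))))"
proof -
  let ?Z = "K1 (args X (set B))" and ?w = "(\<Sum>i\<in>set B. x i) + \<kappa>1"
  have Z: "?Z \<in> gpart U ?w" by (rule degree_args[OF K1(2)]) (use X l in auto)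
  have 1: "K1 (map X B) = signed (lexp (gdim U) x B) ?Z"
    by (rule alternating_family[OF K1(1)]) (use l X in auto)
  have 2: "K2 (map X A @ ?Z # map X C) =
    signed (lexp (gdim U) x (A @ C) + (int (length A) + pr (\<Sum>a\<in>set A. x a) ?w))
      (K2 (?Z # args X (set A \<union> set C)))"
    by (rule alternating_move_front[OF K2(1) _ _ Z]) (use l X in auto)
  have rest: "set A \<union> set C = T - set B" using l by auto
  have cards: "card (set A) = length A" "card (set B) = length B" using l by (simp_all add: distinct_card)
  have sl: "sum_list (map x A) = (\<Sum>a\<in>set A. x a)" using l by (simp add: sum_list_distinct_conv_sum_set)
  have e1: "lexp (gdim U) x (A @ B @ C) = lexp (gdim U) x A + kinv (gdim U) x (set A) (set B)
      + kinv (gdim U) x (set A) (set C) + lexp (gdim U) x B + kinv (gdim U) x (set B) (set C) + lexp (gdim U) x C"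
    using l(1) by (simp add: lexp_append kinv_Un_right)
  have e2: "lexp (gdim U) x (A @ C) = lexp (gdim U) x A + kinv (gdim U) x (set A) (set C) + lexp (gdim U) x C"
    using l(1) by (intro lexp_append) auto
  have e3: "kinv (gdim U) x (set B) (T - set B) = kinv (gdim U) x (set B) (set A) + kinv (gdim U) x (set B) (set C)"
    unfolding rest[symmetric] using l(1) by (intro kinv_Un_right) auto
  have e4: "kinv (gdim U) x (set A) (set B) = int (length A) * int (length B)
      + pr (\<Sum>a\<in>set A. x a) (\<Sum>b\<in>set B. x b) - kinv (gdim U) x (set B) (set A)"
  proof -
    have "set A \<inter> set B = {}" using l(1) by auto
    from kinv_swap[OF this, of "gdim U" x] show ?thesis unfolding cards by linarith
  qed
  have "K2 (map X A @ [K1 (map X B)] @ map X C)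
    = signed (lexp (gdim U) x B) (K2 (map X A @ ?Z # map X C))"
    unfolding 1 using ml_signed[OF K2(2)] by simp
  \<comment> \<open>moving the value of \<open>K\<^sub>1\<close> past \<open>A\<close> undoes the sign of moving \<open>B\<close> past \<open>A\<close>, up to the degree of \<open>K\<^sub>1\<close> itself\<close>
  moreover have "even (lexp (gdim U) x (A @ B @ C)
        + ((int (length B) - 1) * int (length A) + pr \<kappa>1 (\<kappa>2 + sum_list (map x A))
        + (lexp (gdim U) x B + (lexp (gdim U) x (A @ C) + (int (length A) + pr (\<Sum>a\<in>set A. x a) ?w))))
      - (pr \<kappa>1 \<kappa>2 + kinv (gdim U) x (set B) (T - set B)))"
    unfolding e1 e2 e3 e4 sl
    by (simp add: pairing_simps pairing_commute[of _ \<kappa>1] algebra_simps)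
  ultimately show ?thesis
    unfolding 2 rest signed_signed by (simp only: signed_signed) (rule signed_cong, simp add: add.assoc)
qed

text \<open>
  Rotating the listing moves the block to the front, so all \<open>q + 1\<close> positions of the block contribute the
  same. A fixed set of first entries has \<open>p! q!\<close> listings.
\<close>

lemma sum_insertion_positions:
  fixes F :: "int set \<Rightarrow> 'u"
  assumes T: "finite T" "card T = p + q"
  shows "(\<Sum>l\<in>permutations_of_set T. \<Sum>i\<le>q. F (set (take p (drop i l))))
    = gscale U (of_nat (Suc q) * (fact p * fact q)) (\<Sum>S | S \<subseteq> T \<and> card S = p. F S)"
proof -
  have rot: "(\<Sum>l\<in>permutations_of_set T. F (set (take p (drop i l))))
      = (\<Sum>l\<in>permutations_of_set T. F (set (take p l)))" if i: "i \<le> q" for i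
  proof -
    have len: "length l = p + q" if "l \<in> permutations_of_set T" for l
      using that T by (simp add: permutations_of_set_def distinct_card[symmetric])
    have "take p (drop i l) = take p (rotate i l)" if "l \<in> permutations_of_set T" for l
      using len[OF that] i by (cases "length l = i") (auto simp: rotate_drop_take)
    then have "(\<Sum>l\<in>permutations_of_set T. F (set (take p (drop i l))))
        = (\<Sum>l\<in>permutations_of_set T. F (set (take p (rotate i l))))" by simp
    also have "\<dots> = (\<Sum>l\<in>permutations_of_set T. F (set (take p l)))"
    proof (rule sum.reindex_bij_betw)
      have "inj_on (rotate i) (permutations_of_set T)"
      proof (rule inj_onI)
        fix l l' assume l: "l \<in> permutations_of_set T" "l' \<in> permutations_of_set T"
          and e: "rotate i l = rotate i l'"
        have "rotate (p + q - i) (rotate i l) = l" if "l \<in> permutations_of_set T" for l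
          unfolding rotate_rotate by (rule rotate_id) (use len[OF that] i in simp)
        from this[OF l(1)] this[OF l(2)] show "l = l'" unfolding e by (rule subst)
      qed
      moreover have "rotate i ` permutations_of_set T \<subseteq> permutations_of_set T"
        by (auto simp: permutations_of_set_def)
      ultimately show "bij_betw (rotate i) (permutations_of_set T) (permutations_of_set T)"
        using endo_inj_surj[of "permutations_of_set T" "rotate i"] T by (simp add: bij_betw_def)
    qed
    finally show ?thesis .
  qed
  have "(\<Sum>l\<in>permutations_of_set T. \<Sum>i\<le>q. F (set (take p (drop i l))))
      = (\<Sum>i\<le>q. \<Sum>l\<in>permutations_of_set T. F (set (take p (drop i l))))" by (rule sum.swap)
  also have "\<dots> = (\<Sum>i\<le>q. \<Sum>l\<in>permutations_of_set T. F (set (take p l)))" using rot by simp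
  also have "\<dots> = gscale U (of_nat (Suc q)) (\<Sum>l\<in>permutations_of_set T. F (set (take p l)))"
    by (simp add: vs.sum_constant_scale)
  also have "(\<Sum>l\<in>permutations_of_set T. F (set (take p l)))
      = (\<Sum>S | S \<subseteq> T \<and> card S = p. \<Sum>_\<in>permutations_of_set S \<times> permutations_of_set (T - S). F S)"
    by (rule sum_permutations_take[OF T])
  also have "\<dots> = (\<Sum>S | S \<subseteq> T \<and> card S = p. gscale U (fact p * fact q) (F S))"
  proof (rule sum.cong[OF refl])
    fix S assume "S \<in> {S. S \<subseteq> T \<and> card S = p}"
    then have S: "S \<subseteq> T" "card S = p" "finite S" using T finite_subset by auto
    then have "card (T - S) = q" using T by (simp add: card_Diff_subset)
    then have "card (permutations_of_set S \<times> permutations_of_set (T - S)) = fact p * fact q"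
      using S T by (simp add: card_cartesian_product)
    then show "(\<Sum>_\<in>permutations_of_set S \<times> permutations_of_set (T - S). F S) = gscale U (fact p * fact q) (F S)"
      by (simp add: vs.sum_constant_scale)
  qed
  also have "\<dots> = gscale U (fact p * fact q) (\<Sum>S | S \<subseteq> T \<and> card S = p. F S)"
    by (simp add: vs.scale_sum_right)
  finally show ?thesis by simp
qed

text \<open>
  The insertion operator of \<open>A(U)\<close> is a signed sum over all ways to choose the arguments of the
  inner map. The Koszul sign absorbs the position at which the inner map is inserted, so that each
  choice occurs equally often in the alternation, and the normalizing factor cancels this
  multiplicity. Subsets of the wrong size contribute zero, because maps vanish on lists of a wrong
  length.
\<close>

theorem alt_insertion_family:
  fixes X :: "int \<Rightarrow> 'u"
  assumes K1: "K1 \<in> alt_maps U (k1, \<kappa>1)" and K2: "K2 \<in> alt_maps U (k2, \<kappa>2)"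
    and T: "finite T" and X: "\<And>i. i \<in> T \<Longrightarrow> X i \<in> gpart U (x i)"
  shows "alt_insertion U (k1, \<kappa>1) K1 (k2, \<kappa>2) K2 (args X T) =
    signed (pr \<kappa>1 \<kappa>2) (\<Sum>S\<in>Pow T. signed (kinv (gdim U) x S (T - S))
      (K2 (K1 (args X S) # args X (T - S))))"
proof -
  define F where "F S = signed (kinv (gdim U) x S (T - S)) (K2 (K1 (args X S) # args X (T - S)))" for S
  note ml = alt_multilinear[OF K1] alt_multilinear[OF K2]
  have F0: "F S = 0" if "int (card S) \<noteq> k1 + 1" for S
    using alt_length[OF K1, of "args X S"] that ml_zero[OF ml(2), of "[]"] by (simp add: F_def)
  have alt: "alt_insertion U (k1, \<kappa>1) K1 (k2, \<kappa>2) K2 \<in> alt_maps U (k1 + k2, \<kappa>1 + \<kappa>2)"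
    using alt_insertion_alt[OF K1 K2] by simp
  show ?thesis
  proof (cases "int (card T) = k1 + k2 + 1 \<and> k1 \<ge> -1 \<and> k2 \<ge> 0")
    case False
    \<comment> \<open>either \<open>K\<^sub>1\<close> or \<open>K\<^sub>2\<close> gets a list of a wrong length\<close>
    have "F S = 0" if S: "S \<subseteq> T" for S
    proof (cases "int (card S) = k1 + 1")
      case True
      have "card (T - S) = card T - card S" "card S \<le> card T"
        using S T by (auto simp: card_Diff_subset finite_subset card_mono)
      then have "int (length (K1 (args X S) # args X (T - S))) \<noteq> k2 + 1"
        using False True by auto
      then show ?thesis using alt_length[OF K2] by (simp add: F_def)
    qed (rule F0)
    then have r: "(\<Sum>S\<in>Pow T. F S) = 0" by simp
    have "alt_insertion U (k1, \<kappa>1) K1 (k2, \<kappa>2) K2 (args X T) = 0"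
    proof (cases "int (card T) = k1 + k2 + 1")
      case True
      consider "K1 = 0" | "K2 = 0" | "k2 = -1"
        using False True K1 K2 by (cases "k1 < -1"; cases "k2 < -1") (auto simp: alt_maps_below)
      then show ?thesis
        by cases (simp_all add: alt_insertion_zero_left[OF K2] alt_insertion_zero_right, simp add: alt_insertion_def)
    qed (use alt_length[OF alt, of "args X T"] in simp)
    then show ?thesis using r unfolding F_def by simp
  next
    case True
    define p where "p = nat (k1 + 1)"
    define q where "q = nat k2"
    have k: "k1 = int p - 1" "k2 = int q" and cT: "card T = p + q"
      using True by (auto simp: p_def q_def)
    have ml: "multilinear U p K1" "multilinear U (Suc q) K2"
      using ml by (auto simp: k nat_add_distrib)
    let ?J = "insertion U (k1, \<kappa>1) K1 (k2, \<kappa>2) K2"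
    have mlJ: "multilinear U (p + q) ?J" unfolding k by (rule multilinear_insertion[OF ml])
    have l: "signed (lexp (gdim U) x l) (?J (map X l)) =
        (\<Sum>i\<le>q. signed (pr \<kappa>1 \<kappa>2) (F (set (take p (drop i l)))))" if "l \<in> permutations_of_set T" for l
    proof -
      have l: "set l = T" "distinct l" using that by (auto simp: permutations_of_set_def)
      then have len: "length l = p + q" using cT distinct_card by metis
      have h: "homs U (map X l) (map x l)" using l X by (intro homs_map) auto
      have lJ: "?J (map X l) = (\<Sum>i\<le>q.
          signed ((int p - 1) * int i + pr \<kappa>1 (\<kappa>2 + sum_list (take i (map x l))))
            (K2 (take i (map X l) @ [K1 (take p (drop i (map X l)))] @ drop (i + p) (map X l))))"
        unfolding k by (rule insertion_homogeneous[OF ml h]) (use len in simp)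
      have "signed (lexp (gdim U) x l) (signed ((int p - 1) * int i + pr \<kappa>1 (\<kappa>2 + sum_list (take i (map x l))))
            (K2 (take i (map X l) @ [K1 (take p (drop i (map X l)))] @ drop (i + p) (map X l))))
          = signed (pr \<kappa>1 \<kappa>2) (F (set (take p (drop i l))))" if i: "i \<le> q" for i
      proof -
        have app: "take i l @ take p (drop i l) @ drop (i + p) l = l"
          by (metis append_take_drop_id drop_drop add.commute)
        have li: "length (take i l) = i" "length (take p (drop i l)) = p" using len i by auto
        show ?thesis
          using insertion_summand[OF alt_alternating[OF K1] alt_degree[OF K1] alt_alternating[OF K2] ml(2),
              of "take i l" "take p (drop i l)" "drop (i + p) l" T X x \<kappa>2] app l X
          unfolding F_def app li by (simp add: take_map drop_map)
      qed
      then show ?thesis unfolding lJ signed_sum by (intro sum.cong refl) simp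
    qed
    have "alternator U ?J (args X T) = gscale U (1 / fact (card T))
        (\<Sum>l\<in>permutations_of_set T. signed (lexp (gdim U) x l) (?J (map X l)))"
      by (rule alternator_family[OF mlJ T X])
    also have "\<dots> = gscale U (1 / fact (p + q))
        (\<Sum>l\<in>permutations_of_set T. \<Sum>i\<le>q. signed (pr \<kappa>1 \<kappa>2) (F (set (take p (drop i l)))))"
      unfolding cT by (intro arg_cong[where f = "gscale U _"] sum.cong refl l)
    also have "\<dots> = gscale U (1 / fact (p + q)) (gscale U (of_nat (Suc q) * (fact p * fact q))
        (\<Sum>S | S \<subseteq> T \<and> card S = p. signed (pr \<kappa>1 \<kappa>2) (F S)))"
      by (subst sum_insertion_positions[OF T cT, where F = "\<lambda>S. signed (pr \<kappa>1 \<kappa>2) (F S)"]) simp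
    finally have "alt_insertion U (k1, \<kappa>1) K1 (k2, \<kappa>2) K2 (args X T) =
        (\<Sum>S | S \<subseteq> T \<and> card S = p. signed (pr \<kappa>1 \<kappa>2) (F S))"
      using k by (simp add: alt_insertion_def map_scale_def nat_add_distrib fact_Suc del: of_nat_Suc)
    also have "\<dots> = (\<Sum>S\<in>Pow T. signed (pr \<kappa>1 \<kappa>2) (F S))"
      by (rule sum.mono_neutral_left) (use T F0 k in auto)
    finally show ?thesis by (simp add: F_def signed_sum)
  qed
qed

end

section \<open>The pre-Lie identity\<close>

lemma sum_Pow_Pow:
  fixes f :: "'i set \<Rightarrow> 'i set \<Rightarrow> 'b::comm_monoid_add"
  assumes T: "finite T"
  shows "(\<Sum>S\<in>Pow T. \<Sum>A\<in>Pow S. f A (S - A)) = (\<Sum>A\<in>Pow T. \<Sum>B\<in>Pow (T - A). f A B)"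
proof -
  have fin: "finite S" if "S \<subseteq> T" for S using that T by (rule finite_subset)
  have "(\<Sum>S\<in>Pow T. \<Sum>A\<in>Pow S. f A (S - A)) = (\<Sum>(S, A)\<in>Sigma (Pow T) Pow. f A (S - A))"
    by (rule sum.Sigma) (use T fin in auto)
  also have "\<dots> = (\<Sum>(A, B)\<in>Sigma (Pow T) (\<lambda>A. Pow (T - A)). f A B)"
    by (rule sum.reindex_bij_witness[where i = "\<lambda>(A, B). (A \<union> B, A)" and j = "\<lambda>(S, A). (A, S - A)"]) auto
  also have "\<dots> = (\<Sum>A\<in>Pow T. \<Sum>B\<in>Pow (T - A). f A B)"
    by (rule sum.Sigma[symmetric]) (use T in auto)
  finally show ?thesis .
qed

lemma sum_Pow_swap:
  fixes f :: "'i set \<Rightarrow> 'i set \<Rightarrow> 'b::comm_monoid_add"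
  assumes T: "finite T"
  shows "(\<Sum>A\<in>Pow T. \<Sum>B\<in>Pow (T - A). f A B) = (\<Sum>A\<in>Pow T. \<Sum>B\<in>Pow (T - A). f B A)"
proof -
  have 1: "(\<Sum>A\<in>Pow T. \<Sum>B\<in>Pow (T - A). g A B) = (\<Sum>(A, B)\<in>Sigma (Pow T) (\<lambda>A. Pow (T - A)). g A B)"
    for g :: "'i set \<Rightarrow> 'i set \<Rightarrow> 'b"
    by (rule sum.Sigma) (use T in auto)
  show ?thesis unfolding 1
    by (rule sum.reindex_bij_witness[where i = "\<lambda>(A, B). (B, A)" and j = "\<lambda>(B, A). (A, B)"]) auto
qed

lemma sum_Pow_insert:
  fixes f :: "'i set \<Rightarrow> 'b::comm_monoid_add"
  assumes "finite R" "z \<notin> R"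
  shows "(\<Sum>S\<in>Pow (insert z R). f S) = (\<Sum>S\<in>Pow R. f (insert z S)) + (\<Sum>S\<in>Pow R. f S)"
proof -
  have "(\<Sum>S\<in>Pow (insert z R). f S) = (\<Sum>S\<in>Pow R. f S) + (\<Sum>S\<in>insert z ` Pow R. f S)"
    unfolding Pow_insert by (rule sum.union_disjoint) (use assms in auto)
  also have "(\<Sum>S\<in>insert z ` Pow R. f S) = (\<Sum>S\<in>Pow R. f (insert z S))"
    by (subst sum.reindex) (use assms in \<open>auto intro!: inj_onI\<close>)
  finally show ?thesis by (simp add: add.commute)
qed

lemma args_cong: "finite S \<Longrightarrow> (\<And>i. i \<in> S \<Longrightarrow> X i = Y i) \<Longrightarrow> args X S = args Y S"
  by simp

context graded_vs
begin

abbreviation ins :: "int \<times> mdeg \<Rightarrow> ('u list \<Rightarrow> 'u) \<Rightarrow> int \<times> mdeg \<Rightarrow> ('u list \<Rightarrow> 'u) \<Rightarrow> 'u list \<Rightarrow> 'u" where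
  "ins \<equiv> alt_insertion U"

text \<open>
  The exponent of the sign of exchanging elements of degrees \<open>d\<close> and \<open>e\<close> in the \<open>(m+1)\<close>-graded algebra \<open>A(U)\<close>.
\<close>

definition dsgn :: "int \<times> mdeg \<Rightarrow> int \<times> mdeg \<Rightarrow> int" where
  "dsgn d e = fst d * fst e + pr (snd d) (snd e)"

lemma dsgn_commute: "dsgn d e = dsgn e d"
  by (simp add: dsgn_def pairing_commute mult.commute)

lemma dsgn_add: "dsgn (d + d') e = dsgn d e + dsgn d' e" "dsgn d (e + e') = dsgn d e + dsgn d e'"
  by (simp_all add: dsgn_def pairing_simps algebra_simps)

lemma args_nth: "args (\<lambda>i. Xs ! nat i) (int ` {..<length Xs}) = Xs"
proof -
  have "sorted (map int [0..<length Xs])" by (simp add: sorted_iff_nth_mono)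
  then have "sorted_list_of_set (int ` {..<length Xs}) = map int [0..<length Xs]"
    by (intro sorted_distinct_set_unique) (simp_all add: distinct_map atLeast0LessThan)
  then show ?thesis by (simp only:) (rule nth_equalityI, simp_all del: upt_Suc)
qed

lemma homs_nth: "homs U Xs xs \<Longrightarrow> i \<in> int ` {..<length Xs} \<Longrightarrow> Xs ! nat i \<in> gpart U (xs ! nat i)"
  by (auto simp: list_all2_conv_all_nth)

text \<open>
  Elements of \<open>A(U)\<close> are compared on families of homogeneous arguments.
\<close>

lemma alt_eqI:
  assumes "K \<in> alt_maps U d" "L \<in> alt_maps U d"
    and "\<And>T (X :: int \<Rightarrow> 'u) x. finite T \<Longrightarrow> (\<And>i. i \<in> T \<Longrightarrow> X i \<in> gpart U (x i)) \<Longrightarrow>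
           K (args X T) = L (args X T)"
  shows "K = L"
proof -
  obtain k \<kappa> where d: "d = (k, \<kappa>)" by (cases d)
  show ?thesis
  proof (rule multilinear_eqI)
    show "multilinear U (nat (k + 1)) K" "multilinear U (nat (k + 1)) L"
      using assms(1,2) by (auto simp: d intro: alt_multilinear)
    fix Xs xs assume Xs: "homs U Xs xs"
    have "K (args (\<lambda>i. Xs ! nat i) (int ` {..<length Xs})) = L (args (\<lambda>i. Xs ! nat i) (int ` {..<length Xs}))"
      by (rule assms(3)[where x = "\<lambda>i. xs ! nat i"]) (use homs_nth[OF Xs] in auto)
    then show "K Xs = L Xs" unfolding args_nth .
  qed
qed

lemmas alt_signed = direct_signed[OF direct_alt_maps]
  and alt_add = direct_add[OF direct_alt_maps]

lemma ins_add_left: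
  assumes "K \<in> alt_maps U d" "K' \<in> alt_maps U d" "L \<in> alt_maps U e"
  shows "ins d (K + K') e L = ins d K e L + ins d K' e L"
proof (rule alt_eqI)
  show "ins d (K + K') e L \<in> alt_maps U (d + e)" "ins d K e L + ins d K' e L \<in> alt_maps U (d + e)"
    using assms by (auto intro: alt_insertion_alt alt_add)
  fix T and X :: "int \<Rightarrow> 'u" and x
  assume TX: "finite T" "\<And>i. i \<in> T \<Longrightarrow> X i \<in> gpart U (x i)"
  obtain k \<kappa> l \<epsilon> where d: "d = (k, \<kappa>)" "e = (l, \<epsilon>)" by (cases d, cases e)
  note A = assms[unfolded d]
  show "ins d (K + K') e L (args X T) = (ins d K e L + ins d K' e L) (args X T)"
    using ml_add[OF alt_multilinear[OF A(3)], of "[]"]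
    unfolding d by (subst plus_fun_apply)
      (simp only: alt_insertion_family[OF A(1,3) TX] alt_insertion_family[OF A(2,3) TX]
        alt_insertion_family[OF alt_add[OF A(1,2)] A(3) TX], simp add: signed_add sum.distrib)
qed

lemma ins_add_right:
  assumes "K \<in> alt_maps U d" "L \<in> alt_maps U e" "L' \<in> alt_maps U e"
  shows "ins d K e (L + L') = ins d K e L + ins d K e L'"
proof (rule alt_eqI)
  show "ins d K e (L + L') \<in> alt_maps U (d + e)" "ins d K e L + ins d K e L' \<in> alt_maps U (d + e)"
    using assms by (auto intro: alt_insertion_alt alt_add)
  fix T and X :: "int \<Rightarrow> 'u" and x
  assume TX: "finite T" "\<And>i. i \<in> T \<Longrightarrow> X i \<in> gpart U (x i)"
  obtain k \<kappa> l \<epsilon> where d: "d = (k, \<kappa>)" "e = (l, \<epsilon>)" by (cases d, cases e)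
  note A = assms[unfolded d]
  show "ins d K e (L + L') (args X T) = (ins d K e L + ins d K e L') (args X T)"
    unfolding d by (subst plus_fun_apply)
      (simp only: alt_insertion_family[OF A(1,2) TX] alt_insertion_family[OF A(1,3) TX]
        alt_insertion_family[OF A(1) alt_add[OF A(2,3)] TX], simp add: signed_add sum.distrib)
qed

lemma ins_scale_left:
  assumes "K \<in> alt_maps U d" "L \<in> alt_maps U e"
  shows "ins d (map_scale U a K) e L = map_scale U a (ins d K e L)"
proof (rule alt_eqI)
  show "ins d (map_scale U a K) e L \<in> alt_maps U (d + e)" "map_scale U a (ins d K e L) \<in> alt_maps U (d + e)"
    using assms by (auto intro: alt_insertion_alt alt_scale)
  fix T and X :: "int \<Rightarrow> 'u" and x
  assume TX: "finite T" "\<And>i. i \<in> T \<Longrightarrow> X i \<in> gpart U (x i)"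
  obtain k \<kappa> l \<epsilon> where d: "d = (k, \<kappa>)" "e = (l, \<epsilon>)" by (cases d, cases e)
  note A = assms[unfolded d]
  have m: "map_scale U a M Xs = gscale U a (M Xs)" for M Xs
    by (simp add: map_scale_def)
  show "ins d (map_scale U a K) e L (args X T) = map_scale U a (ins d K e L) (args X T)"
    using ml_scale[OF alt_multilinear[OF A(2)], of "[]"] unfolding d
    by (subst m, simp only: alt_insertion_family[OF A(1,2) TX] alt_insertion_family[OF alt_scale[OF A(1)] A(2) TX])
       (simp add: scale_signed vs.scale_sum_right m)
qed

lemma ins_scale_right:
  assumes "K \<in> alt_maps U d" "L \<in> alt_maps U e"
  shows "ins d K e (map_scale U a L) = map_scale U a (ins d K e L)"
proof (rule alt_eqI)
  show "ins d K e (map_scale U a L) \<in> alt_maps U (d + e)" "map_scale U a (ins d K e L) \<in> alt_maps U (d + e)"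
    using assms by (auto intro: alt_insertion_alt alt_scale)
  fix T and X :: "int \<Rightarrow> 'u" and x
  assume TX: "finite T" "\<And>i. i \<in> T \<Longrightarrow> X i \<in> gpart U (x i)"
  obtain k \<kappa> l \<epsilon> where d: "d = (k, \<kappa>)" "e = (l, \<epsilon>)" by (cases d, cases e)
  note A = assms[unfolded d]
  have m: "map_scale U a M Xs = gscale U a (M Xs)" for M Xs
    by (simp add: map_scale_def)
  show "ins d K e (map_scale U a L) (args X T) = map_scale U a (ins d K e L) (args X T)"
    unfolding d
    by (subst m, simp only: alt_insertion_family[OF A(1,2) TX] alt_insertion_family[OF A(1) alt_scale[OF A(2)] TX])
       (simp add: scale_signed vs.scale_sum_right m)
qed

lemma map_scale_sign: "map_scale U ((-1) powi a) K = signed a K"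
  by (simp add: map_scale_def scale_sign fun_eq_iff signed_fun)

lemma ins_signed_left:
  "K \<in> alt_maps U d \<Longrightarrow> L \<in> alt_maps U e \<Longrightarrow> ins d (signed a K) e L = signed a (ins d K e L)"
  using ins_scale_left[of K d L e "(-1) powi a"] by (simp add: map_scale_sign)

lemma ins_signed_right:
  "K \<in> alt_maps U d \<Longrightarrow> L \<in> alt_maps U e \<Longrightarrow> ins d K e (signed a L) = signed a (ins d K e L)"
  using ins_scale_right[of K d L e "(-1) powi a"] by (simp add: map_scale_sign)

lemma ins_diff_left:
  "K \<in> alt_maps U d \<Longrightarrow> K' \<in> alt_maps U d \<Longrightarrow> L \<in> alt_maps U e \<Longrightarrow>
    ins d (K - K') e L = ins d K e L - ins d K' e L"
  using ins_add_left[of K d "signed 1 K'" L e] ins_signed_left[of K' d L e 1] alt_signed[of K' d 1]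
  by (simp add: signed_def)

lemma ins_diff_right:
  "K \<in> alt_maps U d \<Longrightarrow> L \<in> alt_maps U e \<Longrightarrow> L' \<in> alt_maps U e \<Longrightarrow>
    ins d K e (L - L') = ins d K e L - ins d K e L'"
  using ins_add_right[of K d L e "signed 1 L'"] ins_signed_right[of K d L' e 1] alt_signed[of L' e 1]
  by (simp add: signed_def)

lemma alternating_swap:
  fixes X :: "int \<Rightarrow> 'u"
  assumes K: "alternating U K" and Y: "Y \<in> gpart U y" and Z: "Z \<in> gpart U z"
    and R: "finite R" "\<And>i. i \<in> R \<Longrightarrow> X i \<in> gpart U (x i)"
  shows "K (Y # Z # args X R) = signed (1 + pr y z) (K (Z # Y # args X R))"
proof -
  obtain w where w: "\<And>t. t \<in> R \<Longrightarrow> w < t" using exists_below_int[OF R(1)] by blast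
  then have wR: "w \<notin> R" by force
  let ?X = "X(w := Y)" and ?x = "x(w := y)" and ?L = "sorted_list_of_set R"
  have eq: "args ?X R = args X R" "args ?x R = args x R" using wR R by auto
  have "K (map ?X [w] @ Z # map ?X ?L) =
    signed (lexp (gdim U) ?x ([w] @ ?L) + (int (length [w]) + pr (\<Sum>a\<in>set [w]. ?x a) z))
      (K (Z # args ?X (set [w] \<union> set ?L)))"
    by (rule alternating_move_front[OF K _ _ Z]) (use wR R Y in auto)
  moreover have "lexp (gdim U) ?x ([w] @ ?L) = kinv (gdim U) ?x {w} R + lexp (gdim U) ?x ?L"
    using R(1) by simp
  moreover have "kinv (gdim U) ?x {w} R = 0" by (rule kinv_below) (rule w)
  moreover have "lexp m x' l = 0" if "sorted l" "distinct l" for m x' and l :: "int list"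
    using that by (induction l) (auto intro!: kinv_below simp: less_le)
  moreover have "args ?X (insert w R) = Y # args X R" by (simp only: args_insert_below[OF R(1) w] eq fun_upd_same)
  ultimately show ?thesis using eq R(1) by simp
qed

text \<open>
  The shuffle formula when one argument \<open>Z\<close> precedes a family. The subsets of the enlarged index set
  split into those that contain the index of \<open>Z\<close>, where \<open>Z\<close> comes first and costs no sign, and those
  that do not, where the selected arguments move past \<open>Z\<close>.
\<close>

lemma ins_Cons_family:
  fixes X :: "int \<Rightarrow> 'u"
  assumes K2: "K2 \<in> alt_maps U (k2, \<kappa>2)" and K3: "K3 \<in> alt_maps U (k3, \<kappa>3)"
    and R: "finite R" and X: "\<And>i. i \<in> R \<Longrightarrow> X i \<in> gpart U (x i)" and Z: "Z \<in> gpart U w"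
  shows "ins (k2, \<kappa>2) K2 (k3, \<kappa>3) K3 (Z # args X R) = signed (pr \<kappa>2 \<kappa>3)
    ((\<Sum>S\<in>Pow R. signed (kinv (gdim U) x S (R - S)) (K3 (K2 (Z # args X S) # args X (R - S)))) +
     (\<Sum>S\<in>Pow R. signed (kinv (gdim U) x S (R - S) + (int (card S) + pr (\<Sum>i\<in>S. x i) w))
        (K3 (K2 (args X S) # Z # args X (R - S)))))"
proof -
  obtain z where z: "\<And>t. t \<in> R \<Longrightarrow> z < t" using exists_below_int[OF R] by blast
  then have zR: "z \<notin> R" by force
  let ?X = "X(z := Z)" and ?x = "x(z := w)"
  have aX: "args ?X S = args X S" if "S \<subseteq> R" for S
    using that zR R by (intro args_cong) (auto intro: finite_subset)
  have aZ: "args ?X (insert z S) = Z # args X S" if "S \<subseteq> R" for S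
  proof -
    have "args ?X (insert z S) = ?X z # args ?X S"
      by (rule args_insert_below) (use that z R in \<open>auto intro: finite_subset\<close>)
    then show ?thesis by (simp only: aX[OF that] fun_upd_same)
  qed
  have "ins (k2, \<kappa>2) K2 (k3, \<kappa>3) K3 (Z # args X R) = ins (k2, \<kappa>2) K2 (k3, \<kappa>3) K3 (args ?X (insert z R))"
    using aZ[of R] by simp
  also have "\<dots> = signed (pr \<kappa>2 \<kappa>3) (\<Sum>S\<in>Pow (insert z R). signed (kinv (gdim U) ?x S (insert z R - S))
      (K3 (K2 (args ?X S) # args ?X (insert z R - S))))"
    by (rule alt_insertion_family[OF K2 K3]) (use R X Z zR in auto)
  also have "(\<Sum>S\<in>Pow (insert z R). signed (kinv (gdim U) ?x S (insert z R - S))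
      (K3 (K2 (args ?X S) # args ?X (insert z R - S)))) =
    (\<Sum>S\<in>Pow R. signed (kinv (gdim U) ?x (insert z S) (insert z R - insert z S))
      (K3 (K2 (args ?X (insert z S)) # args ?X (insert z R - insert z S)))) +
    (\<Sum>S\<in>Pow R. signed (kinv (gdim U) ?x S (insert z R - S))
      (K3 (K2 (args ?X S) # args ?X (insert z R - S))))"
    by (rule sum_Pow_insert[OF R zR])
  also have "\<dots> = (\<Sum>S\<in>Pow R. signed (kinv (gdim U) x S (R - S)) (K3 (K2 (Z # args X S) # args X (R - S)))) +
     (\<Sum>S\<in>Pow R. signed (kinv (gdim U) x S (R - S) + (int (card S) + pr (\<Sum>i\<in>S. x i) w))
        (K3 (K2 (args X S) # Z # args X (R - S))))"
  proof (intro arg_cong2[where f = "(+)"] sum.cong refl)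
    fix S assume "S \<in> Pow R"
    then have S: "S \<subseteq> R" "z \<notin> S" "finite S" using zR R by (auto intro: finite_subset)
    have k: "kinv (gdim U) ?x S (R - S) = kinv (gdim U) x S (R - S)"
      using S zR by (intro kinv_cong) auto
    have d1: "insert z R - insert z S = R - S" and d2: "insert z R - S = insert z (R - S)"
      using zR S by auto
    have aXR: "args ?X (R - S) = args X (R - S)" by (rule aX) auto
    have "kinv (gdim U) ?x (insert z S) (R - S) = kinv (gdim U) ?x {z} (R - S) + kinv (gdim U) ?x S (R - S)"
      by (rule kinv_insert_left) (use S in auto)
    moreover have "kinv (gdim U) ?x {z} (R - S) = 0" by (rule kinv_below) (use z in auto)
    ultimately show "signed (kinv (gdim U) ?x (insert z S) (insert z R - insert z S))
      (K3 (K2 (args ?X (insert z S)) # args ?X (insert z R - insert z S)))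
      = signed (kinv (gdim U) x S (R - S)) (K3 (K2 (Z # args X S) # args X (R - S)))"
      unfolding d1 aZ[OF S(1)] aXR using k by simp
    have "kinv (gdim U) ?x S (insert z (R - S)) = kinv (gdim U) ?x S {z} + kinv (gdim U) ?x S (R - S)"
      by (rule kinv_insert_right) (use R zR in auto)
    moreover have "kinv (gdim U) ?x S {z} = int (card S) + pr (\<Sum>i\<in>S. ?x i) (?x z)"
      by (rule kinv_above) (use z S in auto)
    moreover have "(\<Sum>i\<in>S. ?x i) = (\<Sum>i\<in>S. x i)" by (rule sum.cong) (use S in auto)
    ultimately show "signed (kinv (gdim U) ?x S (insert z R - S))
      (K3 (K2 (args ?X S) # args ?X (insert z R - S)))
      = signed (kinv (gdim U) x S (R - S) + (int (card S) + pr (\<Sum>i\<in>S. x i) w))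
        (K3 (K2 (args X S) # Z # args X (R - S)))"
      unfolding d2 aX[OF S(1)] using aZ[of "R - S"] k by (simp add: add.commute)
  qed
  finally show ?thesis .
qed


text \<open>
  In \<open>i(K\<^sub>1)(i(K\<^sub>2)K\<^sub>3)\<close> the value of \<open>K\<^sub>1\<close> is either an argument of \<open>K\<^sub>2\<close> or, next to the value of
  \<open>K\<^sub>2\<close>, an argument of \<open>K\<^sub>3\<close>; the two sums below collect these terms.
\<close>

definition inner_sum where
  "inner_sum K1 K2 K3 X x T = (\<Sum>A\<in>Pow T. \<Sum>B\<in>Pow (T - A).
     signed (kinv (gdim U) x A (T - A) + kinv (gdim U) x B (T - A - B))
       (K3 (K2 (K1 (args X A) # args X B) # args X (T - A - B))))"

definition outer_sum where
  "outer_sum K1 \<kappa>1 K2 K3 X x T = (\<Sum>A\<in>Pow T. \<Sum>B\<in>Pow (T - A).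
     signed (kinv (gdim U) x A (T - A) + (kinv (gdim U) x B (T - A - B)
          + (int (card B) + pr (\<Sum>i\<in>B. x i) ((\<Sum>i\<in>A. x i) + \<kappa>1))))
       (K3 (K2 (args X B) # K1 (args X A) # args X (T - A - B))))"

lemma ins_ins_right:
  fixes X :: "int \<Rightarrow> 'u"
  assumes K1: "K1 \<in> alt_maps U (k1, \<kappa>1)" and K2: "K2 \<in> alt_maps U (k2, \<kappa>2)" and K3: "K3 \<in> alt_maps U (k3, \<kappa>3)"
    and T: "finite T" and X: "\<And>i. i \<in> T \<Longrightarrow> X i \<in> gpart U (x i)"
  shows "ins (k1, \<kappa>1) K1 (k2 + k3, \<kappa>2 + \<kappa>3) (ins (k2, \<kappa>2) K2 (k3, \<kappa>3) K3) (args X T) =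
    signed (pr \<kappa>1 \<kappa>2 + pr \<kappa>1 \<kappa>3 + pr \<kappa>2 \<kappa>3) (inner_sum K1 K2 K3 X x T + outer_sum K1 \<kappa>1 K2 K3 X x T)"
proof -
  have K23: "ins (k2, \<kappa>2) K2 (k3, \<kappa>3) K3 \<in> alt_maps U (k2 + k3, \<kappa>2 + \<kappa>3)"
    using alt_insertion_alt[OF K2 K3] by simp
  have "ins (k1, \<kappa>1) K1 (k2 + k3, \<kappa>2 + \<kappa>3) (ins (k2, \<kappa>2) K2 (k3, \<kappa>3) K3) (args X T) =
    signed (pr \<kappa>1 (\<kappa>2 + \<kappa>3)) (\<Sum>A\<in>Pow T. signed (kinv (gdim U) x A (T - A))
      (ins (k2, \<kappa>2) K2 (k3, \<kappa>3) K3 (K1 (args X A) # args X (T - A))))"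
    by (rule alt_insertion_family[OF K1 K23 T X])
  also have "\<dots> = signed (pr \<kappa>1 (\<kappa>2 + \<kappa>3)) (\<Sum>A\<in>Pow T. signed (kinv (gdim U) x A (T - A))
    (signed (pr \<kappa>2 \<kappa>3)
    ((\<Sum>B\<in>Pow (T - A). signed (kinv (gdim U) x B (T - A - B)) (K3 (K2 (K1 (args X A) # args X B) # args X (T - A - B)))) +
     (\<Sum>B\<in>Pow (T - A). signed (kinv (gdim U) x B (T - A - B) + (int (card B) + pr (\<Sum>i\<in>B. x i) ((\<Sum>i\<in>A. x i) + \<kappa>1)))
        (K3 (K2 (args X B) # K1 (args X A) # args X (T - A - B)))))))"
  proof (intro arg_cong[where f = "signed _"] sum.cong refl)
    fix A assume "A \<in> Pow T"
    then have A: "A \<subseteq> T" "finite A" using T by (auto intro: finite_subset)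
    have "K1 (args X A) \<in> gpart U ((\<Sum>i\<in>A. x i) + \<kappa>1)"
      by (rule degree_args[OF alt_degree[OF K1] A(2)]) (use A X in auto)
    then show "ins (k2, \<kappa>2) K2 (k3, \<kappa>3) K3 (K1 (args X A) # args X (T - A)) = signed (pr \<kappa>2 \<kappa>3)
    ((\<Sum>B\<in>Pow (T - A). signed (kinv (gdim U) x B (T - A - B)) (K3 (K2 (K1 (args X A) # args X B) # args X (T - A - B)))) +
     (\<Sum>B\<in>Pow (T - A). signed (kinv (gdim U) x B (T - A - B) + (int (card B) + pr (\<Sum>i\<in>B. x i) ((\<Sum>i\<in>A. x i) + \<kappa>1)))
        (K3 (K2 (args X B) # K1 (args X A) # args X (T - A - B)))))"
      by (intro ins_Cons_family[OF K2 K3]) (use T X in auto)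
  qed
  also have "\<dots> = signed (pr \<kappa>1 \<kappa>2 + pr \<kappa>1 \<kappa>3 + pr \<kappa>2 \<kappa>3)
      (inner_sum K1 K2 K3 X x T + outer_sum K1 \<kappa>1 K2 K3 X x T)"
    unfolding inner_sum_def outer_sum_def
    by (simp add: signed_add signed_sum sum.distrib pairing_simps ac_simps)
  finally show ?thesis .
qed

lemma ins_ins_left:
  fixes X :: "int \<Rightarrow> 'u"
  assumes K1: "K1 \<in> alt_maps U (k1, \<kappa>1)" and K2: "K2 \<in> alt_maps U (k2, \<kappa>2)" and K3: "K3 \<in> alt_maps U (k3, \<kappa>3)"
    and T: "finite T" and X: "\<And>i. i \<in> T \<Longrightarrow> X i \<in> gpart U (x i)"
  shows "ins (k1 + k2, \<kappa>1 + \<kappa>2) (ins (k1, \<kappa>1) K1 (k2, \<kappa>2) K2) (k3, \<kappa>3) K3 (args X T) =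
    signed (pr \<kappa>1 \<kappa>2 + pr \<kappa>1 \<kappa>3 + pr \<kappa>2 \<kappa>3) (inner_sum K1 K2 K3 X x T)"
proof -
  have K12: "ins (k1, \<kappa>1) K1 (k2, \<kappa>2) K2 \<in> alt_maps U (k1 + k2, \<kappa>1 + \<kappa>2)"
    using alt_insertion_alt[OF K1 K2] by simp
  note ml3 = alt_multilinear[OF K3]
  define f where "f A B = signed (kinv (gdim U) x A (T - A) + kinv (gdim U) x B (T - A - B))
       (K3 (K2 (K1 (args X A) # args X B) # args X (T - A - B)))" for A B
  have "ins (k1 + k2, \<kappa>1 + \<kappa>2) (ins (k1, \<kappa>1) K1 (k2, \<kappa>2) K2) (k3, \<kappa>3) K3 (args X T) =
    signed (pr (\<kappa>1 + \<kappa>2) \<kappa>3) (\<Sum>S\<in>Pow T. signed (kinv (gdim U) x S (T - S))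
      (K3 (ins (k1, \<kappa>1) K1 (k2, \<kappa>2) K2 (args X S) # args X (T - S))))"
    by (rule alt_insertion_family[OF K12 K3 T X])
  also have "\<dots> = signed (pr (\<kappa>1 + \<kappa>2) \<kappa>3) (\<Sum>S\<in>Pow T. \<Sum>A\<in>Pow S. signed (pr \<kappa>1 \<kappa>2) (f A (S - A)))"
  proof (intro arg_cong[where f = "signed _"] sum.cong refl)
    fix S assume "S \<in> Pow T"
    then have S: "S \<subseteq> T" "finite S" using T by (auto intro: finite_subset)
    have i: "ins (k1, \<kappa>1) K1 (k2, \<kappa>2) K2 (args X S) = signed (pr \<kappa>1 \<kappa>2)
        (\<Sum>A\<in>Pow S. signed (kinv (gdim U) x A (S - A)) (K2 (K1 (args X A) # args X (S - A))))"
      by (rule alt_insertion_family[OF K1 K2 S(2)]) (use S X in auto)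
    have "signed (kinv (gdim U) x S (T - S)) (K3 (ins (k1, \<kappa>1) K1 (k2, \<kappa>2) K2 (args X S) # args X (T - S)))
      = (\<Sum>A\<in>Pow S. signed (kinv (gdim U) x S (T - S) + (pr \<kappa>1 \<kappa>2 + kinv (gdim U) x A (S - A)))
          (K3 (K2 (K1 (args X A) # args X (S - A)) # args X (T - S))))"
      unfolding i by (simp add: signed_sum ml_signed[OF ml3, of "[]", simplified] ml_sum[OF ml3, of "[]", simplified])
    also have "\<dots> = (\<Sum>A\<in>Pow S. signed (pr \<kappa>1 \<kappa>2) (f A (S - A)))"
    proof (rule sum.cong[OF refl])
      fix A assume "A \<in> Pow S"
      then have A: "A \<subseteq> S" "finite A" using S by (auto intro: finite_subset)
      have rest: "T - A - (S - A) = T - S" using A S by auto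
      have "kinv (gdim U) x (A \<union> (S - A)) (T - S) = kinv (gdim U) x A (T - S) + kinv (gdim U) x (S - A) (T - S)"
        by (rule kinv_Un_left) (use A S in auto)
      moreover have "A \<union> (S - A) = S" using A by auto
      moreover have "kinv (gdim U) x A ((S - A) \<union> (T - S)) = kinv (gdim U) x A (S - A) + kinv (gdim U) x A (T - S)"
        by (rule kinv_Un_right) (use A S T in auto)
      moreover have "(S - A) \<union> (T - S) = T - A" using A S by auto
      ultimately show "signed (kinv (gdim U) x S (T - S) + (pr \<kappa>1 \<kappa>2 + kinv (gdim U) x A (S - A)))
          (K3 (K2 (K1 (args X A) # args X (S - A)) # args X (T - S))) = signed (pr \<kappa>1 \<kappa>2) (f A (S - A))"
        unfolding f_def rest signed_signed by (intro signed_cong) simp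
    qed
    finally show "signed (kinv (gdim U) x S (T - S)) (K3 (ins (k1, \<kappa>1) K1 (k2, \<kappa>2) K2 (args X S) # args X (T - S)))
      = (\<Sum>A\<in>Pow S. signed (pr \<kappa>1 \<kappa>2) (f A (S - A)))" .
  qed
  also have "\<dots> = signed (pr (\<kappa>1 + \<kappa>2) \<kappa>3) (\<Sum>A\<in>Pow T. \<Sum>B\<in>Pow (T - A). signed (pr \<kappa>1 \<kappa>2) (f A B))"
    by (subst sum_Pow_Pow[OF T, where f = "\<lambda>A B. signed (pr \<kappa>1 \<kappa>2) (f A B)"]) simp
  also have "\<dots> = signed (pr \<kappa>1 \<kappa>2 + pr \<kappa>1 \<kappa>3 + pr \<kappa>2 \<kappa>3) (inner_sum K1 K2 K3 X x T)"
    unfolding inner_sum_def f_def[symmetric] signed_sum[symmetric] signed_signed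
    by (intro signed_cong) (simp add: pairing_simps)
  finally show ?thesis .
qed

text \<open>
  Termwise for disjoint \<open>A\<close> and \<open>B\<close>: exchanging the values of \<open>K\<^sub>1\<close> and \<open>K\<^sub>2\<close> as arguments of \<open>K\<^sub>3\<close>, and moving
  \<open>X\<^sub>A\<close> and \<open>X\<^sub>B\<close> past each other, leaves the sign of exchanging objects of degrees \<open>(k\<^sub>1, \<kappa>\<^sub>1)\<close> and
  \<open>(k\<^sub>2, \<kappa>\<^sub>2)\<close>.
\<close>

lemma outer_sum_swap:
  fixes X :: "int \<Rightarrow> 'u"
  assumes K1: "K1 \<in> alt_maps U (k1, \<kappa>1)" and K2: "K2 \<in> alt_maps U (k2, \<kappa>2)" and K3: "K3 \<in> alt_maps U (k3, \<kappa>3)"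
    and T: "finite T" and X: "\<And>i. i \<in> T \<Longrightarrow> X i \<in> gpart U (x i)"
  shows "outer_sum K1 \<kappa>1 K2 K3 X x T = signed (k1 * k2 + pr \<kappa>1 \<kappa>2) (outer_sum K2 \<kappa>2 K1 K3 X x T)"
proof -
  define f where "f K1 \<kappa>1 K2 A B = signed (kinv (gdim U) x A (T - A) + (kinv (gdim U) x B (T - A - B)
          + (int (card B) + pr (\<Sum>i\<in>B. x i) ((\<Sum>i\<in>A. x i) + \<kappa>1))))
       (K3 (K2 (args X B) # K1 (args X A) # args X (T - A - B)))" for K1 \<kappa>1 K2 A B
  note ml3 = alt_multilinear[OF K3]
  have fs: "f K1 \<kappa>1 K2 A B = signed (k1 * k2 + pr \<kappa>1 \<kappa>2) (f K2 \<kappa>2 K1 B A)"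
    if A: "A \<subseteq> T" and B: "B \<subseteq> T - A" for A B
  proof (cases "int (card A) = k1 + 1 \<and> int (card B) = k2 + 1")
    case False
    then have "K1 (args X A) = 0 \<or> K2 (args X B) = 0"
      using alt_length[OF K1, of "args X A"] alt_length[OF K2, of "args X B"] by auto
    then have "f K1 \<kappa>1 K2 A B = 0" "f K2 \<kappa>2 K1 B A = 0"
      using ml_zero[OF ml3, of "[]"] ml_zero[OF ml3, of "[_]"] by (auto simp: f_def)
    then show ?thesis by simp
  next
    case True
    then have c: "int (card A) = k1 + 1" "int (card B) = k2 + 1" by auto
    have fin: "finite A" "finite B" using A B T by (auto intro: finite_subset)
    let ?C = "T - A - B" and ?a = "\<Sum>i\<in>A. x i" and ?b = "\<Sum>i\<in>B. x i"
    have rest: "T - B - A = ?C" by auto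
    have "T - A = B \<union> ?C" "T - B = A \<union> ?C" using A B by auto
    then have 1: "kinv (gdim U) x A (T - A) = kinv (gdim U) x A B + kinv (gdim U) x A ?C"
      and 2: "kinv (gdim U) x B (T - B) = kinv (gdim U) x B A + kinv (gdim U) x B ?C"
      using kinv_Un_right[of B ?C "gdim U" x A] kinv_Un_right[of A ?C "gdim U" x B] A B T fin by auto
    have "A \<inter> B = {}" using B by auto
    from kinv_swap[OF this, of "gdim U" x]
    have 3: "kinv (gdim U) x A B = (k1 + 1) * (k2 + 1) + pr ?a ?b - kinv (gdim U) x B A"
      unfolding c by linarith
    have s: "K3 (K2 (args X B) # K1 (args X A) # args X ?C) =
        signed (1 + pr (?b + \<kappa>2) (?a + \<kappa>1)) (K3 (K1 (args X A) # K2 (args X B) # args X ?C))"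
      by (rule alternating_swap[OF alt_alternating[OF K3] degree_args[OF alt_degree[OF K2] fin(2)]
            degree_args[OF alt_degree[OF K1] fin(1)]]) (use A B T X in auto)
    show ?thesis
      unfolding f_def s rest 1 2 3 c signed_signed
      by (rule signed_cong)
         (simp add: pairing_simps pairing_commute[of _ ?b ?a] pairing_commute[of _ \<kappa>2 \<kappa>1]
            pairing_commute[of _ \<kappa>2 ?a] pairing_commute[of _ \<kappa>1 ?a] pairing_commute[of _ \<kappa>1 ?b]
            pairing_commute[of _ \<kappa>2 ?b] algebra_simps)
  qed
  have "outer_sum K1 \<kappa>1 K2 K3 X x T = (\<Sum>A\<in>Pow T. \<Sum>B\<in>Pow (T - A). f K1 \<kappa>1 K2 A B)"
    by (simp add: outer_sum_def f_def)
  also have "\<dots> = (\<Sum>A\<in>Pow T. \<Sum>B\<in>Pow (T - A). signed (k1 * k2 + pr \<kappa>1 \<kappa>2) (f K2 \<kappa>2 K1 B A))"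
    using fs by (intro sum.cong refl) auto
  also have "\<dots> = signed (k1 * k2 + pr \<kappa>1 \<kappa>2) (\<Sum>A\<in>Pow T. \<Sum>B\<in>Pow (T - A). f K2 \<kappa>2 K1 B A)"
    by (simp add: signed_sum)
  also have "(\<Sum>A\<in>Pow T. \<Sum>B\<in>Pow (T - A). f K2 \<kappa>2 K1 B A) = (\<Sum>A\<in>Pow T. \<Sum>B\<in>Pow (T - A). f K2 \<kappa>2 K1 A B)"
    by (rule sum_Pow_swap[OF T])
  also have "\<dots> = outer_sum K2 \<kappa>2 K1 K3 X x T" by (simp add: outer_sum_def f_def)
  finally show ?thesis .
qed

text \<open>
  The associator of the insertion product is the outer sum, and this is graded symmetric in the first
  two maps.
\<close>

theorem pre_Lie:
  assumes K: "K1 \<in> alt_maps U d1" "K2 \<in> alt_maps U d2" "K3 \<in> alt_maps U d3"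
  shows "ins d1 K1 (d2 + d3) (ins d2 K2 d3 K3) - ins (d1 + d2) (ins d1 K1 d2 K2) d3 K3 =
    signed (dsgn d1 d2) (ins d2 K2 (d1 + d3) (ins d1 K1 d3 K3) - ins (d1 + d2) (ins d2 K2 d1 K1) d3 K3)"
proof (rule alt_eqI)
  have c: "d2 + (d1 + d3) = d1 + (d2 + d3)" "d1 + d2 + d3 = d1 + (d2 + d3)" "d2 + d1 = d1 + d2"
    by (simp_all add: ac_simps)
  have a: "ins d1 K1 (d2 + d3) (ins d2 K2 d3 K3) \<in> alt_maps U (d1 + (d2 + d3))"
    "ins (d1 + d2) (ins d1 K1 d2 K2) d3 K3 \<in> alt_maps U (d1 + (d2 + d3))"
    "ins d2 K2 (d1 + d3) (ins d1 K1 d3 K3) \<in> alt_maps U (d1 + (d2 + d3))"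
    "ins (d1 + d2) (ins d2 K2 d1 K1) d3 K3 \<in> alt_maps U (d1 + (d2 + d3))"
    using K alt_insertion_alt[OF K(1) alt_insertion_alt[OF K(2,3)]] alt_insertion_alt[OF alt_insertion_alt[OF K(1,2)] K(3)]
      alt_insertion_alt[OF K(2) alt_insertion_alt[OF K(1,3)]] alt_insertion_alt[OF alt_insertion_alt[OF K(2,1)] K(3)]
    by (simp_all only: c)
  show "ins d1 K1 (d2 + d3) (ins d2 K2 d3 K3) - ins (d1 + d2) (ins d1 K1 d2 K2) d3 K3 \<in> alt_maps U (d1 + (d2 + d3))"
    "signed (dsgn d1 d2) (ins d2 K2 (d1 + d3) (ins d1 K1 d3 K3) - ins (d1 + d2) (ins d2 K2 d1 K1) d3 K3)
      \<in> alt_maps U (d1 + (d2 + d3))"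
    using a by (auto intro: alt_diff alt_signed)
  fix T and X :: "int \<Rightarrow> 'u" and x
  assume TX: "finite T" "\<And>i. i \<in> T \<Longrightarrow> X i \<in> gpart U (x i)"
  obtain k1 \<kappa>1 k2 \<kappa>2 k3 \<kappa>3 where d: "d1 = (k1, \<kappa>1)" "d2 = (k2, \<kappa>2)" "d3 = (k3, \<kappa>3)"
    by (cases d1, cases d2, cases d3)
  note K = K[unfolded d]
  let ?s = "pr \<kappa>1 \<kappa>2 + pr \<kappa>1 \<kappa>3 + pr \<kappa>2 \<kappa>3" and ?s' = "pr \<kappa>2 \<kappa>1 + pr \<kappa>2 \<kappa>3 + pr \<kappa>1 \<kappa>3"
  have s: "?s' = ?s" by (simp add: pairing_commute[of _ \<kappa>2 \<kappa>1])
  have 1: "(ins d1 K1 (d2 + d3) (ins d2 K2 d3 K3)) (args X T) - (ins (d1 + d2) (ins d1 K1 d2 K2) d3 K3) (args X T)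
      = signed ?s (outer_sum K1 \<kappa>1 K2 K3 X x T)"
    by (simp only: d add_Pair ins_ins_right[OF K TX] ins_ins_left[OF K TX]) (simp add: signed_add)
  have 2: "(ins d2 K2 (d1 + d3) (ins d1 K1 d3 K3)) (args X T) - (ins (d2 + d1) (ins d2 K2 d1 K1) d3 K3) (args X T)
      = signed ?s' (outer_sum K2 \<kappa>2 K1 K3 X x T)"
    by (simp only: d add_Pair ins_ins_right[OF K(2,1,3) TX] ins_ins_left[OF K(2,1,3) TX]) (simp add: signed_add)
  show "(ins d1 K1 (d2 + d3) (ins d2 K2 d3 K3) - ins (d1 + d2) (ins d1 K1 d2 K2) d3 K3) (args X T) =
    signed (dsgn d1 d2) (ins d2 K2 (d1 + d3) (ins d1 K1 d3 K3) - ins (d1 + d2) (ins d2 K2 d1 K1) d3 K3) (args X T)"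
  proof -
    have 3: "outer_sum K1 \<kappa>1 K2 K3 X x T = signed (k1 * k2 + pr \<kappa>1 \<kappa>2) (outer_sum K2 \<kappa>2 K1 K3 X x T)"
      by (rule outer_sum_swap[OF K TX])
    show ?thesis
      unfolding signed_fun fun_diff_def 1 2[unfolded c s] 3 signed_signed
      by (simp add: dsgn_def d add.commute)
  qed
qed

section \<open>The graded Lie algebra \<open>A(U)\<close>\<close>

abbreviation brh where "brh \<equiv> nr_bracket_hom U"

lemma brh_eq: "brh d1 K1 d2 K2 = ins d1 K1 d2 K2 - signed (dsgn d1 d2) (ins d2 K2 d1 K1)"
  by (simp add: nr_bracket_hom_def map_scale_sign dsgn_def)

lemma brh_alt:
  assumes "K1 \<in> alt_maps U d1" "K2 \<in> alt_maps U d2"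
  shows "brh d1 K1 d2 K2 \<in> alt_maps U (d1 + d2)"
  unfolding brh_eq
  using alt_insertion_alt[OF assms] alt_insertion_alt[OF assms(2,1)]
  by (auto simp: add.commute intro!: alt_diff alt_signed)

lemma biadditive_brh: "biadditive (alt_maps U) (alt_maps U) brh"
  unfolding biadditive_def brh_eq
  by (auto simp: ins_add_left ins_add_right signed_add)

text \<open>
  In any graded pre-Lie algebra the graded commutator satisfies the Jacobi identity: written out, the
  twelve terms group into the symmetric associators of the three pairs.
\<close>

theorem Jacobi_homogeneous:
  assumes K: "K1 \<in> alt_maps U d1" "K2 \<in> alt_maps U d2" "K3 \<in> alt_maps U d3"
  shows "brh d1 K1 (d2 + d3) (brh d2 K2 d3 K3) =
    brh (d1 + d2) (brh d1 K1 d2 K2) d3 K3 + signed (dsgn d1 d2) (brh d2 K2 (d1 + d3) (brh d1 K1 d3 K3))"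
proof -
  have c: "d2 + d1 = d1 + d2" "d3 + d1 = d1 + d3" "d3 + d2 = d2 + d3" by (simp_all add: add.commute)
  note a = alt_insertion_alt[OF K(1,2)] alt_insertion_alt[OF K(2,1), unfolded c]
    alt_insertion_alt[OF K(1,3)] alt_insertion_alt[OF K(3,1), unfolded c]
    alt_insertion_alt[OF K(2,3)] alt_insertion_alt[OF K(3,2), unfolded c]
  have neg: "signed b v = v \<or> signed b v = - v" for b and v :: "'u list \<Rightarrow> 'u" by (simp add: signed_def)
  have p: "ins d1 K1 (d2 + d3) (ins d2 K2 d3 K3) = ins (d1 + d2) (ins d1 K1 d2 K2) d3 K3 +
      signed (dsgn d1 d2) (ins d2 K2 (d1 + d3) (ins d1 K1 d3 K3) - ins (d1 + d2) (ins d2 K2 d1 K1) d3 K3)"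
    "ins d1 K1 (d2 + d3) (ins d3 K3 d2 K2) = ins (d1 + d3) (ins d1 K1 d3 K3) d2 K2 +
      signed (dsgn d1 d3) (ins d3 K3 (d1 + d2) (ins d1 K1 d2 K2) - ins (d1 + d3) (ins d3 K3 d1 K1) d2 K2)"
    "ins d2 K2 (d1 + d3) (ins d3 K3 d1 K1) = ins (d2 + d3) (ins d2 K2 d3 K3) d1 K1 +
      signed (dsgn d2 d3) (ins d3 K3 (d1 + d2) (ins d2 K2 d1 K1) - ins (d2 + d3) (ins d3 K3 d2 K2) d1 K1)"
    using pre_Lie[OF K] pre_Lie[OF K(1,3,2)] pre_Lie[OF K(2,3,1)]
    by (simp_all add: c diff_eq_eq add.commute)
  show ?thesis
    unfolding brh_eq
    by (simp add: a K alt_signed ins_diff_left ins_diff_right ins_signed_left ins_signed_right dsgn_add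
          dsgn_commute[of d3] dsgn_commute[of d2 d1] p signed_diff signed_add)
       (simp add: signed_def)
qed


abbreviation nr where "nr \<equiv> nr_bracket U"

lemma nr_eq: "nr = bilinear_ext (alt_maps U) (alt_maps U) brh"
  by (intro ext) (simp add: nr_bracket_def bilinear_ext_def)

lemma nr_homogeneous: "K \<in> alt_maps U d \<Longrightarrow> L \<in> alt_maps U e \<Longrightarrow> nr K L = brh d K e L"
  unfolding nr_eq by (rule bilinear_ext_homogeneous[OF direct_alt_maps direct_alt_maps biadditive_brh])

lemma nr_alt: "K \<in> alt_maps U d \<Longrightarrow> L \<in> alt_maps U e \<Longrightarrow> nr K L \<in> alt_maps U (d + e)"
  by (simp add: nr_homogeneous brh_alt)

lemmas alg_add = dsum_add[OF direct_alt_maps]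
  and alg_zero = dsum_zero[OF direct_alt_maps]
  and alg_minus = dsum_minus[OF direct_alt_maps]
  and alt_alg = in_dsum[OF direct_alt_maps]
  and alg_induct = dsum_induct[OF direct_alt_maps, consumes 1, case_names homogeneous add]
  and alg_induct2 = dsum_induct2[OF direct_alt_maps direct_alt_maps, consumes 2,
      case_names homogeneous add_left add_right]

lemma nr_add_left:
  "K \<in> alt_algebra U \<Longrightarrow> K' \<in> alt_algebra U \<Longrightarrow> L \<in> alt_algebra U \<Longrightarrow> nr (K + K') L = nr K L + nr K' L"
  unfolding nr_eq
  by (rule bilinear_ext_add(1)[OF direct_alt_maps direct_alt_maps biadditive_brh _ _ _ alg_zero])

lemma nr_add_right:
  "K \<in> alt_algebra U \<Longrightarrow> L \<in> alt_algebra U \<Longrightarrow> L' \<in> alt_algebra U \<Longrightarrow> nr K (L + L') = nr K L + nr K L'"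
  unfolding nr_eq
  by (rule bilinear_ext_add(2)[OF direct_alt_maps direct_alt_maps biadditive_brh _ alg_zero])

lemma nr_zero_left [simp]: "nr 0 L = 0"
  by (simp add: nr_bracket_def hsupp_def hcomp_zero[OF direct_alt_maps])

lemma nr_zero_right [simp]: "nr K 0 = 0"
  by (simp add: nr_bracket_def hsupp_def hcomp_zero[OF direct_alt_maps])

lemma nr_alg:
  assumes "K \<in> alt_algebra U" "L \<in> alt_algebra U"
  shows "nr K L \<in> alt_algebra U"
  using assms
proof (induction rule: alg_induct2)
  case (homogeneous d e K L)
  then show ?case by (rule alt_alg[OF nr_alt])
qed (simp_all only: nr_add_left nr_add_right alg_add)

lemma map_scale_add: "map_scale U a (K + L) = map_scale U a K + map_scale U a L"
  by (simp add: map_scale_def fun_eq_iff vs.scale_right_distrib)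

lemma map_scale_diff: "map_scale U a (K - L) = map_scale U a K - map_scale U a L"
  by (simp add: map_scale_def fun_eq_iff vs.scale_right_diff_distrib)

lemma map_scale_signed: "map_scale U a (signed b K) = signed b (map_scale U a K)"
  by (simp add: map_scale_def fun_eq_iff signed_fun scale_signed)

lemma alg_scale: "K \<in> alt_algebra U \<Longrightarrow> map_scale U a K \<in> alt_algebra U"
proof (induction rule: alg_induct)
  case (homogeneous d K)
  show ?case by (rule alt_alg[OF alt_scale[OF homogeneous]])
qed (simp only: map_scale_add alg_add)

lemma brh_scale:
  assumes "K \<in> alt_maps U d" "L \<in> alt_maps U e"
  shows "brh d (map_scale U a K) e L = map_scale U a (brh d K e L)"
    and "brh d K e (map_scale U a L) = map_scale U a (brh d K e L)"
  using assms by (simp_all add: brh_eq ins_scale_left ins_scale_right map_scale_diff map_scale_signed)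

lemma nr_scale_left:
  assumes "K \<in> alt_algebra U" "L \<in> alt_algebra U"
  shows "nr (map_scale U a K) L = map_scale U a (nr K L)"
  using assms
proof (induction rule: alg_induct2)
  case (homogeneous d e K L)
  show ?case
    by (simp only: nr_homogeneous[OF homogeneous] nr_homogeneous[OF alt_scale[OF homogeneous(1)] homogeneous(2)]
        brh_scale[OF homogeneous])
qed (simp_all only: nr_add_left nr_add_right map_scale_add alg_scale)

lemma nr_scale_right:
  assumes "K \<in> alt_algebra U" "L \<in> alt_algebra U"
  shows "nr K (map_scale U a L) = map_scale U a (nr K L)"
  using assms
proof (induction rule: alg_induct2)
  case (homogeneous d e K L)
  show ?case
    by (simp only: nr_homogeneous[OF homogeneous] nr_homogeneous[OF homogeneous(1) alt_scale[OF homogeneous(2)]]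
        brh_scale[OF homogeneous])
qed (simp_all only: nr_add_left nr_add_right map_scale_add alg_scale)

lemma nr_signed_left: "K \<in> alt_algebra U \<Longrightarrow> L \<in> alt_algebra U \<Longrightarrow> nr (signed a K) L = signed a (nr K L)"
  using nr_scale_left[of K L "(-1) powi a"] by (simp add: map_scale_sign)

lemma nr_signed_right: "K \<in> alt_algebra U \<Longrightarrow> L \<in> alt_algebra U \<Longrightarrow> nr K (signed a L) = signed a (nr K L)"
  using nr_scale_right[of K L "(-1) powi a"] by (simp add: map_scale_sign)

lemma nr_diff_left:
  assumes "K \<in> alt_algebra U" "K' \<in> alt_algebra U" "L \<in> alt_algebra U"
  shows "nr (K - K') L = nr K L - nr K' L"
  using nr_add_left[OF assms(1) alg_minus[OF assms(2)] assms(3)] nr_signed_left[OF assms(2,3), of 1]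
  by (simp add: signed_def)

lemma nr_diff_right:
  assumes "K \<in> alt_algebra U" "L \<in> alt_algebra U" "L' \<in> alt_algebra U"
  shows "nr K (L - L') = nr K L - nr K L'"
  using nr_add_right[OF assms(1,2) alg_minus[OF assms(3)]] nr_signed_right[OF assms(1,3), of 1]
  by (simp add: signed_def)

lemma nr_Jacobi:
  assumes K: "K1 \<in> alt_maps U d1" "K2 \<in> alt_maps U d2" and "K3 \<in> alt_algebra U"
  shows "nr K1 (nr K2 K3) = nr (nr K1 K2) K3 + signed (dsgn d1 d2) (nr K2 (nr K1 K3))"
  using assms(3)
proof (induction rule: alg_induct)
  case (homogeneous d3 K3)
  note K = K homogeneous
  show ?case
    unfolding nr_homogeneous[OF K(1,2)] nr_homogeneous[OF K(1,3)] nr_homogeneous[OF K(2,3)]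
      nr_homogeneous[OF K(1) brh_alt[OF K(2,3)]] nr_homogeneous[OF K(2) brh_alt[OF K(1,3)]]
      nr_homogeneous[OF brh_alt[OF K(1,2)] K(3)]
    by (rule Jacobi_homogeneous[OF K])
next
  case (add K3 K3')
  note a = alt_alg[OF K(1)] alt_alg[OF K(2)]
  note s = nr_add_right[OF a(1)] nr_add_right[OF a(2)] nr_add_right[OF nr_alg[OF a]] nr_alg[OF a(1)] nr_alg[OF a(2)]
  from add show ?case by (simp only: s signed_add) (simp only: ac_simps)
qed

lemma double_eq_zero: "v + v = 0 \<Longrightarrow> v = (0 :: 'u)"
proof -
  assume "v + v = 0"
  then have "gscale U 2 v = 0" using vs.scale_left_distrib[of 1 1 v] by simp
  then show ?thesis by simp
qed

lemma double_fun_eq_zero: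
  fixes K :: "'u list \<Rightarrow> 'u"
  assumes "K + K = 0"
  shows "K = 0"
  using assms by (auto simp: fun_eq_iff intro: double_eq_zero)

text \<open>The square of the adjoint action of an odd element is half the action of its self-bracket.\<close>

lemma nr_square_zero:
  assumes P: "P \<in> alt_maps U d" "odd (dsgn d d)" "nr P P = 0" and K: "K \<in> alt_algebra U"
  shows "nr P (nr P K) = 0"
proof (rule double_fun_eq_zero)
  have "nr P (nr P K) = - nr P (nr P K)"
    using nr_Jacobi[OF P(1,1) K] P(2,3) by (simp only: signed_def if_False nr_zero_left add_0)
  then show "nr P (nr P K) + nr P (nr P K) = 0" by (metis add.right_inverse)
qed

lemma nr_self:
  assumes P: "P \<in> alt_maps U d" "odd (dsgn d d)"
  shows "nr P P = 0 \<longleftrightarrow> ins d P d P = 0"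
proof -
  have "nr P P = ins d P d P + ins d P d P"
    using P(2) by (simp add: nr_homogeneous[OF P(1,1)] brh_eq signed_def)
  then show ?thesis using double_fun_eq_zero[of "ins d P d P"] by (simp only:) force
qed

end

section \<open>The graded space \<open>E = V \<oplus> W\<close>\<close>

lemma dcons_0 [simp]: "dcons q x 0 = q"
  and dcons_Suc [simp]: "dcons q x (Suc i) = x i"
  by (simp_all add: dcons_def)

lemma dcons_eta: "dcons (d 0) (\<lambda>i. d (Suc i)) = d"
  by (rule ext) (simp add: dcons_def split: nat.split)

lemma dcons_cases:
  obtains q x where "d = dcons q x"
  using dcons_eta[of d, symmetric] by blast

lemma dcons_eq_iff [simp]: "dcons q x = dcons r y \<longleftrightarrow> q = r \<and> x = y"
proof
  assume e: "dcons q x = dcons r y"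
  have "x i = y i" for i using fun_cong[OF e, of "Suc i"] by simp
  then show "q = r \<and> x = y" using fun_cong[OF e, of 0] by auto
qed simp

lemma dcons_add: "dcons p x + dcons q y = dcons (p + q) (x + y)"
  by (rule ext) (simp add: dcons_def split: nat.split)

lemma dcons_zero: "dcons 0 0 = 0"
  by (rule ext) (simp add: dcons_def split: nat.split)

lemma sum_list_dcons: "sum_list (map (dcons 0) xs) = dcons 0 (sum_list xs)"
  by (induction xs) (simp_all only: sum_list.Nil sum_list.Cons list.map dcons_zero dcons_add add_0)

lemma pairing_dcons: "pairing (Suc n) (dcons p x) (dcons q y) = p * q + pairing n x y"
  by (simp add: pairing_def sum.lessThan_Suc_shift del: sum.lessThan_Suc)

lemma gpart_Egr:
  "gpart (Egr V W) (dcons q x) =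
    (if q = 0 then gpart V x \<times> {0} else if q = 1 then {0} \<times> gpart W x else {(0, 0)})"
  by (simp add: Egr_def)

lemma gdim_Egr [simp]: "gdim (Egr V W) = Suc (gdim V)"
  by (simp add: Egr_def)

lemma gscale_Egr: "gscale (Egr V W) a (v, w) = (gscale V a v, gscale W a w)"
  by (simp add: Egr_def)

text \<open>
  The components of \<open>(v, w)\<close> are those of \<open>v\<close> in the degrees \<open>(0, x)\<close> and those of \<open>w\<close> in the degrees
  \<open>(1, x)\<close>. Conversely a decomposition of zero projects to decompositions of zero in \<open>V\<close> and in \<open>W\<close>.
\<close>

lemma graded_Egr:
  fixes V :: "('k::field_char_0, 'v::ab_group_add) gspace" and W :: "('k, 'w::ab_group_add) gspace"
  assumes V: "graded_space V" and W: "graded_space W" and dim: "gdim W = gdim V"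
  shows "graded_space (Egr V W)"
proof -
  interpret V: graded_vs V by unfold_locales (rule V)
  interpret W: graded_vs W by unfold_locales (rule W)
  let ?E = "Egr V W"
  interpret E: vector_space "gscale ?E"
    by unfold_locales
      (auto simp: Egr_def V.vs.scale_right_distrib W.vs.scale_right_distrib V.vs.scale_left_distrib W.vs.scale_left_distrib)
  have sub: "E.subspace (gpart ?E d)" for d
  proof -
    obtain q x where d: "d = dcons q x" by (rule dcons_cases)
    show ?thesis
      unfolding d gpart_Egr E.subspace_def
      by (auto simp: gscale_Egr V.part_zero W.part_zero V.part_add W.part_add V.part_scale W.part_scale zero_prod_def)
  qed
  have out: "gpart ?E d = {0}" if "d \<notin> degs (gdim ?E)" for d
  proof -
    obtain q x where d: "d = dcons q x" by (rule dcons_cases)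
    have "x \<notin> degs (gdim V)"
    proof
      assume x: "x \<in> degs (gdim V)"
      have "d i = 0" if "i \<ge> Suc (gdim V)" for i
        using that x by (cases i) (auto simp: d degs_def)
      with \<open>d \<notin> degs (gdim ?E)\<close> show False by (simp add: degs_def)
    qed
    then have "gpart V x = {0}" "gpart W x = {0}"
      using V W dim unfolding graded_space_def by auto
    then show ?thesis unfolding d gpart_Egr by (simp add: zero_prod_def)
  qed
  have "\<exists>!f. decomposes (gpart ?E) e f" for e
  proof -
    obtain v w where e: "e = (v, w)" by (cases e)
    let ?f = "\<lambda>d. if d 0 = 0 then (hcomp (gpart V) v (\<lambda>i. d (Suc i)), 0)
      else if d 0 = 1 then (0, hcomp (gpart W) w (\<lambda>i. d (Suc i))) else (0, 0)"
    let ?A = "dcons 0 ` hsupp (gpart V) v" and ?B = "dcons 1 ` hsupp (gpart W) w"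
    have "decomposes (gpart ?E) e ?f"
    proof (rule decomposesI[of "?A \<union> ?B"])
      show "finite (?A \<union> ?B)" by (simp add: V.cmp_finite W.cmp_finite)
      show "?f d \<in> gpart ?E d" for d
      proof -
        obtain q x where d: "d = dcons q x" by (rule dcons_cases)
        show ?thesis unfolding d gpart_Egr by (simp add: V.cmp_in W.cmp_in)
      qed
      show "?f d = 0" if "d \<notin> ?A \<union> ?B" for d
      proof -
        obtain q x where d: "d = dcons q x" by (rule dcons_cases)
        have "q = 0 \<Longrightarrow> x \<notin> hsupp (gpart V) v" "q = 1 \<Longrightarrow> x \<notin> hsupp (gpart W) w" using that d by auto
        then show ?thesis unfolding d by (auto simp: hsupp_def zero_prod_def)
      qed
      have "(\<Sum>d\<in>?A \<union> ?B. ?f d) = (\<Sum>d\<in>?A. ?f d) + (\<Sum>d\<in>?B. ?f d)"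
        by (rule sum.union_disjoint) (auto simp: V.cmp_finite W.cmp_finite)
      also have "(\<Sum>d\<in>?A. ?f d) = (\<Sum>x\<in>hsupp (gpart V) v. (hcomp (gpart V) v x, 0))"
        by (subst sum.reindex) (auto intro: inj_onI)
      also have "(\<Sum>d\<in>?B. ?f d) = (\<Sum>x\<in>hsupp (gpart W) w. (0, hcomp (gpart W) w x))"
        by (subst sum.reindex) (auto intro: inj_onI)
      also have "(\<Sum>x\<in>hsupp (gpart V) v. (hcomp (gpart V) v x, 0 :: 'w)) = (v, 0)"
        by (rule prod_eqI) (simp_all add: fst_sum snd_sum V.cmp_sum V.cmp_finite)
      also have "(\<Sum>x\<in>hsupp (gpart W) w. (0 :: 'v, hcomp (gpart W) w x)) = (0, w)"
        by (rule prod_eqI) (simp_all add: fst_sum snd_sum W.cmp_sum W.cmp_finite)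
      finally show "e = (\<Sum>d\<in>?A \<union> ?B. ?f d)" by (simp add: e)
    qed
    moreover have "direct (gpart ?E)"
      unfolding direct_def
    proof (intro conjI allI impI ballI)
      fix f d assume f: "decomposes (gpart ?E) 0 f"
      have fin: "finite {d. f d \<noteq> 0}" and fE: "\<And>d. f d \<in> gpart ?E d" and s: "0 = (\<Sum>d | f d \<noteq> 0. f d)"
        using f unfolding decomposes_def by auto
      have fq: "decomposes G 0 (\<lambda>x. g (f (dcons q x)))"
        if g: "g 0 = 0" "\<And>e e'. g (e + e') = g e + g e'" and G: "\<And>x. g (f (dcons q x)) \<in> G x"
          and other: "\<And>p x. p \<noteq> q \<Longrightarrow> g (f (dcons p x)) = 0"
        for g :: "'v \<times> 'w \<Rightarrow> 'b::ab_group_add" and G :: "mdeg \<Rightarrow> 'b set" and q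
      proof (rule decomposesI[of "(\<lambda>d i. d (Suc i)) ` {d. f d \<noteq> 0}", OF _ G])
        let ?t = "\<lambda>(d :: mdeg) i. d (Suc i)"
        show "g (f (dcons q x)) = 0" if "x \<notin> ?t ` {d. f d \<noteq> 0}" for x
        proof (rule ccontr)
          assume "g (f (dcons q x)) \<noteq> 0"
          then have "dcons q x \<in> {d. f d \<noteq> 0}" using g(1) by force
          from imageI[OF this, of ?t] that show False by simp
        qed
        have gs: "g (\<Sum>d\<in>A. f d) = (\<Sum>d\<in>A. g (f d))" for A
          by (induction A rule: infinite_finite_induct) (simp_all add: g)
        have "0 = (\<Sum>d | f d \<noteq> 0. g (f d))" using arg_cong[OF s, of g] by (simp add: gs g)
        also have "\<dots> = (\<Sum>d\<in>dcons q ` ?t ` {d. f d \<noteq> 0}. g (f d))"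
        proof (rule sum.mono_neutral_cong)
          fix d assume d: "d \<in> {d. f d \<noteq> 0} - dcons q ` ?t ` {d. f d \<noteq> 0}"
          have n: "d 0 \<noteq> q"
          proof
            assume "d 0 = q"
            then have "d = dcons q (?t d)" using dcons_eta[of d] by simp
            with d show False by blast
          qed
          from other[OF n, of "?t d"] show "g (f d) = 0" unfolding dcons_eta .
        qed (use fin g in auto)
        also have "\<dots> = (\<Sum>x\<in>?t ` {d. f d \<noteq> 0}. g (f (dcons q x)))"
          by (subst sum.reindex) (auto intro: inj_onI)
        finally show "0 = (\<Sum>x\<in>?t ` {d. f d \<noteq> 0}. g (f (dcons q x)))" .
      qed (use fin in simp)
      have pE: "f (dcons q x) \<in> (if q = 0 then gpart V x \<times> {0} else if q = 1 then {0} \<times> gpart W x else {(0, 0)})"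
        for q x using fE[of "dcons q x"] by (simp only: gpart_Egr)
      have fV: "decomposes (gpart V) 0 (\<lambda>x. fst (f (dcons 0 x)))"
      proof (rule fq)
        show "fst (f (dcons 0 x)) \<in> gpart V x" for x using pE[of 0 x] by auto
        show "fst (f (dcons p x)) = 0" if "p \<noteq> 0" for p x using pE[of p x] that by (auto split: if_splits)
      qed simp_all
      have fW: "decomposes (gpart W) 0 (\<lambda>x. snd (f (dcons 1 x)))"
      proof (rule fq)
        show "snd (f (dcons 1 x)) \<in> gpart W x" for x using pE[of 1 x] by auto
        show "snd (f (dcons p x)) = 0" if "p \<noteq> 1" for p x using pE[of p x] that by (auto split: if_splits)
      qed simp_all
      obtain q x where d: "d = dcons q x" by (rule dcons_cases)
      show "f d = 0"
        using fE[of d] direct_unique[OF V.direct_part fV, of x] direct_unique[OF W.direct_part fW, of x]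
        by (auto simp: d gpart_Egr zero_prod_def split: if_splits)
    qed (use sub E.subspace_0 E.subspace_diff in auto)
    ultimately show ?thesis using decomposes_unique by blast
  qed
  then show ?thesis
    unfolding graded_space_def using sub out E.vector_space_axioms by blast
qed

section \<open>Graded Lie algebras and modules from binary maps\<close>

context graded_vs
begin

lemma additive_eqI:
  fixes f g :: "'u \<Rightarrow> 'a::ab_group_add"
  assumes "\<And>v w. f (v + w) = f v + f w" "\<And>v w. g (v + w) = g v + g w"
    and "\<And>x v. v \<in> gpart U x \<Longrightarrow> f v = g v"
  shows "f v = g v"
  by (rule dsum_induct[OF direct_part part_dsum, where Q = "\<lambda>v. f v = g v"]) (simp_all add: assms)

lemma additive_eq2I:
  fixes f g :: "'u \<Rightarrow> 'u \<Rightarrow> 'a::ab_group_add"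
  assumes "\<And>v v' w. f (v + v') w = f v w + f v' w" "\<And>v w w'. f v (w + w') = f v w + f v w'"
    and "\<And>v v' w. g (v + v') w = g v w + g v' w" "\<And>v w w'. g v (w + w') = g v w + g v w'"
    and "\<And>x y v w. v \<in> gpart U x \<Longrightarrow> w \<in> gpart U y \<Longrightarrow> f v w = g v w"
  shows "f v w = g v w"
proof (rule additive_eqI[where f = "\<lambda>v. f v w" and g = "\<lambda>v. g v w"])
  fix x v assume v: "v \<in> gpart U x"
  show "f v w = g v w"
    by (rule additive_eqI) (use assms v in auto)
qed (use assms in auto)

lemma alt_binary_degree:
  assumes "K \<in> alt_maps U (k, \<kappa>)" "A \<in> gpart U a" "B \<in> gpart U b"
  shows "K [A, B] \<in> gpart U (a + b + \<kappa>)"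
proof -
  have "homs U [A, B] [a, b]" using assms by simp
  then have "K [A, B] \<in> gpart U (sum_list [a, b] + \<kappa>)"
    using alt_degree[OF assms(1)] unfolding has_degree_def by blast
  then show ?thesis by (simp only: sum_list.Cons sum_list.Nil add_0_right)
qed

lemma alt_binary_swap:
  assumes "K \<in> alt_maps U (k, \<kappa>)" "A \<in> gpart U a" "B \<in> gpart U b"
  shows "K [A, B] = signed (1 + pr a b) (K [B, A])"
  using alternating_swap[OF alt_alternating[OF assms(1)] assms(2,3), of "{}"] by simp

text \<open>
  The shuffle formula for \<open>i(K)K\<close> with a binary \<open>K\<close> that preserves degrees: the three terms of the Jacobi
  identity, one for each two-element subset.
\<close>

lemma ins_triple:
  assumes K: "K \<in> alt_maps U (1, 0)" and A: "A \<in> gpart U a" and B: "B \<in> gpart U b" and C: "C \<in> gpart U c"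
  shows "ins (1, 0) K (1, 0) K [A, B, C] =
    K [K [A, B], C] + signed (1 + pr b c) (K [K [A, C], B]) + signed (pr a b + pr a c) (K [K [B, C], A])"
proof -
  define X where "X i = (if i = 0 then A else if i = 1 then B else C)" for i :: int
  define x where "x i = (if i = 0 then a else if i = 1 then b else c)" for i :: int
  let ?T = "{0, 1, 2 :: int}"
  define f where "f S = signed (kinv (gdim U) x S (?T - S)) (K (K (args X S) # args X (?T - S)))" for S
  have vals: "X 0 = A" "X 1 = B" "X 2 = C" "x 0 = a" "x 1 = b" "x 2 = c" by (simp_all add: X_def x_def)
  have comp: "?T - {0, 1} = {2}" "?T - {0, 2} = {1}" "?T - {1, 2} = {0}" by auto
  have "ins (1, 0) K (1, 0) K (args X ?T) = signed (pr 0 0) (\<Sum>S\<in>Pow ?T. f S)"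
    unfolding f_def by (rule alt_insertion_family[OF K K]) (use A B C in \<open>auto simp: vals\<close>)
  also have "(\<Sum>S\<in>Pow ?T. f S) = (\<Sum>S\<in>{{0, 1}, {0, 2}, {1, 2}}. f S)"
  proof (rule sum.mono_neutral_right)
    show "\<forall>S\<in>Pow ?T - {{0, 1}, {0, 2}, {1, 2}}. f S = 0"
    proof
      fix S assume S: "S \<in> Pow ?T - {{0, 1}, {0, 2}, {1, 2}}"
      have "Pow ?T = {{}, {0}, {1}, {2}, {0, 1}, {0, 2}, {1, 2}, {0, 1, 2}}"
        unfolding Pow_insert Pow_empty by auto
      with S have "S \<in> {{}, {0}, {1}, {2}, {0, 1, 2}}" by blast
      then have "card S \<noteq> 2" by auto
      then have "K (args X S) = 0" by (intro alt_length[OF K]) simp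
      then show "f S = 0" using ml_zero[OF alt_multilinear[OF K], of "[]"] by (simp add: f_def)
    qed
  qed auto
  also have "\<dots> = f {0, 1} + (f {0, 2} + f {1, 2})"
  proof -
    have "{0, 1} \<noteq> {0, 2 :: int}" "{0, 1} \<noteq> {1, 2 :: int}" "{0, 2} \<noteq> {1, 2 :: int}"
      by (simp_all add: doubleton_eq_iff)
    then show ?thesis by simp
  qed
  also have "f {0, 1} = K [K [A, B], C]"
    unfolding f_def comp by (simp add: vals kinv_def)
  also have "f {0, 2} = signed (1 + pr b c) (K [K [A, C], B])"
    unfolding f_def comp by (simp add: vals kinv_def pairing_commute[of _ c b])
  also have "f {1, 2} = signed (pr a b + pr a c) (K [K [B, C], A])"
    unfolding f_def comp
    by (simp add: vals kinv_def, intro signed_cong) (simp add: pairing_commute[of _ c a] pairing_commute[of _ b a])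
  finally have "ins (1, 0) K (1, 0) K (args X ?T) = signed (pr 0 0) (K [K [A, B], C] +
    (signed (1 + pr b c) (K [K [A, C], B]) + signed (pr a b + pr a c) (K [K [B, C], A])))" .
  moreover have "args X ?T = [A, B, C]" by (simp add: vals)
  moreover have "signed (pr 0 0) v = v" for v :: 'u by simp
  ultimately show ?thesis by (simp only: add.assoc)
qed

lemma length_3_cases:
  assumes "length Xs = 3"
  obtains A B C where "Xs = [A, B, C]"
proof -
  from assms have "length Xs = Suc (Suc (Suc 0))" by simp
  then show thesis using that by (auto simp: length_Suc_conv)
qed

lemma odd_dsgn_binary: "odd (dsgn (1, 0) (1, 0))"
  by (simp add: dsgn_def)

lemma ins_zero_iff:
  assumes K: "K \<in> alt_maps U (1, 0)"
  shows "ins (1, 0) K (1, 0) K = 0 \<longleftrightarrow> (\<forall>a b c A B C. A \<in> gpart U a \<longrightarrow> B \<in> gpart U b \<longrightarrow> C \<in> gpart U c \<longrightarrow>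
    ins (1, 0) K (1, 0) K [A, B, C] = 0)" (is "?F = 0 \<longleftrightarrow> ?R")
proof
  assume R: ?R
  have "?F \<in> alt_maps U (2, 0)" using alt_insertion_alt[OF K K] by simp
  from alt_multilinear[OF this] have m: "multilinear U 3 ?F" by simp
  have "?F = (\<lambda>_. 0)"
  proof (rule multilinear_eqI[OF m multilinear_zero])
    fix Xs xs assume Xs: "homs U Xs xs" "length Xs = 3"
    from Xs(2) obtain A B C where "Xs = [A, B, C]" by (rule length_3_cases)
    then show "?F Xs = 0" using Xs R by (auto simp: list_all2_Cons1)
  qed
  then show "?F = 0" by (simp add: zero_fun_def)
qed simp

text \<open>
  Half of the self-bracket is the three-term sum above; moving the inner brackets to the second slot
  turns it into the Leibniz form of the Jacobi identity.
\<close>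

lemma graded_lie_algebra_of_alt:
  assumes K: "K \<in> alt_maps U (1, 0)" and 0: "nr K K = 0"
  shows "graded_lie_algebra U (\<lambda>A B. K [A, B])"
proof -
  note ml = alt_multilinear[OF K]
  have lin: "Vector_Spaces.linear (gscale U) (gscale U) (\<lambda>Y. K [X, Y])"
    "Vector_Spaces.linear (gscale U) (gscale U) (\<lambda>Y. K [Y, X])" for X
    using ml_add[OF ml, of "[X]" _ _ "[]"] ml_scale[OF ml, of "[X]" _ _ "[]"]
      ml_add[OF ml, of "[]" _ _ "[X]"] ml_scale[OF ml, of "[]" _ _ "[X]"]
    by (simp_all add: linear_iff_UU)
  have deg: "K [X, Y] \<in> gpart U (x + y)" if "X \<in> gpart U x" "Y \<in> gpart U y" for x y X Y
    using alt_binary_degree[OF K that] by (simp only: add_0_right)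
  have anti: "K [X, Y] = - gscale U ((-1) powi pr x y) (K [Y, X])"
    if "X \<in> gpart U x" "Y \<in> gpart U y" for x y X Y
    using alt_binary_swap[OF K that] by (simp add: scale_sign signed_Suc)
  have F0: "ins (1, 0) K (1, 0) K = 0" using 0 nr_self[OF K odd_dsgn_binary] by simp
  have jac: "K [X, K [Y, Z]] = K [K [X, Y], Z] + gscale U ((-1) powi pr x y) (K [Y, K [X, Z]])"
    if h: "X \<in> gpart U x" "Y \<in> gpart U y" "Z \<in> gpart U z" for x y z X Y Z
  proof -
    have "ins (1, 0) K (1, 0) K [X, Y, Z] = 0" unfolding F0 by simp
    then have "K [K [X, Y], Z] + signed (1 + pr y z) (K [K [X, Z], Y]) + signed (pr x y + pr x z) (K [K [Y, Z], X]) = 0"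
      unfolding ins_triple[OF K h] .
    moreover have "K [K [X, Z], Y] = signed (1 + pr (x + z) y) (K [Y, K [X, Z]])"
      by (rule alt_binary_swap[OF K deg[OF h(1,3)] h(2)])
    moreover have "K [K [Y, Z], X] = signed (1 + pr (y + z) x) (K [X, K [Y, Z]])"
      by (rule alt_binary_swap[OF K deg[OF h(2,3)] h(1)])
    ultimately have "K [K [X, Y], Z] + signed (1 + pr y z + (1 + pr (x + z) y)) (K [Y, K [X, Z]])
        + signed (pr x y + pr x z + (1 + pr (y + z) x)) (K [X, K [Y, Z]]) = 0"
      by (simp only: signed_signed)
    moreover have "signed (1 + pr y z + (1 + pr (x + z) y)) (K [Y, K [X, Z]]) = signed (pr x y) (K [Y, K [X, Z]])"
      by (rule signed_cong) (simp add: pairing_simps pairing_commute[of _ z y])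
    moreover have "signed (pr x y + pr x z + (1 + pr (y + z) x)) (K [X, K [Y, Z]]) = - K [X, K [Y, Z]]"
      unfolding signed_def by (simp add: pairing_simps pairing_commute[of _ z x] pairing_commute[of _ y x])
    ultimately have "K [K [X, Y], Z] + signed (pr x y) (K [Y, K [X, Z]]) + - K [X, K [Y, Z]] = 0" by metis
    then show ?thesis by (simp add: scale_sign algebra_simps)
  qed
  show ?thesis unfolding graded_lie_algebra_def using graded lin deg anti jac by blast
qed

text \<open>
  On a homogeneous element the values of the components lie in different parts, so they vanish
  separately.
\<close>

lemma direct_End_part: "direct (End_part U)"
  unfolding direct_def
proof (intro conjI allI impI ballI)
  fix f and d :: mdeg assume f: "decomposes (End_part U) 0 f"
  have fin: "finite {d. f d \<noteq> 0}" and fE: "\<And>d. f d \<in> End_part U d" and s: "0 = (\<Sum>d | f d \<noteq> 0. f d)"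
    using f unfolding decomposes_def by auto
  show "f d = 0"
  proof
    fix v
    show "f d v = 0 v"
    proof (rule additive_eqI[where f = "f d" and g = "0"])
      fix y v assume v: "v \<in> gpart U y"
      let ?D = "{d. f d \<noteq> 0}"
      have "decomposes (gpart U) 0 (\<lambda>e. f (e - y) v)"
      proof (rule decomposesI[of "(\<lambda>d. y + d) ` ?D"])
        show "f (e - y) v \<in> gpart U e" for e
        proof -
          have "f (e - y) v \<in> gpart U (y + (e - y))" using fE[of "e - y"] v unfolding End_part_def by blast
          then show ?thesis by simp
        qed
        show "f (e - y) v = 0" if "e \<notin> (\<lambda>d. y + d) ` ?D" for e
        proof (rule ccontr)
          assume "f (e - y) v \<noteq> 0"
          then have "e - y \<in> ?D" by auto
          from imageI[OF this, of "\<lambda>d. y + d"] that show False by simp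
        qed
        have "0 = (\<Sum>d\<in>?D. f d v)" using fun_cong[OF s, of v] by (simp add: sum_fun_apply)
        also have "\<dots> = (\<Sum>e\<in>(\<lambda>d. y + d) ` ?D. f (e - y) v)"
          by (subst sum.reindex) (auto intro: inj_onI)
        finally show "0 = \<dots>" .
      qed (use fin in auto)
      from direct_unique[OF direct_part this, of "y + d"] show "f d v = 0 v" by simp
    qed (use fE[of d] in \<open>auto simp: End_part_def linear_iff_UU\<close>)
  qed
qed (auto simp: End_part_def linear_iff_UU part_zero vs.scale_right_diff_distrib intro!: part_diff, blast+)

definition comm_hom where
  "comm_hom \<delta>1 D1 \<delta>2 D2 = (\<lambda>Y. D1 (D2 Y) - gscale U ((-1) powi pr \<delta>1 \<delta>2) (D2 (D1 Y)))"

lemma gcomm_eq: "gcomm U = bilinear_ext (End_part U) (End_part U) comm_hom"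
  by (intro ext) (simp add: gcomm_def bilinear_ext_def comm_hom_def)

lemma biadditive_comm_hom: "biadditive (End_part U) (End_part U) comm_hom"
  unfolding biadditive_def comm_hom_def
  by (auto simp: fun_eq_iff End_part_def linear_iff_UU vs.scale_right_distrib)

lemma gcomm_homogeneous:
  assumes "D1 \<in> End_part U \<delta>1" "D2 \<in> End_part U \<delta>2"
  shows "gcomm U D1 D2 Y = D1 (D2 Y) - signed (pr \<delta>1 \<delta>2) (D2 (D1 Y))"
  unfolding gcomm_eq
  by (subst bilinear_ext_homogeneous[OF direct_End_part direct_End_part biadditive_comm_hom, OF assms])
     (simp add: comm_hom_def scale_sign)

lemma gcomm_add:
  assumes "D1 \<in> dsum (End_part U)" "D1' \<in> dsum (End_part U)" "D2 \<in> dsum (End_part U)" "D2' \<in> dsum (End_part U)"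
  shows "gcomm U (D1 + D1') D2 = gcomm U D1 D2 + gcomm U D1' D2"
    and "gcomm U D1 (D2 + D2') = gcomm U D1 D2 + gcomm U D1 D2'"
  unfolding gcomm_eq
  using bilinear_ext_add[OF direct_End_part direct_End_part biadditive_comm_hom assms] by simp_all

end

section \<open>Binary maps on \<open>E\<close>: brackets and actions\<close>

lemma inV_add: "(inV (v + v') :: 'v::ab_group_add \<times> 'w::ab_group_add) = inV v + inV v'"
  and inV_minus: "(inV (- v) :: 'v \<times> 'w) = - inV v"
  by (simp_all add: inV_def zero_prod_def)

lemma inW_add: "(inW (w + w') :: 'v::ab_group_add \<times> 'w::ab_group_add) = inW w + inW w'"
  and inW_zero [simp]: "(inW 0 :: 'v \<times> 'w) = 0"
  and inW_diff: "(inW (w - w') :: 'v \<times> 'w) = inW w - inW w'"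
  and inW_minus: "(inW (- w) :: 'v \<times> 'w) = - inW w"
  by (simp_all add: inW_def zero_prod_def)

lemma inV_signed: "(inV (signed a v) :: 'v::ab_group_add \<times> 'w::ab_group_add) = signed a (inV v)"
  and inW_signed: "(inW (signed a w) :: 'v \<times> 'w) = signed a (inW w)"
  by (simp_all add: signed_def inV_minus inW_minus)

lemma fst_inV [simp]: "fst (inV v) = v" and snd_inV [simp]: "snd (inV v) = 0"
  and fst_inW [simp]: "fst (inW w) = 0" and snd_inW [simp]: "snd (inW w) = w"
  by (simp_all add: inV_def inW_def)

lemma inV_eq_0 [simp]: "inV v = 0 \<longleftrightarrow> v = 0" and inW_eq_0 [simp]: "inW w = 0 \<longleftrightarrow> w = 0"
  by (simp_all add: inV_def inW_def zero_prod_def)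

lemma inW_sum: "(inW (\<Sum>i\<in>I. f i) :: 'v::ab_group_add \<times> 'w::ab_group_add) = (\<Sum>i\<in>I. inW (f i))"
  by (induction I rule: infinite_finite_induct) (simp_all add: inW_add)

lemma has_degreeD: "has_degree U \<kappa> K \<Longrightarrow> homs U Xs xs \<Longrightarrow> K Xs \<in> gpart U (sum_list xs + \<kappa>)"
  unfolding has_degree_def by (elim allE impE)

text \<open>
  On arguments from \<open>V\<close> the Koszul signs of \<open>E\<close> and of \<open>V\<close> agree, since their first degree is zero.
\<close>

lemma kexp_dcons:
  assumes "\<sigma> permutes {..<length xs}"
  shows "kexp (Suc n) \<sigma> (map (dcons 0) xs) = kexp n \<sigma> xs"
proof -
  have "\<sigma> i < length xs" if "i < length xs" for i using permutes_in_image[OF assms, of i] that by simp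
  then show ?thesis
    unfolding kexp_def by (intro sum.cong) (auto simp: pairing_dcons)
qed

locale graded_pair = V: graded_vs V + W: graded_vs W
  for V :: "('k::field_char_0, 'v::ab_group_add) gspace" and W :: "('k, 'w::ab_group_add) gspace" +
  assumes dims: "gdim W = gdim V"
begin

abbreviation E where "E \<equiv> Egr V W"

sublocale E: graded_vs "Egr V W"
  by unfold_locales (rule graded_Egr[OF V.graded W.graded dims])

lemma gscale_inV: "gscale E a (inV v) = inV (gscale V a v)"
  and gscale_inW: "gscale E a (inW w) = inW (gscale W a w)"
  by (simp_all add: inV_def inW_def gscale_Egr)

lemma fst_gscale: "fst (gscale E a e) = gscale V a (fst e)"
  and snd_gscale: "snd (gscale E a e) = gscale W a (snd e)"
  by (cases e; simp add: gscale_Egr)+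

lemma inV_part: "v \<in> gpart V x \<Longrightarrow> inV v \<in> gpart E (dcons 0 x)"
  by (simp add: gpart_Egr inV_def)

lemma inW_part: "w \<in> gpart W x \<Longrightarrow> inW w \<in> gpart E (dcons 1 x)"
  by (simp add: gpart_Egr inW_def)

lemma part_0D: "e \<in> gpart E (dcons 0 x) \<Longrightarrow> e = inV (fst e) \<and> fst e \<in> gpart V x"
  by (auto simp: gpart_Egr inV_def)

lemma part_1D: "e \<in> gpart E (dcons 1 x) \<Longrightarrow> e = inW (snd e) \<and> snd e \<in> gpart W x"
  by (auto simp: gpart_Egr inW_def)

lemma part_otherD: "e \<in> gpart E (dcons q x) \<Longrightarrow> q \<noteq> 0 \<Longrightarrow> q \<noteq> 1 \<Longrightarrow> e = 0"
  by (simp add: gpart_Egr zero_prod_def)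

lemma homs_inV: "homs V Xs xs \<Longrightarrow> homs E (map inV Xs) (map (dcons 0) xs)"
  by (auto simp: list_all2_conv_all_nth inV_part)

end

locale binary_on_E = graded_pair V W
  for V :: "('k::field_char_0, 'v::ab_group_add) gspace" and W :: "('k, 'w::ab_group_add) gspace" +
  fixes P :: "('v \<times> 'w) list \<Rightarrow> 'v \<times> 'w"
  assumes P: "P \<in> alt_maps (Egr V W) (1, 0)"
begin

abbreviation \<mu> where "\<mu> \<equiv> mult_of P"
abbreviation \<pi> where "\<pi> \<equiv> act_of P"

lemma P_multilinear: "multilinear E 2 P"
  using E.alt_multilinear[OF P] by simp

lemmas P_add1 = E.ml_add[OF P_multilinear, of "[]" _ _ "[_]", simplified]
  and P_add2 = E.ml_add[OF P_multilinear, of "[_]" _ _ "[]", simplified]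
  and P_scale1 = E.ml_scale[OF P_multilinear, of "[]" _ _ "[_]", simplified]
  and P_scale2 = E.ml_scale[OF P_multilinear, of "[_]" _ _ "[]", simplified]

text \<open>
  The degree of \<open>P\<close> forces two arguments from \<open>V\<close> to have a value in \<open>V\<close>; both components are biadditive,
  so this passes from homogeneous arguments to all.
\<close>

lemma P_VV: "P [inV X1, inV X2] = inV (\<mu> [X1, X2])"
proof -
  have "snd (P [inV X1, inV X2]) = 0"
  proof (rule V.additive_eq2I[where f = "\<lambda>X1 X2. snd (P [inV X1, inV X2])" and g = "\<lambda>_ _. 0"])
    fix x y v w assume "v \<in> gpart V x" "w \<in> gpart V y"
    from E.alt_binary_degree[OF P inV_part[OF this(1)] inV_part[OF this(2)]]
    have "P [inV v, inV w] \<in> gpart E (dcons 0 (x + y))" by (simp only: dcons_add add_0_right)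
    then show "snd (P [inV v, inV w]) = 0" using part_0D by (metis snd_inV)
  qed (simp_all add: inV_add P_add1 P_add2)
  then show ?thesis by (auto simp: mult_of_def inV_def intro: prod_eqI)
qed

lemma P_VW: "P [inV X, inW Y] = inW (\<pi> X Y)"
proof -
  have "fst (P [inV X, inW Y]) = 0"
  proof (rule V.additive_eqI[where f = "\<lambda>X. fst (P [inV X, inW Y])" and g = "\<lambda>_. 0"])
    fix x X assume X: "X \<in> gpart V x"
    show "fst (P [inV X, inW Y]) = 0"
    proof (rule W.additive_eqI[where f = "\<lambda>Y. fst (P [inV X, inW Y])" and g = "\<lambda>_. 0"])
      fix y Y assume "Y \<in> gpart W y"
      from E.alt_binary_degree[OF P inV_part[OF X] inW_part[OF this]]
      have "P [inV X, inW Y] \<in> gpart E (dcons 1 (x + y))" by (simp only: dcons_add add_0_right add_0)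
      then show "fst (P [inV X, inW Y]) = 0" using part_1D by (metis fst_inW)
    qed (simp_all add: inW_add P_add2)
  qed (simp_all add: inV_add P_add1)
  then show ?thesis by (auto simp: act_of_def inW_def intro: prod_eqI)
qed

lemma \<mu>_add: "\<mu> [X + X', Y] = \<mu> [X, Y] + \<mu> [X', Y]" "\<mu> [X, Y + Y'] = \<mu> [X, Y] + \<mu> [X, Y']"
  by (simp_all add: mult_of_def inV_add P_add1 P_add2)

lemma \<pi>_add: "\<pi> (X + X') Y = \<pi> X Y + \<pi> X' Y" "\<pi> X (Y + Y') = \<pi> X Y + \<pi> X Y'"
  by (simp_all add: act_of_def inV_add inW_add P_add1 P_add2)

lemma \<pi>_scale: "\<pi> (gscale V a X) Y = gscale W a (\<pi> X Y)" "\<pi> X (gscale W a Y) = gscale W a (\<pi> X Y)"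
  by (simp_all add: act_of_def P_scale1 P_scale2 snd_gscale flip: gscale_inV gscale_inW)

lemma \<pi>_degree: 
  assumes "X \<in> gpart V x" "Y \<in> gpart W y"
  shows "\<pi> X Y \<in> gpart W (x + y)"
proof -
  from E.alt_binary_degree[OF P inV_part[OF assms(1)] inW_part[OF assms(2)]]
  have "P [inV X, inW Y] \<in> gpart E (dcons 1 (x + y))" by (simp only: dcons_add add_0_right add_0)
  then show ?thesis using part_1D unfolding P_VW by (metis snd_inW)
qed

lemma \<mu>_alt: "\<mu> \<in> alt_maps V (1, 0)"
proof -
  have "multilinear V 2 \<mu>"
  proof (rule V.multilinearI)
    fix Xs :: "'v list" assume "length Xs \<noteq> 2"
    then show "\<mu> Xs = 0" by (simp add: mult_of_def E.ml_length[OF P_multilinear])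
  next
    fix A B :: "'v list" and v w a
    show "\<mu> (A @ (v + w) # B) = \<mu> (A @ v # B) + \<mu> (A @ w # B)"
      by (simp add: mult_of_def inV_add E.ml_add[OF P_multilinear])
    show "\<mu> (A @ gscale V a v # B) = gscale V a (\<mu> (A @ v # B))"
      by (simp add: mult_of_def E.ml_scale[OF P_multilinear] fst_gscale flip: gscale_inV)
  qed
  moreover have "has_degree V 0 \<mu>"
    unfolding has_degree_def
  proof (intro allI impI)
    fix Xs xs assume "homs V Xs xs"
    from homs_inV[OF this] have "P (map inV Xs) \<in> gpart E (sum_list (map (dcons 0) xs) + 0)"
      using E.alt_degree[OF P] unfolding has_degree_def by blast
    then have "P (map inV Xs) \<in> gpart E (dcons 0 (sum_list xs))" by (simp only: sum_list_dcons add_0_right)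
    from part_0D[OF this] show "\<mu> Xs \<in> gpart V (sum_list xs + 0)" unfolding mult_of_def add_0_right by (rule conjunct2)
  qed
  moreover have "alternating V \<mu>"
    unfolding alternating_def
  proof (intro allI impI)
    fix Xs xs \<sigma> assume Xs: "homs V Xs xs" and \<sigma>: "\<sigma> permutes {..<length Xs}"
    have len: "length Xs = length xs" using Xs by (rule list_all2_lengthD)
    have "P (permute_list \<sigma> (map inV Xs)) = signed (kexp (gdim E) \<sigma> (map (dcons 0) xs)) (P (map inV Xs))"
      using E.alt_alternating[OF P] homs_inV[OF Xs] \<sigma> unfolding alternating_def by simp
    then show "\<mu> (permute_list \<sigma> Xs) = signed (kexp (gdim V) \<sigma> xs) (\<mu> Xs)"
      using \<sigma> kexp_dcons[of \<sigma> xs] len by (simp add: mult_of_def permute_list_map)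
  qed
  ultimately show ?thesis by (simp add: V.alt_maps_iff)
qed

lemma \<mu>_degree: "X \<in> gpart V x \<Longrightarrow> Y \<in> gpart V y \<Longrightarrow> \<mu> [X, Y] \<in> gpart V (x + y)"
  using V.alt_binary_degree[OF \<mu>_alt] by (simp only: add_0_right) 

lemma P_WV:
  assumes "X \<in> gpart V x" "Y \<in> gpart W y"
  shows "P [inW Y, inV X] = signed (1 + V.pr y x) (inW (\<pi> X Y))"
  using E.alt_binary_swap[OF P inW_part[OF assms(2)] inV_part[OF assms(1)]]
  by (simp add: P_VW pairing_dcons)

abbreviation F where "F \<equiv> E.ins (1, 0) P (1, 0) P"

lemma F_alt: "F \<in> alt_maps E (2, 0)"
  using E.alt_insertion_alt[OF P P] by simp

lemma F_VVV:
  assumes h: "A \<in> gpart V a" "B \<in> gpart V b" "C \<in> gpart V c"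
  shows "F [inV A, inV B, inV C] = inV (V.ins (1, 0) \<mu> (1, 0) \<mu> [A, B, C])"
  unfolding E.ins_triple[OF P inV_part[OF h(1)] inV_part[OF h(2)] inV_part[OF h(3)]]
    V.ins_triple[OF \<mu>_alt h]
  by (simp add: P_VV inV_add inV_signed pairing_dcons)

text \<open>
  The terms of \<open>i(P)P\<close> in which the value of \<open>P\<close> in \<open>W\<close> stands in the first slot have to be rewritten by
  symmetry, and this produces the two terms of the commutator.
\<close>

lemma F_VVW:
  assumes h: "A \<in> gpart V a" "B \<in> gpart V b" "Y \<in> gpart W y"
  shows "F [inV A, inV B, inW Y] =
    inW (\<pi> (\<mu> [A, B]) Y - (\<pi> A (\<pi> B Y) - signed (V.pr a b) (\<pi> B (\<pi> A Y))))"
proof -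
  have 1: "signed (1 + V.pr b y) (P [inW (\<pi> A Y), inV B]) = inW (signed (V.pr a b) (\<pi> B (\<pi> A Y)))"
    unfolding P_WV[OF h(2) \<pi>_degree[OF h(1,3)]] inW_signed signed_signed
    by (rule signed_cong) (simp add: pairing_simps pairing_commute[of _ y b])
  have 2: "signed (V.pr a b + V.pr a y) (P [inW (\<pi> B Y), inV A]) = - inW (\<pi> A (\<pi> B Y))"
    unfolding P_WV[OF h(1) \<pi>_degree[OF h(2,3)]] signed_signed
    by (simp add: signed_def pairing_simps pairing_commute[of _ y a] pairing_commute[of _ b a])
  have "F [inV A, inV B, inW Y] = inW (\<pi> (\<mu> [A, B]) Y) + signed (1 + V.pr b y) (P [inW (\<pi> A Y), inV B])
      + signed (V.pr a b + V.pr a y) (P [inW (\<pi> B Y), inV A])"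
    unfolding E.ins_triple[OF P inV_part[OF h(1)] inV_part[OF h(2)] inW_part[OF h(3)]]
    by (simp add: P_VV P_VW pairing_dcons)
  then show ?thesis unfolding 1 2 by (simp add: inW_diff inW_signed)
qed

lemma alternating_zero_perm:
  assumes "alternating E K" "homs E Xs xs" "mset Ys = mset Xs" "K Ys = 0"
  shows "K Xs = 0"
proof -
  obtain \<sigma> where "\<sigma> permutes {..<length Xs}" "permute_list \<sigma> Xs = Ys"
    by (rule mset_eq_permutation[OF assms(3)])
  then have "K Ys = signed (kexp (gdim E) \<sigma> xs) (K Xs)"
    using assms(1,2) unfolding alternating_def by metis
  with assms(4) show ?thesis by (metis signed_eq_0_iff)
qed

text \<open>
  With two or more arguments from \<open>W\<close> the value of \<open>i(P)P\<close> would have degree at least \<open>2\<close> in the first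
  component, where \<open>E\<close> is zero. By symmetry, a single argument from \<open>W\<close> may be moved to the last place.
\<close>

lemma F_zero_iff:
  "F = 0 \<longleftrightarrow> (\<forall>a b c A B C. A \<in> gpart V a \<longrightarrow> B \<in> gpart V b \<longrightarrow> C \<in> gpart V c \<longrightarrow> F [inV A, inV B, inV C] = 0) \<and>
    (\<forall>a b y A B Y. A \<in> gpart V a \<longrightarrow> B \<in> gpart V b \<longrightarrow> Y \<in> gpart W y \<longrightarrow> F [inV A, inV B, inW Y] = 0)"
  (is "_ \<longleftrightarrow> ?R1 \<and> ?R2")
proof
  assume R: "?R1 \<and> ?R2"
  note R1 = conjunct1[OF R, rule_format] and R2 = conjunct2[OF R, rule_format]
  show "F = 0"
    unfolding E.ins_zero_iff[OF P]
  proof (intro allI impI)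
    fix d1 d2 d3 e1 e2 e3
    assume e: "e1 \<in> gpart E d1" "e2 \<in> gpart E d2" "e3 \<in> gpart E d3"
    obtain p x q y r z where d: "d1 = dcons p x" "d2 = dcons q y" "d3 = dcons r z"
      by (metis dcons_cases)
    note e = e[unfolded d]
    have h: "homs E [e1, e2, e3] [dcons p x, dcons q y, dcons r z]" using e by simp
    have "F [e1, e2, e3] \<in> gpart E (sum_list [dcons p x, dcons q y, dcons r z] + 0)"
      by (rule has_degreeD[OF E.alt_degree[OF F_alt] h])
    then have deg: "F [e1, e2, e3] \<in> gpart E (dcons (p + (q + r)) (x + (y + z)))"
      by (simp only: sum_list.Cons sum_list.Nil dcons_add add_0_right)
    show "F [e1, e2, e3] = 0"
    proof (cases "p \<in> {0, 1} \<and> q \<in> {0, 1} \<and> r \<in> {0, 1}")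
      case False
      then have "e1 = 0 \<or> e2 = 0 \<or> e3 = 0"
        using part_otherD[OF e(1)] part_otherD[OF e(2)] part_otherD[OF e(3)] by auto
      then show ?thesis by (intro E.ml_zero_set[OF E.alt_multilinear[OF F_alt]]) auto
    next
      case True
      have "p + (q + r) \<ge> 2 \<or> (p = 0 \<and> q = 0 \<and> r = 0) \<or> (p = 0 \<and> q = 0 \<and> r = 1)
          \<or> (p = 0 \<and> q = 1 \<and> r = 0) \<or> (p = 1 \<and> q = 0 \<and> r = 0)"
        using True by auto
      then consider "p + (q + r) \<ge> 2" | "p = 0" "q = 0" "r = 0" | "p = 0" "q = 0" "r = 1"
        | "p = 0" "q = 1" "r = 0" | "p = 1" "q = 0" "r = 0"
        by (elim disjE conjE)
      then show ?thesis
      proof cases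
        case 1
        then show ?thesis using part_otherD[OF deg] by simp
      next
        case 2
        then have "e1 \<in> gpart E (dcons 0 x)" "e2 \<in> gpart E (dcons 0 y)" "e3 \<in> gpart E (dcons 0 z)"
          using e by simp_all
        note h = part_0D[OF this(1)] part_0D[OF this(2)] part_0D[OF this(3)]
        have "F [inV (fst e1), inV (fst e2), inV (fst e3)] = 0"
          by (rule R1[OF conjunct2[OF h(1)] conjunct2[OF h(2)] conjunct2[OF h(3)]])
        then show ?thesis by (simp only: flip: conjunct1[OF h(1)] conjunct1[OF h(2)] conjunct1[OF h(3)])
      next
        case 3
        then have "e1 \<in> gpart E (dcons 0 x)" "e2 \<in> gpart E (dcons 0 y)" "e3 \<in> gpart E (dcons 1 z)"
          using e by simp_all
        note h = part_0D[OF this(1)] part_0D[OF this(2)] part_1D[OF this(3)]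
        have "F [inV (fst e1), inV (fst e2), inW (snd e3)] = 0"
          by (rule R2[OF conjunct2[OF h(1)] conjunct2[OF h(2)] conjunct2[OF h(3)]])
        then show ?thesis by (simp only: flip: conjunct1[OF h(1)] conjunct1[OF h(2)] conjunct1[OF h(3)])
      next
        case 4
        then have "e1 \<in> gpart E (dcons 0 x)" "e3 \<in> gpart E (dcons 0 z)" "e2 \<in> gpart E (dcons 1 y)"
          using e by simp_all
        note h' = part_0D[OF this(1)] part_0D[OF this(2)] part_1D[OF this(3)]
        have "F [inV (fst e1), inV (fst e3), inW (snd e2)] = 0"
          by (rule R2[OF conjunct2[OF h'(1)] conjunct2[OF h'(2)] conjunct2[OF h'(3)]])
        then have "F [e1, e3, e2] = 0"
          by (simp only: flip: conjunct1[OF h'(1)] conjunct1[OF h'(2)] conjunct1[OF h'(3)])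
        then show ?thesis by (rule alternating_zero_perm[OF E.alt_alternating[OF F_alt] h, rotated]) simp
      next
        case 5
        then have "e2 \<in> gpart E (dcons 0 y)" "e3 \<in> gpart E (dcons 0 z)" "e1 \<in> gpart E (dcons 1 x)"
          using e by simp_all
        note h' = part_0D[OF this(1)] part_0D[OF this(2)] part_1D[OF this(3)]
        have "F [inV (fst e2), inV (fst e3), inW (snd e1)] = 0"
          by (rule R2[OF conjunct2[OF h'(1)] conjunct2[OF h'(2)] conjunct2[OF h'(3)]])
        then have "F [e2, e3, e1] = 0"
          by (simp only: flip: conjunct1[OF h'(1)] conjunct1[OF h'(2)] conjunct1[OF h'(3)])
        then show ?thesis by (rule alternating_zero_perm[OF E.alt_alternating[OF F_alt] h, rotated]) simp
      qed
    qed
  qed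
qed simp

lemma \<pi>_End: "X \<in> gpart V x \<Longrightarrow> \<pi> X \<in> End_part W x"
  using \<pi>_degree[of X x] by (auto simp: End_part_def W.linear_iff_UU \<pi>_add \<pi>_scale add.commute)

lemma \<pi>_End_sum: "\<pi> X \<in> dsum (End_part W)"
proof (rule dsum_induct[OF V.direct_part V.part_dsum, where Q = "\<lambda>X. \<pi> X \<in> dsum (End_part W)"])
  show "\<pi> X \<in> dsum (End_part W)" if "X \<in> gpart V x" for x X
    by (rule in_dsum[OF W.direct_End_part, OF \<pi>_End[OF that]])
  show "\<pi> (X + X') \<in> dsum (End_part W)" if "\<pi> X \<in> dsum (End_part W)" "\<pi> X' \<in> dsum (End_part W)" for X X'
  proof -
    have "\<pi> (X + X') = \<pi> X + \<pi> X'" by (rule ext) (simp add: \<pi>_add)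
    then show ?thesis using dsum_add[OF W.direct_End_part that] by (simp only:)
  qed
qed

text \<open>
  Both sides of the module identity are additive in each argument, so homogeneous arguments suffice.
\<close>

lemma module_identity_iff:
  "(\<forall>X1 X2 Y. \<pi> (\<mu> [X1, X2]) Y = gcomm W (\<pi> X1) (\<pi> X2) Y) \<longleftrightarrow>
   (\<forall>a b y A B Y. A \<in> gpart V a \<longrightarrow> B \<in> gpart V b \<longrightarrow> Y \<in> gpart W y \<longrightarrow>
      \<pi> (\<mu> [A, B]) Y = \<pi> A (\<pi> B Y) - signed (V.pr a b) (\<pi> B (\<pi> A Y)))"
  (is "?L \<longleftrightarrow> ?R")
proof
  assume ?L
  then show ?R using W.gcomm_homogeneous[OF \<pi>_End \<pi>_End] by (simp add: dims)
next
  assume R: ?R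
  have "\<pi> (\<mu> [X1, X2]) Y = gcomm W (\<pi> X1) (\<pi> X2) Y" for X1 X2 Y
  proof (rule V.additive_eq2I[where f = "\<lambda>X1 X2. \<pi> (\<mu> [X1, X2]) Y" and g = "\<lambda>X1 X2. gcomm W (\<pi> X1) (\<pi> X2) Y"])
    fix X1 X1' X2 X2'
    have s: "\<pi> (X1 + X1') = \<pi> X1 + \<pi> X1'" for X1 X1' by (rule ext) (simp add: \<pi>_add)
    note ends = \<pi>_End_sum[of X1] \<pi>_End_sum[of X1'] \<pi>_End_sum[of X2] \<pi>_End_sum[of X2']
    show "gcomm W (\<pi> (X1 + X1')) (\<pi> X2) Y = gcomm W (\<pi> X1) (\<pi> X2) Y + gcomm W (\<pi> X1') (\<pi> X2) Y"
      unfolding s W.gcomm_add(1)[OF ends] by (rule plus_fun_apply)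
    show "gcomm W (\<pi> X1) (\<pi> (X2 + X2')) Y = gcomm W (\<pi> X1) (\<pi> X2) Y + gcomm W (\<pi> X1) (\<pi> X2') Y"
      unfolding s W.gcomm_add(2)[OF ends] by (rule plus_fun_apply)
  next
    fix a b A B assume h: "A \<in> gpart V a" "B \<in> gpart V b"
    show "\<pi> (\<mu> [A, B]) Y = gcomm W (\<pi> A) (\<pi> B) Y"
      unfolding W.gcomm_homogeneous[OF \<pi>_End[OF h(1)] \<pi>_End[OF h(2)]]
      by (rule W.additive_eqI) (use R h in \<open>auto simp: \<pi>_add signed_add dims\<close>)
  qed (simp_all add: \<mu>_add \<pi>_add)
  then show ?L by blast
qed

theorem self_bracket_zero_iff:
  "E.nr P P = 0 \<longleftrightarrow> V.nr \<mu> \<mu> = 0 \<and> (\<forall>X1 X2 Y. \<pi> (\<mu> [X1, X2]) Y = gcomm W (\<pi> X1) (\<pi> X2) Y)"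
  unfolding E.nr_self[OF P E.odd_dsgn_binary] V.nr_self[OF \<mu>_alt V.odd_dsgn_binary]
    F_zero_iff V.ins_zero_iff[OF \<mu>_alt] module_identity_iff
  using F_VVV F_VVW by (simp add: inV_eq_0 inW_eq_0 cong: conj_cong imp_cong)

theorem graded_lie_module_of_square_zero:
  assumes "E.nr P P = 0"
  shows "graded_lie_module V (\<lambda>X1 X2. \<mu> [X1, X2]) W \<pi>"
proof -
  have "Vector_Spaces.linear (gscale V) (gscale W) (\<lambda>X. \<pi> X Y)" for Y
    using \<pi>_add \<pi>_scale
    by (simp add: Vector_Spaces.linear_iff V.vs.vector_space_axioms W.vs.vector_space_axioms)
  then show ?thesis
    using assms self_bracket_zero_iff V.graded_lie_algebra_of_alt[OF \<mu>_alt] W.graded dims \<pi>_End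
    unfolding graded_lie_module_def by blast
qed

end

section \<open>The differential on cochains\<close>

lemma sum_dcons: "(\<Sum>b\<in>A. dcons 0 (f b)) = dcons 0 (\<Sum>b\<in>A. f b)"
proof (induction A rule: infinite_finite_induct)
  case (infinite A)
  show ?case unfolding sum.infinite[OF infinite] by (rule dcons_zero[symmetric])
next
  case empty
  show ?case unfolding sum.empty by (rule dcons_zero[symmetric])
next
  case (insert b A)
  then show ?case unfolding sum.insert[OF insert(1,2)] insert(3) dcons_add by (simp only: add_0)
qed

text \<open>
  Omitting arguments from a list is expressed by the complement of an index set, in order to match the
  shuffle formula.
\<close>

lemma nths_eq_map: "nths Xs I = map ((!) Xs) (filter (\<lambda>i. i \<in> I) [0..<length Xs])"
proof (induction Xs rule: rev_induct)
  case (snoc X Xs)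
  have "map ((!) (Xs @ [X])) (filter (\<lambda>i. i \<in> I) [0..<length Xs]) = map ((!) Xs) (filter (\<lambda>i. i \<in> I) [0..<length Xs])"
    by (rule map_cong) (auto simp: nth_append)
  with snoc show ?case by (simp add: nths_append)
qed simp

lemma nths_eq_args:
  "nths Xs (- A) = args (\<lambda>i. Xs ! nat i) (int ` ({..<length Xs} - A))"
proof -
  have "sorted (map int (filter (\<lambda>i. i \<notin> A) [0..<length Xs]))"
    using sorted_filter[of "\<lambda>i. i" "[0..<length Xs]" "\<lambda>i. i \<notin> A"]
    by (simp add: sorted_iff_nth_mono)
  then have "sorted_list_of_set (int ` ({..<length Xs} - A)) = map int (filter (\<lambda>i. i \<notin> A) [0..<length Xs])"
    by (intro sorted_distinct_set_unique) (auto simp: distinct_map)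
  then show ?thesis by (simp add: nths_eq_map comp_def)
qed

text \<open>
  The exponent \<open>\<alpha>\<^sub>i\<close> is the exponent of the sign of moving the \<open>i\<close>-th argument to the front.
\<close>

lemma alpha1_eq:
  assumes "i \<le> length xs"
  shows "alpha1 n xs i = (\<Sum>b<i. 1 + pairing n (xs ! i) (xs ! b))"
proof -
  have "sum_list (take i xs) = (\<Sum>b<i. xs ! b)"
    using assms by (simp add: sum_list_sum_nth atLeast0LessThan)
  then show ?thesis by (simp only: alpha1_def pairing_sum_right sum.distrib) simp
qed

lemma kinv_nat:
  assumes "finite B"
  shows "kinv (Suc n) (\<lambda>i. dcons 0 (xs ! nat i)) {int i} (int ` B) =
    (\<Sum>b\<in>B \<inter> {..<i}. 1 + pairing n (xs ! i) (xs ! b))"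
proof -
  have "kinv (Suc n) (\<lambda>i. dcons 0 (xs ! nat i)) {int i} (int ` B) =
      (\<Sum>b\<in>B. if b < i then 1 + pairing n (xs ! i) (xs ! b) else 0)"
    by (simp add: kinv_def sum.reindex pairing_dcons cong del: if_weak_cong)
  also have "\<dots> = (\<Sum>b\<in>B \<inter> {..<i}. 1 + pairing n (xs ! i) (xs ! b))"
    by (rule sum.mono_neutral_cong_right) (use assms in auto)
  finally show ?thesis .
qed

lemma sum_subsets_card_2:
  fixes f :: "int set \<Rightarrow> 'b::comm_monoid_add"
  assumes "\<And>S. card S \<noteq> 2 \<Longrightarrow> f S = 0"
  shows "(\<Sum>S\<in>Pow (int ` {..k}). f S) = (\<Sum>(i, j)\<in>{(i, j). i < j \<and> j \<le> k}. f {int i, int j})"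
proof -
  let ?D = "{(i, j). i < j \<and> j \<le> k}" and ?h = "\<lambda>(i, j). {int i, int j}"
  have inj: "inj_on ?h ?D" by (rule inj_onI) (auto simp: doubleton_eq_iff)
  have "(\<Sum>S\<in>?h ` ?D. f S) = (\<Sum>S\<in>Pow (int ` {..k}). f S)"
  proof (rule sum.mono_neutral_left)
    show "\<forall>S\<in>Pow (int ` {..k}) - ?h ` ?D. f S = 0"
    proof (intro ballI assms notI)
      fix S assume S: "S \<in> Pow (int ` {..k}) - ?h ` ?D" and "card S = 2"
      then obtain a b where ab: "S = {a, b}" "a \<noteq> b" by (auto simp: card_2_iff)
      with S obtain i j where ij: "a = int i" "b = int j" "i \<le> k" "j \<le> k" by auto
      have "S \<in> ?h ` ?D"
      proof (cases "i < j")
        case True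
        then show ?thesis using ab ij by (intro image_eqI[of _ _ "(i, j)"]) auto
      next
        case False
        then show ?thesis using ab ij by (intro image_eqI[of _ _ "(j, i)"]) auto
      qed
      with S show False by blast
    qed
  qed auto
  then show ?thesis unfolding sum.reindex[OF inj] by (simp add: case_prod_beta comp_def)
qed

lemma sum_subsets_co_singleton:
  fixes f :: "int set \<Rightarrow> 'b::comm_monoid_add"
  assumes "\<And>S. card S \<noteq> k \<Longrightarrow> f S = 0"
  shows "(\<Sum>S\<in>Pow (int ` {..k}). f S) = (\<Sum>i\<le>k. f (int ` ({..k} - {i})))"
proof -
  let ?h = "\<lambda>i. int ` ({..k} - {i})"
  have inj: "inj_on ?h {..k}"
  proof (rule inj_onI)
    fix i j assume ij: "i \<in> {..k}" "j \<in> {..k}" and "?h i = ?h j"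
    then have "{..k} - {i} = {..k} - {j}" by (simp add: inj_image_eq_iff)
    then show "i = j" using ij by blast
  qed
  have "(\<Sum>S\<in>?h ` {..k}. f S) = (\<Sum>S\<in>Pow (int ` {..k}). f S)"
  proof (rule sum.mono_neutral_left)
    show "\<forall>S\<in>Pow (int ` {..k}) - ?h ` {..k}. f S = 0"
    proof (intro ballI assms notI)
      fix S assume S: "S \<in> Pow (int ` {..k}) - ?h ` {..k}" and c: "card S = k"
      have "card (int ` {..k} - S) = 1"
        using S c by (subst card_Diff_subset) (auto simp: card_image intro: finite_subset)
      then obtain a where a: "int ` {..k} - S = {a}" by (rule card_1_singletonE)
      then obtain i where i: "a = int i" "i \<le> k" by blast
      have "S = int ` {..k} - {a}" using a S by blast
      also have "\<dots> = ?h i" by (auto simp: i)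
      finally show False using S i by blast
    qed
  qed auto
  then show ?thesis unfolding sum.reindex[OF inj] by (simp add: comp_def)
qed

context graded_pair
begin

lemma Lam_eq: "Lam V W (k, c) = alt_maps E (int k - 1, dcons 1 c)"
  by (simp add: Lam_def)

lemma direct_Lam: "direct (Lam V W)"
proof -
  have inj: "inj (\<lambda>(k :: nat, c). (int k - 1, dcons 1 c))" by (rule injI) auto
  have "Lam V W = (\<lambda>d. alt_maps E ((\<lambda>(k, c). (int k - 1, dcons 1 c)) d))"
    by (simp add: Lam_def fun_eq_iff split: prod.split)
  then show ?thesis using direct_reindex[OF E.direct_alt_maps inj] by simp
qed

lemmas Lambda_induct = dsum_induct[OF direct_Lam, consumes 1, case_names homogeneous add]
  and Lambda_induct2 = dsum_induct2[OF direct_Lam direct_Lam, consumes 2,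
      case_names homogeneous add_left add_right]

lemma Lam_alg: "C \<in> Lam V W d \<Longrightarrow> C \<in> alt_algebra E"
  by (cases d) (simp add: Lam_eq E.alt_alg)

lemma Lambda_subset: "Lambda V W \<subseteq> alt_algebra E"
  by (rule dsum_subset[OF direct_Lam E.direct_alt_maps]) (auto intro: Lam_alg)

lemma Lambda_alg: "C \<in> Lambda V W \<Longrightarrow> C \<in> alt_algebra E"
  using Lambda_subset by (rule subsetD)

lemma Lam_value:
  assumes C: "C \<in> Lam V W (k, c)" and Zs: "homs V Zs zs"
  shows "C (map inV Zs) = inW (cochain_eval C Zs)"
    and "cochain_eval C Zs \<in> gpart W (sum_list zs + c)"
proof -
  have "C (map inV Zs) \<in> gpart E (sum_list (map (dcons 0) zs) + dcons 1 c)"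
    by (rule has_degreeD[OF E.alt_degree[OF C[unfolded Lam_eq]] homs_inV[OF Zs]])
  then have "C (map inV Zs) \<in> gpart E (dcons 1 (sum_list zs + c))"
    by (simp only: sum_list_dcons dcons_add add_0)
  from part_1D[OF this] show "C (map inV Zs) = inW (cochain_eval C Zs)"
    "cochain_eval C Zs \<in> gpart W (sum_list zs + c)" unfolding cochain_eval_def by auto
qed

end

context binary_on_E
begin

lemma bd_eq: "bd V W P = E.nr P"
  by (simp add: bd_def fun_eq_iff)

lemma P_alg: "P \<in> alt_algebra E"
  by (rule E.alt_alg[OF P])

lemma bd_Lam:
  assumes "C \<in> Lam V W (k, c)"
  shows "bd V W P C \<in> Lam V W (Suc k, c)"
proof -
  have "bd V W P C \<in> alt_maps E ((1, 0) + (int k - 1, dcons 1 c))"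
    unfolding bd_eq by (rule E.nr_alt[OF P assms[unfolded Lam_eq]])
  then show ?thesis by (simp add: Lam_eq)
qed

lemma bd_Lambda: "C \<in> Lambda V W \<Longrightarrow> bd V W P C \<in> Lambda V W"
proof (induction rule: Lambda_induct)
  case (homogeneous d C)
  then show ?case by (cases d) (auto intro: in_dsum[OF direct_Lam, OF bd_Lam])
next
  case (add C C')
  then have "C \<in> alt_algebra E" "C' \<in> alt_algebra E" using Lambda_subset by auto
  from E.nr_add_right[OF P_alg this] add show ?case
    unfolding bd_eq by (simp only: dsum_add[OF direct_Lam])
qed

theorem bd_differential:
  assumes "E.nr P P = 0"
  shows "differential_on (map_scale E) (alt_algebra E) (bd V W P)"
  unfolding differential_on_def bd_eq
  using E.nr_alg[OF P_alg] E.nr_add_right[OF P_alg] E.nr_scale_right[OF P_alg]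
    E.nr_square_zero[OF P E.odd_dsgn_binary assms]
  by blast

text \<open>
  In \<open>i(P)C\<close> only the two-element subsets contribute and in \<open>i(C)P\<close> only the complements of points,
  since \<open>P\<close> is binary.
\<close>

theorem bd_formula:
  assumes C: "C \<in> Lam V W (k, c)" and len: "length Xs = Suc k" and Xs: "homs V Xs xs"
  shows "bd V W P C (map inV Xs) =
    inW (- ((\<Sum>i\<le>k. signed (alpha1 (gdim V) xs i + V.pr (xs ! i) c)
                (\<pi> (Xs ! i) (cochain_eval C (nths Xs (- {i})))))
          + (\<Sum>(i, j)\<in>{(i, j). i < j \<and> j \<le> k}. signed (alpha2 (gdim V) xs i j)
                (cochain_eval C (\<mu> [Xs ! i, Xs ! j] # nths Xs (- {i, j}))))))"
proof -
  let ?n = "gdim V" and ?T = "int ` {..k}" and ?Y = "\<lambda>i. Xs ! nat i" and ?y = "\<lambda>i. xs ! nat i"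
  let ?X = "\<lambda>i. inV (Xs ! nat i) :: 'v \<times> 'w" and ?x = "\<lambda>i. dcons 0 (xs ! nat i)"
  note C' = C[unfolded Lam_eq]
  have lx: "length xs = Suc k" using Xs len by (auto dest: list_all2_lengthD)
  have hY: "Xs ! i \<in> gpart V (xs ! i)" if "i \<le> k" for i
    using Xs len that by (auto simp: list_all2_conv_all_nth)
  have hX: "?X i \<in> gpart E (?x i)" if "i \<in> ?T" for i using that by (auto intro!: inV_part hY)
  have T: "finite ?T" "{..<Suc k} = {..k}" by auto
  have aT: "args ?X ?T = map inV Xs"
    using arg_cong[OF V.args_nth[of Xs], of "map inV :: _ \<Rightarrow> ('v \<times> 'w) list"]
    unfolding len T(2) map_map comp_def .
  have aX: "args ?X (int ` ({..k} - A)) = map inV (nths Xs (- A))" for A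
    by (simp add: nths_eq_args len T(2))
  have hN: "homs V (nths Xs (- A)) (nths xs (- A))" for A
  proof -
    have "homs V (args ?Y (int ` ({..k} - A))) (args ?y (int ` ({..k} - A)))"
      by (rule V.homs_map) (auto intro: hY)
    then show ?thesis by (simp add: nths_eq_args len lx T(2))
  qed
  have sN: "sum_list (nths xs (- {i})) = (\<Sum>b\<in>{..k} - {i}. xs ! b)" for i
  proof -
    have "sum_list (nths xs (- {i})) = (\<Sum>b\<in>int ` ({..k} - {i}). xs ! nat b)"
      unfolding nths_eq_args lx T(2) by (simp add: sum_list_distinct_conv_sum_set)
    also have "\<dots> = (\<Sum>b\<in>{..k} - {i}. xs ! b)" by (subst sum.reindex) (auto intro: inj_onI)
    finally show ?thesis .
  qed

  have first: "E.ins (1, 0) P (int k - 1, dcons 1 c) C (map inV Xs) =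
    - inW (\<Sum>(i, j)\<in>{(i, j). i < j \<and> j \<le> k}. signed (alpha2 ?n xs i j)
                (cochain_eval C (\<mu> [Xs ! i, Xs ! j] # nths Xs (- {i, j}))))"
  proof -
    define f where "f S = signed (kinv (gdim E) ?x S (?T - S)) (C (P (args ?X S) # args ?X (?T - S)))" for S
    have "E.ins (1, 0) P (int k - 1, dcons 1 c) C (args ?X ?T) = signed (E.pr 0 (dcons 1 c)) (\<Sum>S\<in>Pow ?T. f S)"
      unfolding f_def by (rule E.alt_insertion_family[OF P C' T(1) hX])
    also have "\<dots> = (\<Sum>S\<in>Pow ?T. f S)" by (simp only: pairing_zero signed_0)
    also have "\<dots> = (\<Sum>(i, j)\<in>{(i, j). i < j \<and> j \<le> k}. f {int i, int j})"
    proof (rule sum_subsets_card_2)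
      fix S :: "int set" assume "card S \<noteq> 2"
      then have "P (args ?X S) = 0" by (intro E.ml_length[OF P_multilinear]) simp
      then show "f S = 0" using E.ml_zero[OF E.alt_multilinear[OF C'], of "[]"] by (simp add: f_def)
    qed
    also have "\<dots> = (\<Sum>(i, j)\<in>{(i, j). i < j \<and> j \<le> k}. - inW (signed (alpha2 ?n xs i j)
                (cochain_eval C (\<mu> [Xs ! i, Xs ! j] # nths Xs (- {i, j})))))"
    proof (rule sum.cong[OF refl], clarify)
      fix i j assume ij: "i < j" "j \<le> k"
      have r: "?T - {int i, int j} = int ` ({..k} - {i, j})" by auto
      have "kinv (gdim E) ?x {int i, int j} (?T - {int i, int j})
          = kinv (gdim E) ?x {int i} (int ` ({..k} - {i, j})) + kinv (gdim E) ?x {int j} (int ` ({..k} - {i, j}))"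
        unfolding r by (rule kinv_insert_left) (use ij in auto)
      also have "kinv (gdim E) ?x {int i} (int ` ({..k} - {i, j})) = alpha1 ?n xs i"
        unfolding gdim_Egr using ij lx by (subst kinv_nat) (auto simp: alpha1_eq intro!: sum.cong)
      \<comment> \<open>\<open>\<alpha>\<^sub>j\<close> also counts the pair \<open>(i, j)\<close>, which keeps its order\<close>
      also have "kinv (gdim E) ?x {int j} (int ` ({..k} - {i, j})) = alpha1 ?n xs j - (1 + V.pr (xs ! j) (xs ! i))"
      proof -
        have "({..k} - {i, j}) \<inter> {..<j} = {..<j} - {i}" using ij by auto
        then show ?thesis
          unfolding gdim_Egr using ij lx by (subst kinv_nat) (auto simp: alpha1_eq sum_diff1)
      qed
      finally have sgn: "kinv (gdim E) ?x {int i, int j} (?T - {int i, int j})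
          = alpha1 ?n xs i + (alpha1 ?n xs j - (1 + V.pr (xs ! j) (xs ! i)))" .
      have "args ?X {int i, int j} = [inV (Xs ! i), inV (Xs ! j)]"
        using args_insert_below[of "{int j}" "int i" ?X] ij by simp
      then have "P (args ?X {int i, int j}) # args ?X (?T - {int i, int j})
          = map inV (\<mu> [Xs ! i, Xs ! j] # nths Xs (- {i, j}))"
        unfolding r aX by (simp add: P_VV)
      moreover have "homs V (\<mu> [Xs ! i, Xs ! j] # nths Xs (- {i, j})) ((xs ! i + xs ! j) # nths xs (- {i, j}))"
        using hN \<mu>_degree[OF hY hY, of i j] ij by simp
      ultimately have "f {int i, int j} = signed (alpha1 ?n xs i + (alpha1 ?n xs j - (1 + V.pr (xs ! j) (xs ! i))))
          (inW (cochain_eval C (\<mu> [Xs ! i, Xs ! j] # nths Xs (- {i, j}))))"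
        unfolding f_def sgn using Lam_value(1)[OF C] by metis
      also have "\<dots> = signed (1 + alpha2 ?n xs i j) (inW (cochain_eval C (\<mu> [Xs ! i, Xs ! j] # nths Xs (- {i, j}))))"
        by (rule signed_cong) (simp add: alpha2_def pairing_commute[of _ "xs ! j"])
      finally show "f {int i, int j} = - inW (signed (alpha2 ?n xs i j)
                (cochain_eval C (\<mu> [Xs ! i, Xs ! j] # nths Xs (- {i, j}))))"
        by (simp only: signed_Suc inW_signed)
    qed
    also have "\<dots> = - inW (\<Sum>(i, j)\<in>{(i, j). i < j \<and> j \<le> k}. signed (alpha2 ?n xs i j)
                (cochain_eval C (\<mu> [Xs ! i, Xs ! j] # nths Xs (- {i, j}))))"
      by (simp add: inW_sum sum_negf case_prod_beta)
    finally show ?thesis unfolding aT .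
  qed

  have second: "E.ins (int k - 1, dcons 1 c) C (1, 0) P (map inV Xs) =
    signed (1 + int k) (inW (\<Sum>i\<le>k. signed (alpha1 ?n xs i + V.pr (xs ! i) c)
                (\<pi> (Xs ! i) (cochain_eval C (nths Xs (- {i}))))))"
  proof -
    define f where "f S = signed (kinv (gdim E) ?x S (?T - S)) (P (C (args ?X S) # args ?X (?T - S)))" for S
    have "E.ins (int k - 1, dcons 1 c) C (1, 0) P (args ?X ?T) = signed (E.pr (dcons 1 c) 0) (\<Sum>S\<in>Pow ?T. f S)"
      unfolding f_def by (rule E.alt_insertion_family[OF C' P T(1) hX])
    also have "\<dots> = (\<Sum>S\<in>Pow ?T. f S)" by (simp only: pairing_zero signed_0)
    also have "\<dots> = (\<Sum>i\<le>k. f (int ` ({..k} - {i})))"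
    proof (rule sum_subsets_co_singleton)
      fix S :: "int set" assume "card S \<noteq> k"
      then have "C (args ?X S) = 0" by (intro E.alt_length[OF C']) simp
      then show "f S = 0" using E.ml_zero[OF P_multilinear, of "[]"] by (simp add: f_def)
    qed
    also have "\<dots> = (\<Sum>i\<le>k. signed (1 + int k) (inW (signed (alpha1 ?n xs i + V.pr (xs ! i) c)
                (\<pi> (Xs ! i) (cochain_eval C (nths Xs (- {i})))))))"
    proof (rule sum.cong[OF refl])
      fix i assume "i \<in> {..k}"
      then have i: "i \<le> k" by simp
      let ?R = "int ` ({..k} - {i})" and ?s = "\<Sum>b\<in>{..k} - {i}. xs ! b"
      have r: "?T - ?R = {int i}" using i by auto
      have Zv: "C (args ?X ?R) = inW (cochain_eval C (nths Xs (- {i})))"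
        "cochain_eval C (nths Xs (- {i})) \<in> gpart W (?s + c)"
        using Lam_value[OF C hN[of "{i}"]] unfolding aX sN by auto
      have "P (C (args ?X ?R) # args ?X (?T - ?R)) =
          signed (1 + V.pr (?s + c) (xs ! i)) (inW (\<pi> (Xs ! i) (cochain_eval C (nths Xs (- {i})))))"
        unfolding r Zv(1) using P_WV[OF hY[OF i] Zv(2)] by simp
      moreover have "kinv (gdim E) ?x ?R {int i} + kinv (gdim E) ?x {int i} ?R
          = int k + V.pr ?s (xs ! i)"
      proof -
        have "(\<Sum>a\<in>?R. ?x a) = dcons 0 ?s"
        proof -
          have "(\<Sum>a\<in>?R. ?x a) = (\<Sum>b\<in>{..k} - {i}. dcons 0 (xs ! b))"
            by (subst sum.reindex) (auto intro: inj_onI)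
          also have "\<dots> = dcons 0 ?s" by (rule sum_dcons)
          finally show ?thesis .
        qed
        moreover have "card ?R = k" using i by (subst card_image) auto
        moreover have "?R \<inter> {int i} = {}" by auto
        ultimately show ?thesis
          using kinv_swap[of ?R "{int i}" "gdim E" ?x] by (simp add: pairing_dcons)
      qed
      moreover have "kinv (gdim E) ?x {int i} ?R = alpha1 ?n xs i"
        unfolding gdim_Egr using i lx by (subst kinv_nat) (auto simp: alpha1_eq intro!: sum.cong)
      ultimately have "f ?R = signed (int k + V.pr ?s (xs ! i) - alpha1 ?n xs i)
          (signed (1 + V.pr (?s + c) (xs ! i)) (inW (\<pi> (Xs ! i) (cochain_eval C (nths Xs (- {i}))))))"
        unfolding f_def r by (metis add_diff_cancel_right')
      also have "\<dots> = signed (1 + int k) (inW (signed (alpha1 ?n xs i + V.pr (xs ! i) c)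
                (\<pi> (Xs ! i) (cochain_eval C (nths Xs (- {i}))))))"
        unfolding inW_signed signed_signed
        by (rule signed_cong) (simp add: pairing_add_left pairing_commute[of _ c])
      finally show "f ?R = \<dots>" .
    qed
    also have "\<dots> = signed (1 + int k) (inW (\<Sum>i\<le>k. signed (alpha1 ?n xs i + V.pr (xs ! i) c)
                (\<pi> (Xs ! i) (cochain_eval C (nths Xs (- {i}))))))"
      by (simp add: inW_sum signed_sum)
    finally show ?thesis unfolding aT .
  qed

  have "bd V W P C = E.brh (1, 0) P (int k - 1, dcons 1 c) C"
    unfolding bd_eq by (rule E.nr_homogeneous[OF P C'])
  also have "\<dots> = E.ins (1, 0) P (int k - 1, dcons 1 c) C
      - signed (int k - 1) (E.ins (int k - 1, dcons 1 c) C (1, 0) P)"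
    unfolding E.brh_eq by (simp only: E.dsgn_def fst_conv snd_conv pairing_zero mult_1 add_0_right)
  finally have "bd V W P C (map inV Xs) = E.ins (1, 0) P (int k - 1, dcons 1 c) C (map inV Xs)
      - signed (int k - 1) (E.ins (int k - 1, dcons 1 c) C (1, 0) P (map inV Xs))"
    by (simp only: fun_diff_def signed_fun)
  also have "\<dots> = - inW (\<Sum>(i, j)\<in>{(i, j). i < j \<and> j \<le> k}. signed (alpha2 ?n xs i j)
                (cochain_eval C (\<mu> [Xs ! i, Xs ! j] # nths Xs (- {i, j}))))
      - inW (\<Sum>i\<le>k. signed (alpha1 ?n xs i + V.pr (xs ! i) c)
                (\<pi> (Xs ! i) (cochain_eval C (nths Xs (- {i})))))"
    unfolding first second signed_signed by (simp add: signed_def)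
  finally show ?thesis by (simp only: inW_minus inW_add minus_add_distrib) simp
qed

end

section \<open>Symmetric products on \<open>W\<close>\<close>

context graded_vs
begin

lemma alternator_add: "alternator U (K + L) = alternator U K + alternator U L"
  by (rule ext) (simp add: alternator_def hom_ext_def vs.scale_right_distrib sum.distrib)

lemma alternator_sum: "alternator U (\<Sum>i\<in>I. f i) = (\<Sum>i\<in>I. alternator U (f i))"
proof (induction I rule: infinite_finite_induct)
  case (infinite I)
  show ?case unfolding sum.infinite[OF infinite] by (rule alternator_zero')
next
  case empty
  show ?case unfolding sum.empty by (rule alternator_zero')
next
  case (insert i I)
  then show ?case unfolding sum.insert[OF insert(1,2)] alternator_add by (simp only:)
qed

lemma alternating_binaryI:
  assumes K: "multilinear U 2 K"
    and swap: "\<And>a b A B. A \<in> gpart U a \<Longrightarrow> B \<in> gpart U b \<Longrightarrow> K [A, B] = signed (1 + pr a b) (K [B, A])"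
  shows "alternating U K"
  unfolding alternating_def
proof (intro allI impI)
  fix Xs xs \<sigma> assume Xs: "homs U Xs xs" and \<sigma>: "\<sigma> permutes {..<length Xs}"
  show "K (permute_list \<sigma> Xs) = signed (kexp (gdim U) \<sigma> xs) (K Xs)"
  proof (cases "length Xs = 2")
    case False
    then show ?thesis by (simp add: ml_length[OF K])
  next
    case True
    then obtain A B where AB: "Xs = [A, B]" by (auto simp: numeral_2_eq_2 length_Suc_conv)
    with Xs obtain a b where ab: "xs = [a, b]" "A \<in> gpart U a" "B \<in> gpart U b"
      by (auto simp: list_all2_Cons1)
    have pairs: "{(i, j). i < j \<and> j < Suc (Suc 0)} = {(0 :: nat, 1)}" by auto
    have k: "kexp (gdim U) \<sigma> xs = (if \<sigma> 1 < \<sigma> 0 then 1 + pr (xs ! \<sigma> 0) (xs ! \<sigma> 1) else 0)"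
      unfolding kexp_def using pairs by (simp add: ab)
    have p: "permute_list \<sigma> Xs = [Xs ! \<sigma> 0, Xs ! \<sigma> 1]"
      by (simp add: permute_list_def AB upt_rec)
    have "\<sigma> 0 < 2" "\<sigma> 1 < 2" "\<sigma> 0 \<noteq> \<sigma> 1"
      using permutes_in_image[OF \<sigma>, of 0] permutes_in_image[OF \<sigma>, of 1] permutes_inj[OF \<sigma>] True
      by (auto dest: injD)
    then consider "\<sigma> 0 = 0" "\<sigma> 1 = 1" | "\<sigma> 0 = 1" "\<sigma> 1 = 0" by linarith
    then show ?thesis
    proof cases
      case 1
      then show ?thesis unfolding p k by (simp add: AB)
    next
      case 2
      then show ?thesis unfolding p k using swap[OF ab(3,2)] by (simp add: AB ab(1))
    qed
  qed
qed

end

lemma extW_add: "(extW (f + g) :: ('v::ab_group_add \<times> 'w::ab_group_add) list \<Rightarrow> _) = extW f + extW g"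
  by (rule ext) (simp add: extW_def inW_add)

lemma extW_zero: "(extW 0 :: ('v::ab_group_add \<times> 'w::ab_group_add) list \<Rightarrow> _) = 0"
  by (rule ext) (simp add: extW_def)

lemma extW_sum: "(extW (\<Sum>i\<in>I. f i) :: ('v::ab_group_add \<times> 'w::ab_group_add) list \<Rightarrow> _) = (\<Sum>i\<in>I. extW (f i))"
proof (induction I rule: infinite_finite_induct)
  case (infinite I)
  show ?case unfolding sum.infinite[OF infinite] by (rule extW_zero)
next
  case empty
  show ?case unfolding sum.empty by (rule extW_zero)
next
  case (insert i I)
  then show ?case unfolding sum.insert[OF insert(1,2)] extW_add by (simp only:)
qed

context graded_pair
begin

lemma multilinear_extW:
  assumes "multilinear W p f"
  shows "multilinear E p (extW f)"
proof (rule E.multilinearI)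
  fix A B :: "('v \<times> 'w) list" and v w a
  show "extW f (A @ (v + w) # B) = extW f (A @ v # B) + extW f (A @ w # B)"
    by (simp add: extW_def W.ml_add[OF assms] inW_add)
  show "extW f (A @ gscale E a v # B) = gscale E a (extW f (A @ v # B))"
    by (simp add: extW_def W.ml_scale[OF assms] snd_gscale gscale_inW)
qed (simp add: extW_def W.ml_length[OF assms])

text \<open>
  Two arguments of degrees \<open>(1, y\<^sub>1)\<close> and \<open>(1, y\<^sub>2)\<close> have a value of degree \<open>(1, y\<^sub>1 + y\<^sub>2 + \<kappa>)\<close>, which explains
  the weight \<open>-1\<close>; all other homogeneous arguments have the value zero.
\<close>

lemma extW_degree:
  assumes f: "multilinear W 2 f" "has_degree W \<kappa> f"
  shows "has_degree E (dcons (-1) \<kappa>) (extW f)"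
  unfolding has_degree_def
proof (intro allI impI)
  fix es ds assume es: "homs E es ds"
  show "extW f es \<in> gpart E (sum_list ds + dcons (-1) \<kappa>)"
  proof (cases "length es = 2")
    case False
    then have "extW f es = 0" by (intro E.ml_length[OF multilinear_extW[OF f(1)]])
    then show ?thesis by (simp only: E.part_zero)
  next
    case True
    then obtain e1 e2 where e: "es = [e1, e2]" by (auto simp: numeral_2_eq_2 length_Suc_conv)
    with es obtain d1 d2 where d: "ds = [d1, d2]" "e1 \<in> gpart E d1" "e2 \<in> gpart E d2"
      by (auto simp: list_all2_Cons1)
    obtain p x q y where pq: "d1 = dcons p x" "d2 = dcons q y" by (metis dcons_cases)
    show ?thesis
    proof (cases "p = 1 \<and> q = 1")
      case True
      then have "snd e1 \<in> gpart W x" "snd e2 \<in> gpart W y" using d pq part_1D by auto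
      then have "f [snd e1, snd e2] \<in> gpart W (sum_list [x, y] + \<kappa>)"
        by (intro has_degreeD[OF f(2)]) simp
      from inW_part[OF this] have "extW f es \<in> gpart E (dcons 1 (x + (y + 0) + \<kappa>))"
        by (simp only: e extW_def list.map sum_list.Cons sum_list.Nil)
      moreover have "sum_list ds + dcons (-1) \<kappa> = dcons 1 (x + (y + 0) + \<kappa>)"
        using True by (simp only: d pq sum_list.Cons sum_list.Nil dcons_add add_0_right) simp
      ultimately show ?thesis by (simp only:)
    next
      case False
      then have "snd e1 = 0 \<or> snd e2 = 0"
        using d pq by (cases "p = 1") (auto simp: gpart_Egr split: if_splits)
      then have "f [snd e1, snd e2] = 0" by (intro W.ml_zero_set[OF f(1)]) auto
      then have "extW f es = 0" by (simp add: e extW_def)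
      then show ?thesis by (simp only: E.part_zero)
    qed
  qed
qed

text \<open>
  Elements of \<open>W\<close> have odd first degree in \<open>E\<close>, which turns symmetry into antisymmetry.
\<close>

lemma extW_alternating:
  assumes f: "multilinear W 2 f" and sym: "graded_symmetric W f"
  shows "alternating E (extW f)"
proof (rule E.alternating_binaryI[OF multilinear_extW[OF f]])
  fix d1 d2 e1 e2 assume e: "e1 \<in> gpart E d1" "e2 \<in> gpart E d2"
  obtain p x q y where pq: "d1 = dcons p x" "d2 = dcons q y" by (metis dcons_cases)
  show "extW f [e1, e2] = signed (1 + E.pr d1 d2) (extW f [e2, e1])"
  proof (cases "p = 1 \<and> q = 1")
    case True
    then have "snd e1 \<in> gpart W x" "snd e2 \<in> gpart W y" using e pq part_1D by auto
    then have "f [snd e1, snd e2] = signed (V.pr x y) (f [snd e2, snd e1])"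
      using sym unfolding graded_symmetric_def W.scale_sign dims by metis
    then have "extW f [e1, e2] = signed (V.pr x y) (extW f [e2, e1])"
      by (simp add: extW_def inW_signed)
    also have "\<dots> = signed (1 + E.pr d1 d2) (extW f [e2, e1])"
      by (rule signed_cong) (simp add: pq pairing_dcons True)
    finally show ?thesis .
  next
    case False
    then have z: "snd e1 = 0 \<or> snd e2 = 0"
      using e pq by (cases "p = 1") (auto simp: gpart_Egr split: if_splits)
    then have "f [snd e1, snd e2] = 0" "f [snd e2, snd e1] = 0"
      by (intro W.ml_zero_set[OF f]; force)+
    then show ?thesis by (simp add: extW_def)
  qed
qed

abbreviation product_part :: "mdeg \<Rightarrow> (('v \<times> 'w) list \<Rightarrow> 'v \<times> 'w) set" where
  "product_part \<equiv> (\<lambda>\<kappa>. alt_maps E (1, dcons (-1) \<kappa>))"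

lemma direct_product_part: "direct product_part"
  by (rule direct_reindex[OF E.direct_alt_maps, of "\<lambda>\<kappa>. (1, dcons (-1) \<kappa>)"]) (auto intro: injI)

text \<open>
  Applying the alternator to the extensions of the components of \<open>\<nu>\<close> gives components of the
  extension of \<open>\<nu>\<close>, because the latter is already alternating.
\<close>

lemma extW_in_dsum:
  assumes \<nu>: "\<nu> \<in> dsum (\<lambda>\<kappa>. multi_maps W (1, \<kappa>))" and sym: "graded_symmetric W \<nu>"
  shows "extW \<nu> \<in> dsum product_part"
proof -
  obtain f where "decomposes (\<lambda>\<kappa>. multi_maps W (1, \<kappa>)) \<nu> f" using \<nu> unfolding dsum_def by auto
  then have fin: "finite {\<kappa>. f \<kappa> \<noteq> 0}" and fm: "\<And>\<kappa>. f \<kappa> \<in> multi_maps W (1, \<kappa>)"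
    and s: "\<nu> = (\<Sum>\<kappa> | f \<kappa> \<noteq> 0. f \<kappa>)" unfolding decomposes_def by auto
  have ml: "multilinear W 2 (f \<kappa>)" and deg: "has_degree W \<kappa> (f \<kappa>)" for \<kappa>
    using fm[of \<kappa>] by (simp_all add: W.multi_maps_iff)
  have ml\<nu>: "multilinear W 2 \<nu>"
  proof -
    have "multilinear W 2 (\<lambda>Xs. \<Sum>\<kappa> | f \<kappa> \<noteq> 0. f \<kappa> Xs)" by (rule W.multilinear_sum) (rule ml)
    also have "(\<lambda>Xs. \<Sum>\<kappa> | f \<kappa> \<noteq> 0. f \<kappa> Xs) = \<nu>" by (rule ext) (simp only: s sum_fun_apply)
    finally show ?thesis .
  qed
  have m: "extW (f \<kappa>) \<in> multi_maps E (1, dcons (-1) \<kappa>)" for \<kappa>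
    using multilinear_extW[OF ml] extW_degree[OF ml deg] by (simp add: E.multi_maps_iff)
  have "extW \<nu> = alternator E (extW \<nu>)"
    by (rule E.alternator_id[OF multilinear_extW[OF ml\<nu>] extW_alternating[OF ml\<nu> sym], symmetric])
  also have "\<dots> = (\<Sum>\<kappa> | f \<kappa> \<noteq> 0. alternator E (extW (f \<kappa>)))"
    unfolding s extW_sum E.alternator_sum ..
  also have "\<dots> \<in> dsum product_part"
  proof (rule dsum_sum[OF direct_product_part])
    fix \<kappa>
    have "alternator E (extW (f \<kappa>)) \<in> product_part \<kappa>"
      unfolding alt_maps_def by (rule imageI) (rule m)
    then show "alternator E (extW (f \<kappa>)) \<in> dsum product_part" by (rule in_dsum[OF direct_product_part])
  qed
  finally show ?thesis .
qed

lemma dsum_product_part_alg: "N \<in> dsum product_part \<Longrightarrow> N \<in> alt_algebra E"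
proof -
  have "dsum product_part \<subseteq> alt_algebra E"
    by (rule dsum_subset[OF direct_product_part E.direct_alt_maps]) (rule subsetI, rule E.alt_alg)
  then show "N \<in> dsum product_part \<Longrightarrow> N \<in> alt_algebra E" by (rule subsetD)
qed

text \<open>
  Nonzero homogeneous arguments have first degrees \<open>0\<close> or \<open>1\<close>, so the value would have first degree at
  least \<open>2\<close>.
\<close>

lemma alt_weight_2_zero:
  assumes K: "K \<in> alt_maps E (k, dcons 2 c)"
  shows "K = 0"
proof -
  note ml = E.alt_multilinear[OF K]
  have "K = (\<lambda>_. 0)"
  proof (rule E.multilinear_eqI[OF ml E.multilinear_zero])
    fix es ds assume es: "homs E es ds"
    show "K es = 0"
    proof (cases "0 \<in> set es")
      case True
      then show ?thesis by (rule E.ml_zero_set[OF ml])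
    next
      case False
      have nn: "0 \<le> d 0" if "d \<in> set ds" for d
      proof (rule ccontr)
        assume neg: "\<not> 0 \<le> d 0"
        from that obtain i where i: "i < length ds" "d = ds ! i" by (auto simp: in_set_conv_nth)
        have "length es = length ds" using es by (rule list_all2_lengthD)
        then have m: "es ! i \<in> gpart E (dcons (d 0) (\<lambda>i. d (Suc i)))" "es ! i \<in> set es"
          using es i by (auto simp: list_all2_conv_all_nth dcons_eta)
        have "es ! i = 0" by (rule part_otherD[OF m(1)]) (use neg in linarith)+
        with m(2) False show False by (simp only:)
      qed
      have "0 \<le> sum_list ds 0" using nn
      proof (induction ds)
        case (Cons d ds)
        then show ?case by simp
      qed simp
      moreover have "K es \<in> gpart E (dcons (sum_list ds 0 + 2) (\<lambda>i. (sum_list ds + dcons 2 c) (Suc i)))"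
      proof -
        have e: "dcons (sum_list ds 0 + 2) (\<lambda>i. (sum_list ds + dcons 2 c) (Suc i)) = sum_list ds + dcons 2 c"
          using dcons_eta[of "sum_list ds + dcons 2 c"] by simp
        show ?thesis unfolding e by (rule has_degreeD[OF E.alt_degree[OF K] es])
      qed
      ultimately show ?thesis by (intro part_otherD) auto
    qed
  qed
  then show ?thesis by (simp add: zero_fun_def)
qed

text \<open>Cochains commute in \<open>A(E)\<close>, since a map of weight \<open>2\<close> has no room for its values.\<close>

lemma nr_Lam_Lam:
  assumes "C1 \<in> Lam V W d1" "C2 \<in> Lam V W d2"
  shows "E.nr C1 C2 = 0"
proof -
  obtain k1 c1 k2 c2 where d: "d1 = (k1, c1)" "d2 = (k2, c2)" by (cases d1, cases d2)
  have "E.nr C1 C2 \<in> alt_maps E ((int k1 - 1, dcons 1 c1) + (int k2 - 1, dcons 1 c2))"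
    by (rule E.nr_alt) (use assms d in \<open>simp_all add: Lam_eq\<close>)
  then have "E.nr C1 C2 \<in> alt_maps E (int k1 - 1 + (int k2 - 1), dcons 2 (c1 + c2))"
    by (simp only: add_Pair dcons_add one_add_one)
  then show ?thesis by (rule alt_weight_2_zero)
qed

text \<open>
  The weight \<open>-1\<close> of the product compensates the two weights \<open>1\<close> of the cochains.
\<close>

lemma nr_nr_Lambda:
  assumes C1: "C1 \<in> Lambda V W" and C2: "C2 \<in> Lambda V W" and N: "N \<in> dsum product_part"
  shows "E.nr C1 (E.nr C2 N) \<in> Lambda V W"
  using C1 C2
proof (induction rule: Lambda_induct2)
  case (homogeneous d1 d2 C1 C2)
  note C = homogeneous and c = homogeneous[THEN Lam_alg]
  obtain k1 c1 k2 c2 where d: "d1 = (k1, c1)" "d2 = (k2, c2)" by (cases d1, cases d2)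
  show ?case
    using N
  proof (induction rule: dsum_induct[OF direct_product_part, consumes 1, case_names homogeneous add])
    case (homogeneous \<kappa> N)
    have "E.nr C1 (E.nr C2 N) \<in> alt_maps E ((int k1 - 1, dcons 1 c1) + ((int k2 - 1, dcons 1 c2) + (1, dcons (-1) \<kappa>)))"
      by (intro E.nr_alt) (use C homogeneous in \<open>simp_all add: Lam_eq d\<close>)
    then have "E.nr C1 (E.nr C2 N) \<in> Lam V W (k1 + k2, c1 + (c2 + \<kappa>))"
      by (simp add: Lam_eq dcons_add del: plus_fun_apply) (simp add: algebra_simps)
    then show ?case by (rule in_dsum[OF direct_Lam])
  next
    case (add N N')
    note a = add(1,2)[THEN dsum_product_part_alg]
    show ?case
      unfolding E.nr_add_right[OF c(2) a] E.nr_add_right[OF c(1) E.nr_alg[OF c(2) a(1)] E.nr_alg[OF c(2) a(2)]]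
      by (rule dsum_add[OF direct_Lam add(3,4)])
  qed
next
  case (add_left C1 C1' C2)
  note a = add_left(1-3)[THEN Lambda_alg]
  show ?case
    unfolding E.nr_add_left[OF a(1,2) E.nr_alg[OF a(3) dsum_product_part_alg[OF N]]]
    by (rule dsum_add[OF direct_Lam add_left(4,5)])
next
  case (add_right C1 C2 C2')
  note a = add_right(1-3)[THEN Lambda_alg] and Na = dsum_product_part_alg[OF N]
  show ?case
    unfolding E.nr_add_left[OF a(2,3) Na] E.nr_add_right[OF a(1) E.nr_alg[OF a(2) Na] E.nr_alg[OF a(3) Na]]
    by (rule dsum_add[OF direct_Lam add_right(4,5)])
qed

lemma Lambda_scale: "C \<in> Lambda V W \<Longrightarrow> map_scale E a C \<in> Lambda V W"
proof (induction rule: Lambda_induct)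
  case (homogeneous d C)
  obtain k c where d: "d = (k, c)" by (cases d)
  have "map_scale E a C \<in> Lam V W d"
    unfolding d Lam_eq by (rule E.alt_scale) (use homogeneous d Lam_eq in simp)
  then show ?case by (rule in_dsum[OF direct_Lam])
next
  case (add C C')
  then show ?case by (simp only: E.map_scale_add dsum_add[OF direct_Lam])
qed

end

section \<open>The product on cohomology\<close>

context binary_on_E
begin

abbreviation D where "D \<equiv> bd V W P"
abbreviation Z where "Z \<equiv> cocycles V W P"
abbreviation B where "B \<equiv> coboundaries V W P"
abbreviation cls where "cls C \<equiv> coh_rel V W P `` {C}"

lemma D_add: "C \<in> Lambda V W \<Longrightarrow> C' \<in> Lambda V W \<Longrightarrow> D (C + C') = D C + D C'"
  unfolding bd_eq by (rule E.nr_add_right[OF P_alg Lambda_alg Lambda_alg])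

lemma D_diff: "C \<in> Lambda V W \<Longrightarrow> C' \<in> Lambda V W \<Longrightarrow> D (C - C') = D C - D C'"
  unfolding bd_eq by (rule E.nr_diff_right[OF P_alg Lambda_alg Lambda_alg])

lemma D_scale: "C \<in> Lambda V W \<Longrightarrow> D (map_scale E a C) = map_scale E a (D C)"
  unfolding bd_eq by (rule E.nr_scale_right[OF P_alg Lambda_alg])

lemma D_signed: "C \<in> Lambda V W \<Longrightarrow> D (signed a C) = signed a (D C)"
  unfolding bd_eq by (rule E.nr_signed_right[OF P_alg Lambda_alg])

lemma D_zero: "D 0 = 0"
  by (simp only: bd_eq E.nr_zero_right)

lemma Z_iff: "C \<in> Z \<longleftrightarrow> C \<in> Lambda V W \<and> D C = 0"
  by (simp add: cocycles_def)

lemma Z_add: "C \<in> Z \<Longrightarrow> C' \<in> Z \<Longrightarrow> C + C' \<in> Z"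
  unfolding Z_iff using D_add dsum_add[OF direct_Lam] by (metis add_0)

lemma Z_scale: "C \<in> Z \<Longrightarrow> map_scale E a C \<in> Z"
  unfolding Z_iff using D_scale Lambda_scale E.map_scale_zero by metis

lemma B_I: "C \<in> Lambda V W \<Longrightarrow> D C \<in> B"
  unfolding coboundaries_def by (rule imageI)

lemma B_E:
  assumes "b \<in> B"
  obtains C where "C \<in> Lambda V W" "b = D C"
  using assms unfolding coboundaries_def by (rule imageE) (rule that)

lemma B_zero: "0 \<in> B"
  using B_I[OF dsum_zero[OF direct_Lam]] D_zero by simp

lemma B_add: "b \<in> B \<Longrightarrow> b' \<in> B \<Longrightarrow> b + b' \<in> B"
  by (elim B_E) (simp only: D_add[symmetric] B_I dsum_add[OF direct_Lam])

lemma B_diff: "b \<in> B \<Longrightarrow> b' \<in> B \<Longrightarrow> b - b' \<in> B"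
  by (elim B_E) (simp only: D_diff[symmetric] B_I dsum_diff[OF direct_Lam])

lemma B_scale: "b \<in> B \<Longrightarrow> map_scale E a b \<in> B"
  by (elim B_E) (simp only: D_scale[symmetric] B_I Lambda_scale)

text \<open>The differential raises the degree by \<open>(1, 0)\<close>, so the components of a cocycle are cocycles.\<close>

lemma hcomp_D:
  assumes "C \<in> Lambda V W"
  shows "hcomp (Lam V W) (D C) (Suc k, c) = D (hcomp (Lam V W) C (k, c))"
  using assms
proof (induction rule: Lambda_induct)
  case (homogeneous d C)
  obtain j b where d: "d = (j, b)" by (cases d)
  note C = homogeneous[unfolded d]
  show ?case
    using D_zero by (simp only: hcomp_homogeneous[OF direct_Lam, OF C]
        hcomp_homogeneous[OF direct_Lam, OF bd_Lam[OF C]] prod.inject nat.inject if_distrib[of D])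
next
  case (add C C')
  then show ?case
    by (simp only: D_add hcomp_add[OF direct_Lam] bd_Lambda D_add[OF in_dsum[OF direct_Lam hcomp_in[OF direct_Lam]]
          in_dsum[OF direct_Lam hcomp_in[OF direct_Lam]]])
qed

lemma hcomp_cocycle:
  assumes "C \<in> Z"
  shows "hcomp (Lam V W) C d \<in> Z"
proof -
  obtain k c where d: "d = (k, c)" by (cases d)
  have C: "C \<in> Lambda V W" "D C = 0" using assms unfolding Z_iff by auto
  have "D (hcomp (Lam V W) C (k, c)) = 0"
    unfolding hcomp_D[OF C(1), symmetric] C(2) by (rule hcomp_zero[OF direct_Lam])
  moreover have "hcomp (Lam V W) C d \<in> Lambda V W"
    by (rule in_dsum[OF direct_Lam hcomp_in[OF direct_Lam C(1)]])
  ultimately show ?thesis unfolding Z_iff d by (rule conjI[rotated])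
qed

lemma cocycle_induct [consumes 1, case_names homogeneous add]:
  assumes C: "C \<in> Z"
    and hom: "\<And>d C. C \<in> Lam V W d \<Longrightarrow> C \<in> Z \<Longrightarrow> Q C"
    and add: "\<And>C C'. C \<in> Z \<Longrightarrow> C' \<in> Z \<Longrightarrow> Q C \<Longrightarrow> Q C' \<Longrightarrow> Q (C + C')"
  shows "Q C"
proof -
  have CL: "C \<in> Lambda V W" using C unfolding Z_iff by (rule conjunct1)
  have Z0: "0 \<in> Z" unfolding Z_iff using dsum_zero[OF direct_Lam] D_zero by simp
  have *: "Q (\<Sum>d\<in>T. hcomp (Lam V W) C d) \<and> (\<Sum>d\<in>T. hcomp (Lam V W) C d) \<in> Z" if "finite T" for T
    using that
  proof (induction T)
    case empty
    show ?case unfolding sum.empty using hom[OF direct_zero[OF direct_Lam] Z0] Z0 by (rule conjI)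
  next
    case (insert d T)
    have h: "hcomp (Lam V W) C d \<in> Z" by (rule hcomp_cocycle[OF C])
    have "Q (hcomp (Lam V W) C d)" by (rule hom[OF hcomp_in[OF direct_Lam CL] h])
    with insert add h Z_add show ?case by (simp only: sum.insert[OF insert(1,2)])
  qed
  show ?thesis
    using *[OF finite_hsupp[OF direct_Lam CL]] sum_hcomp[OF direct_Lam CL finite_hsupp[OF direct_Lam CL]] by simp
qed

lemma rel_iff: "(C, C') \<in> coh_rel V W P \<longleftrightarrow> C \<in> Z \<and> C' \<in> Z \<and> C - C' \<in> B"
  by (simp add: coh_rel_def)

lemma equiv_rel: "equiv Z (coh_rel V W P)"
proof (rule equivI)
  show "refl_on Z (coh_rel V W P)"
    by (rule refl_onI) (use B_zero in \<open>auto simp: rel_iff\<close>)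
  show "sym (coh_rel V W P)"
  proof (rule symI)
    fix C C' assume r: "(C, C') \<in> coh_rel V W P"
    have "0 - (C - C') \<in> B" by (rule B_diff[OF B_zero]) (use r rel_iff in blast)
    with r show "(C', C) \<in> coh_rel V W P" by (simp add: rel_iff)
  qed
  show "trans (coh_rel V W P)"
  proof (rule transI)
    fix C C' C'' assume r: "(C, C') \<in> coh_rel V W P" "(C', C'') \<in> coh_rel V W P"
    then have "C - C' + (C' - C'') \<in> B" by (intro B_add) (auto simp: rel_iff)
    with r show "(C, C'') \<in> coh_rel V W P" by (simp add: rel_iff)
  qed
qed (auto simp: rel_iff)

lemma cls_eqI: "(C, C') \<in> coh_rel V W P \<Longrightarrow> cls C = cls C'"
  by (rule equiv_class_eq[OF equiv_rel])

lemma cls_self: "C \<in> Z \<Longrightarrow> C \<in> cls C"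
  by (rule equiv_class_self[OF equiv_rel])

lemma union_cls:
  assumes C: "C \<in> Z" and f: "\<And>C'. (C, C') \<in> coh_rel V W P \<Longrightarrow> f C' = f C"
  shows "(\<Union>C'\<in>cls C. f C') = f C"
proof -
  have "(\<Union>C'\<in>cls C. f C') = (\<Union>C'\<in>cls C. f C)" by (rule SUP_cong) (use f in auto)
  also have "\<dots> = f C" using cls_self[OF C] by auto
  finally show ?thesis .
qed

lemma union_cls2:
  assumes C: "C1 \<in> Z" "C2 \<in> Z"
    and f: "\<And>C1' C2'. (C1, C1') \<in> coh_rel V W P \<Longrightarrow> (C2, C2') \<in> coh_rel V W P \<Longrightarrow> f C1' C2' = f C1 C2"
  shows "(\<Union>C1'\<in>cls C1. \<Union>C2'\<in>cls C2. f C1' C2') = f C1 C2"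
proof -
  have "(\<Union>C2'\<in>cls C2. f C1' C2') = f C1 C2" if "(C1, C1') \<in> coh_rel V W P" for C1'
  proof -
    have "(C2, C2) \<in> coh_rel V W P" using cls_self[OF C(2)] by simp
    then have "(\<Union>C2'\<in>cls C2. f C1' C2') = f C1' C2"
      using f[OF that] by (intro union_cls[OF C(2)]) auto
    also have "\<dots> = f C1 C2" by (rule f[OF that]) fact
    finally show ?thesis .
  qed
  moreover have "(C1, C1) \<in> coh_rel V W P" using cls_self[OF C(1)] by simp
  ultimately show ?thesis by (subst union_cls[OF C(1)]) auto
qed

lemma coh_add_cls:
  assumes "C1 \<in> Z" "C2 \<in> Z"
  shows "coh_add V W P (cls C1) (cls C2) = cls (C1 + C2)"
  unfolding coh_add_def
proof (rule union_cls2[OF assms])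
  fix C1' C2' assume r: "(C1, C1') \<in> coh_rel V W P" "(C2, C2') \<in> coh_rel V W P"
  then have "(C1 - C1') + (C2 - C2') \<in> B" by (intro B_add) (auto simp: rel_iff)
  moreover have "(C1 - C1') + (C2 - C2') = C1 + C2 - (C1' + C2')" by simp
  ultimately have "(C1 + C2, C1' + C2') \<in> coh_rel V W P"
    using r Z_add unfolding rel_iff by (metis (no_types))
  then show "cls (C1' + C2') = cls (C1 + C2)" by (rule cls_eqI[symmetric])
qed

lemma coh_scale_cls:
  assumes "C \<in> Z"
  shows "coh_scale V W P a (cls C) = cls (map_scale E a C)"
  unfolding coh_scale_def
proof (rule union_cls[OF assms])
  fix C' assume r: "(C, C') \<in> coh_rel V W P"
  then have "map_scale E a (C - C') \<in> B" by (intro B_scale) (auto simp: rel_iff)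
  then have "(map_scale E a C, map_scale E a C') \<in> coh_rel V W P"
    using r Z_scale unfolding rel_iff E.map_scale_diff by blast
  then show "cls (map_scale E a C') = cls (map_scale E a C)" by (rule cls_eqI[symmetric])
qed

lemma cohomology_cases:
  assumes "h \<in> cohomology V W P"
  obtains C where "C \<in> Z" "h = cls C"
  using assms unfolding cohomology_def by (rule quotientE) (rule that)

lemma cls_in_cohomology: "C \<in> Z \<Longrightarrow> cls C \<in> cohomology V W P"
  unfolding cohomology_def by (rule quotientI)

end

locale cochain_product = binary_on_E V W P
  for V :: "('k::field_char_0, 'v::ab_group_add) gspace" and W :: "('k, 'w::ab_group_add) gspace"
    and P :: "('v \<times> 'w) list \<Rightarrow> 'v \<times> 'w" +
  fixes \<nu> :: "'w list \<Rightarrow> 'w"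
  assumes \<nu>: "\<nu> \<in> dsum (\<lambda>\<kappa>. multi_maps W (1, \<kappa>))" "graded_symmetric W \<nu>"
    and P\<nu>: "nr_bracket (Egr V W) P (extW \<nu>) = 0"
begin

abbreviation N where "N \<equiv> extW \<nu> :: ('v \<times> 'w) list \<Rightarrow> 'v \<times> 'w"
abbreviation pd (infixl "\<bullet>" 70) where "C1 \<bullet> C2 \<equiv> bullet V W \<nu> C1 C2"

lemma N_dsum: "N \<in> dsum product_part"
  by (rule extW_in_dsum[OF \<nu>])

lemma N_alg: "N \<in> alt_algebra E"
  by (rule dsum_product_part_alg[OF N_dsum])

lemma pd_eq: "C1 \<bullet> C2 = E.nr C1 (E.nr C2 N)"
  by (simp only: bullet_def)

lemma pd_Lambda: "C1 \<in> Lambda V W \<Longrightarrow> C2 \<in> Lambda V W \<Longrightarrow> C1 \<bullet> C2 \<in> Lambda V W"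
  unfolding pd_eq by (rule nr_nr_Lambda[OF _ _ N_dsum])

lemma pd_add_left:
  "C1 \<in> Lambda V W \<Longrightarrow> C1' \<in> Lambda V W \<Longrightarrow> C2 \<in> Lambda V W \<Longrightarrow> (C1 + C1') \<bullet> C2 = C1 \<bullet> C2 + C1' \<bullet> C2"
  unfolding pd_eq by (rule E.nr_add_left[OF Lambda_alg Lambda_alg E.nr_alg[OF Lambda_alg N_alg]])

lemma pd_add_right:
  assumes "C1 \<in> Lambda V W" "C2 \<in> Lambda V W" "C2' \<in> Lambda V W"
  shows "C1 \<bullet> (C2 + C2') = C1 \<bullet> C2 + C1 \<bullet> C2'"
  unfolding pd_eq E.nr_add_left[OF Lambda_alg[OF assms(2)] Lambda_alg[OF assms(3)] N_alg]
  by (rule E.nr_add_right[OF Lambda_alg[OF assms(1)] E.nr_alg[OF Lambda_alg[OF assms(2)] N_alg]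
        E.nr_alg[OF Lambda_alg[OF assms(3)] N_alg]])

lemma pd_scale_left:
  "C1 \<in> Lambda V W \<Longrightarrow> C2 \<in> Lambda V W \<Longrightarrow> map_scale E a C1 \<bullet> C2 = map_scale E a (C1 \<bullet> C2)"
  unfolding pd_eq by (rule E.nr_scale_left[OF Lambda_alg E.nr_alg[OF Lambda_alg N_alg]])

lemma pd_scale_right:
  assumes "C1 \<in> Lambda V W" "C2 \<in> Lambda V W"
  shows "C1 \<bullet> map_scale E a C2 = map_scale E a (C1 \<bullet> C2)"
  unfolding pd_eq E.nr_scale_left[OF Lambda_alg[OF assms(2)] N_alg]
  by (rule E.nr_scale_right[OF Lambda_alg[OF assms(1)] E.nr_alg[OF Lambda_alg[OF assms(2)] N_alg]])

lemma pd_zero: "0 \<bullet> C = 0" "C \<bullet> 0 = 0"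
  by (simp_all only: pd_eq E.nr_zero_left E.nr_zero_right)

lemma pd_diff_left:
  "C1 \<in> Lambda V W \<Longrightarrow> C1' \<in> Lambda V W \<Longrightarrow> C2 \<in> Lambda V W \<Longrightarrow> (C1 - C1') \<bullet> C2 = C1 \<bullet> C2 - C1' \<bullet> C2"
  unfolding pd_eq by (rule E.nr_diff_left[OF Lambda_alg Lambda_alg E.nr_alg[OF Lambda_alg N_alg]])

lemma pd_diff_right:
  assumes "C1 \<in> Lambda V W" "C2 \<in> Lambda V W" "C2' \<in> Lambda V W"
  shows "C1 \<bullet> (C2 - C2') = C1 \<bullet> C2 - C1 \<bullet> C2'"
  unfolding pd_eq E.nr_diff_left[OF Lambda_alg[OF assms(2)] Lambda_alg[OF assms(3)] N_alg]
  by (rule E.nr_diff_right[OF Lambda_alg[OF assms(1)] E.nr_alg[OF Lambda_alg[OF assms(2)] N_alg]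
        E.nr_alg[OF Lambda_alg[OF assms(3)] N_alg]])

lemma pd_bilinear: "bilinear_product (Lambda V W) (+) (map_scale E) (bullet V W \<nu>)"
  unfolding bilinear_product_def
  by (intro conjI ballI allI pd_Lambda pd_add_left pd_add_right pd_scale_left pd_scale_right)

abbreviation psgn :: "nat \<times> mdeg \<Rightarrow> nat \<times> mdeg \<Rightarrow> int" where
  "psgn d1 d2 \<equiv> (int (fst d1) - 1) * (int (fst d2) - 1) + 1 + V.pr (snd d1) (snd d2)"

text \<open>By the Jacobi identity the two orders of \<open>C\<^sub>1\<close> and \<open>C\<^sub>2\<close> differ by a multiple of \<open>[[C\<^sub>1, C\<^sub>2], \<nu>]\<close>.\<close>

lemma pd_commute:
  assumes C: "C1 \<in> Lam V W d1" "C2 \<in> Lam V W d2"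
  shows "C1 \<bullet> C2 = signed (psgn d1 d2) (C2 \<bullet> C1)"
proof -
  obtain k1 c1 k2 c2 where d: "d1 = (k1, c1)" "d2 = (k2, c2)" by (cases d1, cases d2)
  note C' = C[unfolded d Lam_eq]
  have "E.nr C1 (E.nr C2 N) = E.nr (E.nr C1 C2) N
      + signed (E.dsgn (int k1 - 1, dcons 1 c1) (int k2 - 1, dcons 1 c2)) (E.nr C2 (E.nr C1 N))"
    by (rule E.nr_Jacobi[OF C' N_alg])
  then have "C1 \<bullet> C2 = signed (E.dsgn (int k1 - 1, dcons 1 c1) (int k2 - 1, dcons 1 c2)) (C2 \<bullet> C1)"
    unfolding nr_Lam_Lam[OF C] by (simp only: E.nr_zero_left add_0 pd_eq)
  moreover have "E.dsgn (int k1 - 1, dcons 1 c1) (int k2 - 1, dcons 1 c2) = psgn d1 d2"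
    by (simp add: E.dsgn_def pairing_dcons d)
  ultimately show ?thesis by (simp only:)
qed

text \<open>
  The Jacobi identity says that \<open>[P, \<cdot>]\<close> is a derivation of the bracket. It is applied twice, and the last
  term contains \<open>[P, \<nu>] = 0\<close>.
\<close>

lemma D_pd:
  assumes C: "C1 \<in> Lam V W (k1, c1)" "C2 \<in> Lam V W (k2, c2)"
  shows "D (C1 \<bullet> C2) = D C1 \<bullet> C2 + signed (int k1 - 1) (C1 \<bullet> D C2)"
proof -
  note C' = C[unfolded Lam_eq]
  have s: "E.dsgn (1, 0) (int k - 1, e) = int k - 1" for k e
    by (simp only: E.dsgn_def fst_conv snd_conv pairing_zero mult_1 add_0_right)
  have 2: "E.nr P (E.nr C2 N) = E.nr (E.nr P C2) N"
    using E.nr_Jacobi[OF P C'(2) N_alg]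
    by (simp only: P\<nu> E.nr_zero_right signed_zero add_0_right)
  have "E.nr P (E.nr C1 (E.nr C2 N)) = E.nr (E.nr P C1) (E.nr C2 N)
      + signed (int k1 - 1) (E.nr C1 (E.nr P (E.nr C2 N)))"
    using E.nr_Jacobi[OF P C'(1) E.nr_alg[OF Lam_alg[OF C(2)] N_alg]] by (simp only: s)
  then show ?thesis unfolding 2 by (simp only: pd_eq bd_eq)
qed

text \<open>
  The Leibniz rule is available for homogeneous cochains only. Since the components of a cocycle are
  cocycles, it is enough to consider homogeneous cocycles, here and in the next two lemmas.
\<close>

lemma pd_cocycle:
  assumes "C1 \<in> Z" "C2 \<in> Z"
  shows "C1 \<bullet> C2 \<in> Z"
  using assms(1)
proof (induction rule: cocycle_induct)
  case (homogeneous d1 C1)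
  note C1 = homogeneous
  from assms(2) show ?case
  proof (induction rule: cocycle_induct)
    case (homogeneous d2 C2)
    obtain k1 c1 k2 c2 where d: "d1 = (k1, c1)" "d2 = (k2, c2)" by (cases d1, cases d2)
    have z: "D C1 = 0" "D C2 = 0" and L: "C1 \<in> Lambda V W" "C2 \<in> Lambda V W"
      using C1(2) homogeneous(2) unfolding Z_iff by auto
    have "D (C1 \<bullet> C2) = 0"
      unfolding D_pd[OF C1(1)[unfolded d] homogeneous(1)[unfolded d]] z by (simp only: pd_zero signed_zero add_0)
    then show ?case unfolding Z_iff using pd_Lambda[OF L] by simp
  next
    case (add C2 C2')
    then have "C2 \<in> Lambda V W" "C2' \<in> Lambda V W" "C1 \<in> Lambda V W" using C1(2) unfolding Z_iff by auto
    then show ?case using add Z_add by (simp only: pd_add_right)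
  qed
next
  case (add C1 C1')
  then have "C1 \<in> Lambda V W" "C1' \<in> Lambda V W" "C2 \<in> Lambda V W" using assms(2) unfolding Z_iff by auto
  then show ?case using add Z_add by (simp only: pd_add_left)
qed

text \<open>
  If \<open>C\<close> is a homogeneous cocycle, then \<open>C \<bullet> \<partial>G\<close> is \<open>\<partial>(C \<bullet> G)\<close> up to the sign.
\<close>

lemma pd_coboundary_right:
  assumes C: "C \<in> Z" and b: "b \<in> B"
  shows "C \<bullet> b \<in> B"
proof -
  obtain G where G: "G \<in> Lambda V W" "b = D G" using b by (rule B_E)
  from C have "C \<bullet> D G \<in> B"
  proof (induction rule: cocycle_induct)
    case (homogeneous d C)
    note C = homogeneous
    have CL: "C \<in> Lambda V W" "D C = 0" using C(2) unfolding Z_iff by auto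
    from G(1) show ?case
    proof (induction rule: Lambda_induct)
      case (homogeneous e G)
      obtain k c l b where d: "d = (k, c)" "e = (l, b)" by (cases d, cases e)
      have GL: "G \<in> Lambda V W" by (rule in_dsum[OF direct_Lam, OF homogeneous])
      have "D (C \<bullet> G) = signed (int k - 1) (C \<bullet> D G)"
        unfolding D_pd[OF C(1)[unfolded d] homogeneous[unfolded d]] CL(2) by (simp only: pd_zero add_0)
      then have "signed (int k - 1) (D (C \<bullet> G)) = signed (int k - 1 + (int k - 1)) (C \<bullet> D G)"
        by (simp only: signed_signed)
      also have "\<dots> = signed 0 (C \<bullet> D G)" by (rule signed_cong) simp
      finally have e: "signed (int k - 1) (D (C \<bullet> G)) = C \<bullet> D G" unfolding signed_0 .
      have "C \<bullet> D G = D (signed (int k - 1) (C \<bullet> G))"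
        using D_signed[OF pd_Lambda[OF CL(1) GL]] e by simp
      then show ?case using B_I[OF dsum_signed[OF direct_Lam, OF pd_Lambda[OF CL(1) GL]]] by simp
    next
      case (add G G')
      then show ?case using CL(1) by (simp only: D_add pd_add_right bd_Lambda B_add)
    qed
  next
    case (add C C')
    then have "C \<in> Lambda V W" "C' \<in> Lambda V W" unfolding Z_iff by auto
    then show ?case using add by (simp only: pd_add_left bd_Lambda[OF G(1)] B_add)
  qed
  then show ?thesis unfolding G(2) .
qed

lemma pd_coboundary_left:
  assumes C: "C \<in> Z" and b: "b \<in> B"
  shows "b \<bullet> C \<in> B"
proof -
  obtain G where G: "G \<in> Lambda V W" "b = D G" using b by (rule B_E)
  from C have "D G \<bullet> C \<in> B"
  proof (induction rule: cocycle_induct)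
    case (homogeneous d C)
    note C = homogeneous
    have CL: "C \<in> Lambda V W" "D C = 0" using C(2) unfolding Z_iff by auto
    from G(1) show ?case
    proof (induction rule: Lambda_induct)
      case (homogeneous e G)
      obtain k c l b where d: "d = (k, c)" "e = (l, b)" by (cases d, cases e)
      have GL: "G \<in> Lambda V W" by (rule in_dsum[OF direct_Lam, OF homogeneous])
      have "D (G \<bullet> C) = D G \<bullet> C"
        unfolding D_pd[OF homogeneous[unfolded d] C(1)[unfolded d]] CL(2) by (simp only: pd_zero signed_zero add_0_right)
      then show ?case using B_I[OF pd_Lambda[OF GL CL(1)]] by simp
    next
      case (add G G')
      then show ?case using CL(1) by (simp only: D_add pd_add_left bd_Lambda B_add)
    qed
  next
    case (add C C')
    then have "C \<in> Lambda V W" "C' \<in> Lambda V W" unfolding Z_iff by auto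
    then show ?case using add by (simp only: pd_add_right bd_Lambda[OF G(1)] B_add)
  qed
  then show ?thesis unfolding G(2) .
qed

text \<open>
  With \<open>b\<^sub>i = C\<^sub>i - C\<^sub>i'\<close> the difference of the products is \<open>b\<^sub>1 \<bullet> C\<^sub>2 + C\<^sub>1' \<bullet> b\<^sub>2\<close>.
\<close>

lemma pd_rel:
  assumes r: "(C1, C1') \<in> coh_rel V W P" "(C2, C2') \<in> coh_rel V W P"
  shows "(C1 \<bullet> C2, C1' \<bullet> C2') \<in> coh_rel V W P"
proof -
  have Z: "C1 \<in> Z" "C1' \<in> Z" "C2 \<in> Z" "C2' \<in> Z" and b: "C1 - C1' \<in> B" "C2 - C2' \<in> B"
    using r unfolding rel_iff by auto
  then have L: "C1 \<in> Lambda V W" "C1' \<in> Lambda V W" "C2 \<in> Lambda V W" "C2' \<in> Lambda V W"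
    unfolding Z_iff by auto
  have "(C1 - C1') \<bullet> C2 + C1' \<bullet> (C2 - C2') \<in> B"
    by (rule B_add[OF pd_coboundary_left[OF Z(3) b(1)] pd_coboundary_right[OF Z(2) b(2)]])
  moreover have "(C1 - C1') \<bullet> C2 + C1' \<bullet> (C2 - C2') = C1 \<bullet> C2 - C1' \<bullet> C2'"
    unfolding pd_diff_left[OF L(1,2,3)] pd_diff_right[OF L(2,3,4)] by (rule diff_add_eq[THEN trans]) simp
  ultimately show ?thesis unfolding rel_iff using pd_cocycle Z by simp
qed

lemma pd_respects: "(\<lambda>C1 C2. cls (C1 \<bullet> C2)) respects2 coh_rel V W P"
  unfolding congruent2_def by (auto intro!: cls_eqI pd_rel simp del: Image_singleton_iff)

lemma coh_prod_cls:
  assumes "C1 \<in> Z" "C2 \<in> Z"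
  shows "coh_prod V W P \<nu> (cls C1) (cls C2) = cls (C1 \<bullet> C2)"
  unfolding coh_prod_def
  by (rule union_cls2[OF assms]) (rule cls_eqI[OF pd_rel, symmetric])

lemma coh_prod_bilinear:
  "bilinear_product (cohomology V W P) (coh_add V W P) (coh_scale V W P) (coh_prod V W P \<nu>)"
  unfolding bilinear_product_def
proof (intro conjI ballI allI)
  fix h1 h2 assume "h1 \<in> cohomology V W P" "h2 \<in> cohomology V W P"
  then obtain C1 C2 where C: "C1 \<in> Z" "h1 = cls C1" "C2 \<in> Z" "h2 = cls C2" by (elim cohomology_cases)
  have L: "C1 \<in> Lambda V W" "C2 \<in> Lambda V W" using C unfolding Z_iff by auto
  show "coh_prod V W P \<nu> h1 h2 \<in> cohomology V W P"
    unfolding C(2,4) coh_prod_cls[OF C(1,3)] by (rule cls_in_cohomology[OF pd_cocycle[OF C(1,3)]])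
  fix a
  show "coh_prod V W P \<nu> (coh_scale V W P a h1) h2 = coh_scale V W P a (coh_prod V W P \<nu> h1 h2)"
    unfolding C(2,4) coh_prod_cls[OF C(1,3)] coh_scale_cls[OF C(1)] coh_scale_cls[OF pd_cocycle[OF C(1,3)]]
      coh_prod_cls[OF Z_scale[OF C(1)] C(3)] pd_scale_left[OF L] ..
  show "coh_prod V W P \<nu> h1 (coh_scale V W P a h2) = coh_scale V W P a (coh_prod V W P \<nu> h1 h2)"
    unfolding C(2,4) coh_prod_cls[OF C(1,3)] coh_scale_cls[OF C(3)] coh_scale_cls[OF pd_cocycle[OF C(1,3)]]
      coh_prod_cls[OF C(1) Z_scale[OF C(3)]] pd_scale_right[OF L] ..
next
  fix h1 h2 h3 assume "h1 \<in> cohomology V W P" "h2 \<in> cohomology V W P" "h3 \<in> cohomology V W P"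
  then obtain C1 C2 C3 where C: "C1 \<in> Z" "h1 = cls C1" "C2 \<in> Z" "h2 = cls C2" "C3 \<in> Z" "h3 = cls C3"
    by (elim cohomology_cases)
  have L: "C1 \<in> Lambda V W" "C2 \<in> Lambda V W" "C3 \<in> Lambda V W" using C unfolding Z_iff by auto
  show "coh_prod V W P \<nu> (coh_add V W P h1 h2) h3
      = coh_add V W P (coh_prod V W P \<nu> h1 h3) (coh_prod V W P \<nu> h2 h3)"
    unfolding C(2,4,6) coh_prod_cls[OF C(1,5)] coh_prod_cls[OF C(3,5)] coh_add_cls[OF C(1,3)]
      coh_add_cls[OF pd_cocycle[OF C(1,5)] pd_cocycle[OF C(3,5)]] coh_prod_cls[OF Z_add[OF C(1,3)] C(5)]
      pd_add_left[OF L] ..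
  show "coh_prod V W P \<nu> h3 (coh_add V W P h1 h2)
      = coh_add V W P (coh_prod V W P \<nu> h3 h1) (coh_prod V W P \<nu> h3 h2)"
    unfolding C(2,4,6) coh_prod_cls[OF C(5,1)] coh_prod_cls[OF C(5,3)] coh_add_cls[OF C(1,3)]
      coh_add_cls[OF pd_cocycle[OF C(5,1)] pd_cocycle[OF C(5,3)]] coh_prod_cls[OF C(5) Z_add[OF C(1,3)]]
      pd_add_right[OF L(3,1,2)] ..
qed

lemma coh_prod_commute:
  assumes h: "h1 \<in> coh_part V W P d1" "h2 \<in> coh_part V W P d2"
  shows "coh_prod V W P \<nu> h1 h2 = coh_scale V W P ((-1) powi psgn d1 d2) (coh_prod V W P \<nu> h2 h1)"
proof -
  obtain C1 where C1: "h1 = cls C1" "C1 \<in> Z \<inter> Lam V W d1" using h(1) unfolding coh_part_def by (rule quotientE)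
  obtain C2 where C2: "h2 = cls C2" "C2 \<in> Z \<inter> Lam V W d2" using h(2) unfolding coh_part_def by (rule quotientE)
  have C: "C1 \<in> Z" "C2 \<in> Z" "C1 \<in> Lam V W d1" "C2 \<in> Lam V W d2" using C1 C2 by auto
  show ?thesis
    unfolding C1(1) C2(1) coh_prod_cls[OF C(1,2)] coh_prod_cls[OF C(2,1)] coh_scale_cls[OF pd_cocycle[OF C(2,1)]]
      E.map_scale_sign by (subst pd_commute[OF C(3,4)]) (rule refl)
qed

end

section \<open>Square-zero elements of degree \<open>(1, 0, \<dots>, 0)\<close>\<close>

theorem theorem4p5:
  fixes V :: "('k::field_char_0, 'v::ab_group_add) gspace"
    and W :: "('k, 'w::ab_group_add) gspace"
    and n :: nat
    and P :: "('v \<times> 'w) list \<Rightarrow> 'v \<times> 'w"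
  assumes V: "graded_space V" "gdim V = n"
    and W: "graded_space W" "gdim W = n"
    and P: "P \<in> alt_maps (Egr V W) (1, 0)"
  shows
    "(\<forall>X1 X2 Y. P [inV X1, inV X2] = inV (mult_of P [X1, X2]) \<and>
                P [inV X1, inW Y] = inW (act_of P X1 Y))
     \<and>
     \<comment> \<open>(1)\<close>
     ((nr_bracket (Egr V W) P P = 0 \<longleftrightarrow>
         nr_bracket V (mult_of P) (mult_of P) = 0 \<and>
         (\<forall>X1 X2 Y. act_of P (mult_of P [X1, X2]) Y = gcomm W (act_of P X1) (act_of P X2) Y)) \<and>
      (nr_bracket V (mult_of P) (mult_of P) = 0 \<longrightarrow>
         graded_lie_algebra V (\<lambda>X1 X2. mult_of P [X1, X2])) \<and>
      (nr_bracket (Egr V W) P P = 0 \<longrightarrow>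
         graded_lie_module V (\<lambda>X1 X2. mult_of P [X1, X2]) W (act_of P)))
     \<and>
     \<comment> \<open>(2)\<close>
     (nr_bracket (Egr V W) P P = 0 \<longrightarrow>
        differential_on (map_scale (Egr V W)) (alt_algebra (Egr V W)) (bd V W P) \<and>
        Lambda V W \<subseteq> alt_algebra (Egr V W) \<and>
        bd V W P ` Lambda V W \<subseteq> Lambda V W \<and>
        (\<forall>k c. \<forall>C\<in>Lam V W (k, c).
           bd V W P C \<in> Lam V W (Suc k, c) \<and>
           (\<forall>Xs xs. length Xs = Suc k \<longrightarrow> list_all2 (\<lambda>X x. X \<in> gpart V x) Xs xs \<longrightarrow>
              bd V W P C (map inV Xs) =
                inW (- ((\<Sum>i\<le>k.
                           gscale W ((-1) powi (alpha1 n xs i + pairing n (xs ! i) c))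
                             (act_of P (Xs ! i) (cochain_eval C (nths Xs (- {i})))))
                      + (\<Sum>(i, j)\<in>{(i, j). i < j \<and> j \<le> k}.
                           gscale W ((-1) powi alpha2 n xs i j)
                             (cochain_eval C (mult_of P [Xs ! i, Xs ! j] # nths Xs (- {i, j})))))))))
     \<and>
     \<comment> \<open>(3)\<close>
     (\<forall>\<nu>. nr_bracket (Egr V W) P P = 0 \<longrightarrow>
        \<nu> \<in> dsum (\<lambda>\<kappa>. multi_maps W (1, \<kappa>)) \<longrightarrow> graded_symmetric W \<nu> \<longrightarrow>
        nr_bracket (Egr V W) P (extW \<nu>) = 0 \<longrightarrow>
        extW \<nu> \<in> dsum (\<lambda>\<kappa>. alt_maps (Egr V W) (1, dcons (-1) \<kappa>)) \<and>
        bilinear_product (Lambda V W) (+) (map_scale (Egr V W)) (bullet V W \<nu>) \<and>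
        (\<forall>k1 c1 k2 c2. \<forall>C1\<in>Lam V W (k1, c1). \<forall>C2\<in>Lam V W (k2, c2).
           bullet V W \<nu> C1 C2 =
             map_scale (Egr V W)
               ((-1) powi ((int k1 - 1) * (int k2 - 1) + 1 + pairing n c1 c2))
               (bullet V W \<nu> C2 C1) \<and>
           bd V W P (bullet V W \<nu> C1 C2) =
             bullet V W \<nu> (bd V W P C1) C2
             + map_scale (Egr V W) ((-1) powi (int k1 - 1)) (bullet V W \<nu> C1 (bd V W P C2))) \<and>
        equiv (cocycles V W P) (coh_rel V W P) \<and>
        (\<forall>C1\<in>cocycles V W P. \<forall>C2\<in>cocycles V W P. bullet V W \<nu> C1 C2 \<in> cocycles V W P) \<and>
        (\<lambda>C1 C2. coh_rel V W P `` {bullet V W \<nu> C1 C2}) respects2 coh_rel V W P \<and>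
        (\<forall>C1\<in>cocycles V W P. \<forall>C2\<in>cocycles V W P.
           coh_prod V W P \<nu> (coh_rel V W P `` {C1}) (coh_rel V W P `` {C2}) =
             coh_rel V W P `` {bullet V W \<nu> C1 C2}) \<and>
        bilinear_product (cohomology V W P) (coh_add V W P) (coh_scale V W P) (coh_prod V W P \<nu>) \<and>
        (\<forall>k1 c1 k2 c2. \<forall>h1\<in>coh_part V W P (k1, c1). \<forall>h2\<in>coh_part V W P (k2, c2).
           coh_prod V W P \<nu> h1 h2 =
             coh_scale V W P
               ((-1) powi ((int k1 - 1) * (int k2 - 1) + 1 + pairing n c1 c2))
               (coh_prod V W P \<nu> h2 h1)))"
proof -
  interpret binary_on_E V W P
    by unfold_locales (use V W P in simp_all)
  have n: "n = gdim V" using V(2) by simp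
  show ?thesis
    unfolding n
  proof (intro conjI, goal_cases)
    case 1
    show ?case by (simp only: P_VV P_VW simp_thms)
  next
    case 2
    show ?case by (rule self_bracket_zero_iff)
  next
    case 3
    show ?case by (rule impI) (rule V.graded_lie_algebra_of_alt[OF \<mu>_alt])
  next
    case 4
    show ?case by (rule impI) (rule graded_lie_module_of_square_zero)
  next
    case 5
    show ?case
    proof (intro impI conjI allI ballI, goal_cases)
      case 1
      then show ?case by (rule bd_differential)
    next
      case 2
      show ?case by (rule Lambda_subset)
    next
      case 3
      show ?case by (rule image_subsetI) (rule bd_Lambda)
    next
      case (4 k c C)
      show ?case by (rule bd_Lam) (rule 4)
    next
      case (5 k c C Xs xs)
      show ?case unfolding W.scale_sign by (rule bd_formula[OF 5(2-4)])
    qed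
  next
    case 6
    show ?case
    proof (intro allI impI, goal_cases)
      case (1 \<nu>)
      interpret cochain_product V W P \<nu>
        by unfold_locales (fact 1)+
      show ?case
      proof (intro conjI allI ballI, goal_cases)
        case 1
        show ?case by (rule N_dsum)
      next
        case 2
        show ?case by (rule pd_bilinear)
      next
        case (3 k1 c1 k2 c2 C1 C2)
        from pd_commute[OF this] show ?case unfolding E.map_scale_sign fst_conv snd_conv .
      next
        case (4 k1 c1 k2 c2 C1 C2)
        from D_pd[OF this] show ?case unfolding E.map_scale_sign .
      next
        case 5
        show ?case by (rule equiv_rel)
      next
        case (6 C1 C2)
        then show ?case by (rule pd_cocycle)
      next
        case 7
        show ?case by (rule pd_respects)
      next
        case (8 C1 C2)
        then show ?case by (rule coh_prod_cls)
      next
        case 9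
        show ?case by (rule coh_prod_bilinear)
      next
        case (10 k1 c1 k2 c2 h1 h2)
        from coh_prod_commute[OF this] show ?case unfolding fst_conv snd_conv .
      qed
    qed
  qed
qed

end
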